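(* Let $\mathsf{U}^\mathsf{t}\subseteq\{\neg,\mathbf{X},\mathbf{F},\mathbf{G}\}$ with $\mathbf{X}\in\mathsf{U}^\mathsf{t}$. Then for every $\mathsf{B}^\mathsf{l}\subseteq\mathrm{Bin}_{lg}$ and every $n\in\mathbb{N}$, the problem $\mathrm{CTL}_{\mathrm{Learn}}(\mathsf{U}^\mathsf{t},\emptyset,\mathsf{B}^\mathsf{l},n)$ is NP-complete.
   Context: $\mathrm{Bin}_{lg}$ is the set of binary logical operators $\vee,\wedge,\Rightarrow,\Leftarrow,\Leftrightarrow$ and their negations ($x(\neg* )y:=\neg(x*y)$). A Kripke structure is $\langle Q,I,\mathsf{Prop},\pi,\mathrm{Succ}\rangle$ with finite $Q$, initial states $I\subseteq Q$, labelling $\pi:Q\to2^{\mathsf{Prop}}$ and nonempty successor sets $\mathrm{Succ}(q)\subseteq Q$; its size is the number of edges plus $|\mathsf{Prop}|$ (up to polynomial equivalence). CTL formulas of the fragment $\mathrm{CTL}(\mathsf{Prop},\mathsf{U}^\mathsf{t},\emptyset,\mathsf{B}^\mathsf{l})$: $\phi::=p\mid\neg\phi\mid\phi*\phi\ ( *\in\mathsf{B}^\mathsf{l})\mid \exists\circ\phi\mid\forall\circ\phi$ with $\circ\in\mathsf{U}^\mathsf{t}\setminus\{\neg\}$, negation available only if $\neg\in\mathsf{U}^\mathsf{t}$. Semantics: $q\models\exists\circ\phi$ (resp. $\forall\circ\phi$) iff some (resp. every) infinite path $\rho$ from $q$ following $\mathrm{Succ}$ satisfies $\circ\phi$, where $\mathbf{X}\phi$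 holds iff $\rho[2]\models\phi$, $\mathbf{F}\phi$ iff $\rho[i]\models\phi$ for some $i\ge1$, $\mathbf{G}\phi$ iff for all $i\ge1$. A structure satisfies $\phi$ iff all its initial states do. $|\phi|$ is the number of distinct subformulas ($\exists\circ\phi$ counting as one), $|\phi|_{\mathrm{Bin}}$ the number of distinct subformulas of the form $\phi_1*\phi_2$. $\mathrm{CTL}_{\mathrm{Learn}}(\mathsf{U}^\mathsf{t},\emptyset,\mathsf{B}^\mathsf{l},n)$: input $(\mathsf{Prop},\mathcal{P},\mathcal{N},B)$ with $\mathcal{P},\mathcal{N}$ finite sets of Kripke structures and $B$ written in unary; yes iff there is $\phi$ in the fragment with $|\phi|\le B$, $|\phi|_{\mathrm{Bin}}\le n$, satisfied by every structure of $\mathcal{P}$ and by no structure of $\mathcal{N}$. *)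

theory Defs
  imports Main "HOL-Computational_Algebra.Polynomial"
begin

section \<open>Kripke structures and CTL\<close>

record ('q, 'p) kripke =
  states :: "'q set"
  init :: "'q set"
  props :: "'p set"
  label :: "'q \<Rightarrow> 'p set"
  succ :: "'q \<Rightarrow> 'q set"

definition is_kripke :: "('q, 'p) kripke \<Rightarrow> bool" where
  "is_kripke K \<longleftrightarrow>
     finite (states K) \<and> finite (props K) \<and> init K \<subseteq> states K \<and>
     (\<forall>q\<in>states K. label K q \<subseteq> props K \<and> succ K q \<noteq> {} \<and> succ K q \<subseteq> states K)"

text \<open>Paths are indexed from 0, so the first state of a path \<open>\<rho>\<close> is \<open>\<rho> 0\<close>.\<close>

definition paths :: "('q, 'p) kripke \<Rightarrow> 'q \<Rightarrow> (nat \<Rightarrow> 'q) set" where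
  "paths K q = {\<rho>. \<rho> 0 = q \<and> (\<forall>i. \<rho> (Suc i) \<in> succ K (\<rho> i))}"

datatype temp_op = Next | Finally | Globally

datatype unary_op = Negation | Temporal temp_op

datatype base_op = OrOp | AndOp | ImpliesOp | ImpliedByOp | IffOp

text \<open>This type has exactly ten elements: the five operators and their negations.\<close>

datatype bin_op = Plain base_op | Negated base_op

datatype 'p ctl =
    Atom 'p
  | Neg "'p ctl"
  | Bin bin_op "'p ctl" "'p ctl"
  | Exists temp_op "'p ctl"
  | Forall temp_op "'p ctl"

fun base_sem :: "base_op \<Rightarrow> bool \<Rightarrow> bool \<Rightarrow> bool" where
  "base_sem OrOp a b = (a \<or> b)"
| "base_sem AndOp a b = (a \<and> b)"
| "base_sem ImpliesOp a b = (a \<longrightarrow> b)"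
| "base_sem ImpliedByOp a b = (b \<longrightarrow> a)"
| "base_sem IffOp a b = (a \<longleftrightarrow> b)"

fun bin_sem :: "bin_op \<Rightarrow> bool \<Rightarrow> bool \<Rightarrow> bool" where
  "bin_sem (Plain b) x y = base_sem b x y"
| "bin_sem (Negated b) x y = (\<not> base_sem b x y)"

text \<open>The argument gives the truth value of the operand at each position of a path.\<close>

fun temp_sem :: "temp_op \<Rightarrow> (nat \<Rightarrow> bool) \<Rightarrow> bool" where
  "temp_sem Next \<sigma> = \<sigma> 1"
| "temp_sem Finally \<sigma> = (\<exists>i. \<sigma> i)"
| "temp_sem Globally \<sigma> = (\<forall>i. \<sigma> i)"

primrec sat :: "('q, 'p) kripke \<Rightarrow> 'p ctl \<Rightarrow> 'q \<Rightarrow> bool" where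
  "sat K (Atom p) q = (p \<in> label K q)"
| "sat K (Neg \<phi>) q = (\<not> sat K \<phi> q)"
| "sat K (Bin b \<phi> \<psi>) q = bin_sem b (sat K \<phi> q) (sat K \<psi> q)"
| "sat K (Exists t \<phi>) q = (\<exists>\<rho>\<in>paths K q. temp_sem t (\<lambda>i. sat K \<phi> (\<rho> i)))"
| "sat K (Forall t \<phi>) q = (\<forall>\<rho>\<in>paths K q. temp_sem t (\<lambda>i. sat K \<phi> (\<rho> i)))"

definition models :: "('q, 'p) kripke \<Rightarrow> 'p ctl \<Rightarrow> bool" where
  "models K \<phi> \<longleftrightarrow> (\<forall>q\<in>init K. sat K \<phi> q)"

inductive_set ctl_fragment :: "'p set \<Rightarrow> unary_op set \<Rightarrow> bin_op set \<Rightarrow> 'p ctl set"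
  for Ps :: "'p set" and Ut :: "unary_op set" and Bl :: "bin_op set" where
  Atom: "p \<in> Ps \<Longrightarrow> Atom p \<in> ctl_fragment Ps Ut Bl"
| Neg: "\<lbrakk>Negation \<in> Ut; \<phi> \<in> ctl_fragment Ps Ut Bl\<rbrakk> \<Longrightarrow> Neg \<phi> \<in> ctl_fragment Ps Ut Bl"
| Bin: "\<lbrakk>b \<in> Bl; \<phi> \<in> ctl_fragment Ps Ut Bl; \<psi> \<in> ctl_fragment Ps Ut Bl\<rbrakk>
        \<Longrightarrow> Bin b \<phi> \<psi> \<in> ctl_fragment Ps Ut Bl"
| Exists: "\<lbrakk>Temporal t \<in> Ut; \<phi> \<in> ctl_fragment Ps Ut Bl\<rbrakk> \<Longrightarrow> Exists t \<phi> \<in> ctl_fragment Ps Ut Bl"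
| Forall: "\<lbrakk>Temporal t \<in> Ut; \<phi> \<in> ctl_fragment Ps Ut Bl\<rbrakk> \<Longrightarrow> Forall t \<phi> \<in> ctl_fragment Ps Ut Bl"

primrec subformulas :: "'p ctl \<Rightarrow> 'p ctl set" where
  "subformulas (Atom p) = {Atom p}"
| "subformulas (Neg \<phi>) = insert (Neg \<phi>) (subformulas \<phi>)"
| "subformulas (Bin b \<phi> \<psi>) = insert (Bin b \<phi> \<psi>) (subformulas \<phi> \<union> subformulas \<psi>)"
| "subformulas (Exists t \<phi>) = insert (Exists t \<phi>) (subformulas \<phi>)"
| "subformulas (Forall t \<phi>) = insert (Forall t \<phi>) (subformulas \<phi>)"

definition fsize :: "'p ctl \<Rightarrow> nat" where
  "fsize \<phi> = card (subformulas \<phi>)"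

definition bin_size :: "'p ctl \<Rightarrow> nat" where
  "bin_size \<phi> = card {\<psi> \<in> subformulas \<phi>. \<exists>b \<psi>\<^sub>1 \<psi>\<^sub>2. \<psi> = Bin b \<psi>\<^sub>1 \<psi>\<^sub>2}"


section \<open>The learning problem\<close>

definition learn_instance ::
  "'p set \<Rightarrow> ('q, 'p) kripke set \<Rightarrow> ('q, 'p) kripke set \<Rightarrow> nat \<Rightarrow> bool" where
  "learn_instance Ps P N B \<longleftrightarrow>
     finite Ps \<and> finite P \<and> finite N \<and> (\<forall>K\<in>P \<union> N. is_kripke K \<and> props K = Ps)"

definition ctl_learn ::
  "unary_op set \<Rightarrow> bin_op set \<Rightarrow> nat \<Rightarrow>
   'p set \<Rightarrow> ('q, 'p) kripke set \<Rightarrow> ('q, 'p) kripke set \<Rightarrow> nat \<Rightarrow> bool" where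
  "ctl_learn Ut Bl n Ps P N B \<longleftrightarrow>
     (\<exists>\<phi>\<in>ctl_fragment Ps Ut Bl. fsize \<phi> \<le> B \<and> bin_size \<phi> \<le> n \<and>
        (\<forall>K\<in>P. models K \<phi>) \<and> (\<forall>K\<in>N. \<not> models K \<phi>))"

text \<open>
  Instances are written over the binary alphabet. Propositions and states are numbered
  consecutively from 0. All numbers are in unary; they are self-delimiting and determine the
  lengths of the blocks that follow them, so the code can be parsed from left to right. A
  structure with \<open>m\<close> states over \<open>k\<close> propositions takes \<open>(m + 1)\<^sup>2 + m * k\<close> bits. Every state has a
  successor, so \<open>m\<close> is at most the number of edges, which is at most \<open>m\<^sup>2\<close>.
\<close>

definition unary :: "nat \<Rightarrow> bool list" where
  "unary n = replicate n True @ [False]"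

definition encode_kripke :: "(nat, nat) kripke \<Rightarrow> bool list" where
  "encode_kripke K =
     (let m = card (states K); k = card (props K) in
        unary m @ map (\<lambda>q. q \<in> init K) [0..<m] @
        concat (map (\<lambda>q. map (\<lambda>p. p \<in> label K q) [0..<k] @
                         map (\<lambda>r. r \<in> succ K q) [0..<m]) [0..<m]))"

definition encode_kripkes :: "(nat, nat) kripke list \<Rightarrow> bool list" where
  "encode_kripkes Ks = unary (length Ks) @ concat (map encode_kripke Ks)"

definition encode_instance ::
  "nat \<Rightarrow> (nat, nat) kripke list \<Rightarrow> (nat, nat) kripke list \<Rightarrow> nat \<Rightarrow> bool list" where
  "encode_instance k Ps Ns B = unary k @ unary B @ encode_kripkes Ps @ encode_kripkes Ns"

definition CTL_Learn :: "unary_op set \<Rightarrow> bin_op set \<Rightarrow> nat \<Rightarrow> bool list set" where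
  "CTL_Learn Ut Bl n =
     {encode_instance k Ps Ns B | k Ps Ns B.
        learn_instance {..<k} (set Ps) (set Ns) B \<and>
        (\<forall>K\<in>set Ps \<union> set Ns. \<exists>m. states K = {..<m}) \<and>
        ctl_learn Ut Bl n {..<k} (set Ps) (set Ns) B}"


section \<open>Polynomial time and NP\<close>

text \<open>
  Deterministic multi-tape Turing machines with two-way infinite tapes. Symbols and states are
  natural numbers: symbol 0 is the blank, 1 and 2 stand for the bits, state 0 is the start state
  and \<open>num_states M\<close> is the halting state.
\<close>

datatype move = MoveLeft | Stay | MoveRight

record tm =
  num_tapes :: nat
  num_syms :: nat
  num_states :: nat
  delta :: "nat \<Rightarrow> nat list \<Rightarrow> nat \<times> (nat \<times> move) list"

definition is_tm :: "tm \<Rightarrow> bool" where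
  "is_tm M \<longleftrightarrow> num_tapes M \<ge> 1 \<and> num_syms M \<ge> 3 \<and>
     (\<forall>q rs q' as. q < num_states M \<and> length rs = num_tapes M \<and>
        (\<forall>s\<in>set rs. s < num_syms M) \<and> delta M q rs = (q', as) \<longrightarrow>
        q' \<le> num_states M \<and> length as = num_tapes M \<and> (\<forall>(s, d)\<in>set as. s < num_syms M))"

text \<open>A tape is its content together with the head position; a configuration is a state and the
  list of tapes.\<close>

type_synonym tape = "(int \<Rightarrow> nat) \<times> int"
type_synonym config = "nat \<times> tape list"

definition read :: "tape \<Rightarrow> nat" where
  "read T = fst T (snd T)"

fun offset :: "move \<Rightarrow> int" where
  "offset MoveLeft = -1"
| "offset Stay = 0"
| "offset MoveRight = 1"

definition act :: "nat \<times> move \<Rightarrow> tape \<Rightarrow> tape" where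
  "act a T = ((fst T)(snd T := fst a), snd T + offset (snd a))"

definition step :: "tm \<Rightarrow> config \<Rightarrow> config" where
  "step M c =
     (let (q, Ts) = c in
      if q < num_states M
      then let (q', as) = delta M q (map read Ts) in (q', map2 act as Ts)
      else c)"

definition sym :: "bool \<Rightarrow> nat" where
  "sym b = (if b then 2 else 1)"

definition word_tape :: "bool list \<Rightarrow> tape" where
  "word_tape x =
     ((\<lambda>i. if 0 \<le> i \<and> i < int (length x) then sym (x ! nat i) else 0), 0)"

text \<open>The arguments are on the first tapes, the heads on their first symbols; the remaining
  tapes are blank.\<close>

definition start_config :: "tm \<Rightarrow> bool list list \<Rightarrow> config" where
  "start_config M xs = (0, map word_tape (xs @ replicate (num_tapes M - length xs) []))"

text \<open>The word on a tape starts at the head and extends to the right up to the first blank.\<close>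

definition tape_word :: "tape \<Rightarrow> bool list \<Rightarrow> bool" where
  "tape_word T y \<longleftrightarrow>
     (\<forall>i<length y. fst T (snd T + int i) = sym (y ! i)) \<and> fst T (snd T + int (length y)) = 0"

text \<open>A halted configuration is not changed by \<open>step\<close>, so being halted after \<open>t\<close> steps means
  halting within \<open>t\<close> steps. The result is read off the first tape.\<close>

definition computes_within :: "tm \<Rightarrow> bool list list \<Rightarrow> bool list \<Rightarrow> nat \<Rightarrow> bool" where
  "computes_within M xs y t \<longleftrightarrow>
     (let (q, Ts) = (step M ^^ t) (start_config M xs)
      in q = num_states M \<and> tape_word (hd Ts) y)"

text \<open>Polynomial-time computability of functions of \<open>r\<close> words; only the values on lists of
  length \<open>r\<close> matter.\<close>

definition polytime :: "nat \<Rightarrow> (bool list list \<Rightarrow> bool list) \<Rightarrow> bool" where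
  "polytime r f \<longleftrightarrow>
     (\<exists>M (p :: nat poly). is_tm M \<and> r \<le> num_tapes M \<and>
        (\<forall>xs. length xs = r \<longrightarrow>
           computes_within M xs (f xs) (poly p (sum_list (map length xs)))))"

definition NP :: "bool list set set" where
  "NP = {L. \<exists>V (p :: nat poly). polytime 2 V \<and>
              (\<forall>x. x \<in> L \<longleftrightarrow> (\<exists>c. length c \<le> poly p (length x) \<and> V [x, c] = [True]))}"

definition poly_reducible :: "bool list set \<Rightarrow> bool list set \<Rightarrow> bool" where
  "poly_reducible L L' \<longleftrightarrow> (\<exists>f. polytime 1 f \<and> (\<forall>x. x \<in> L \<longleftrightarrow> f [x] \<in> L'))"

definition NP_hard :: "bool list set \<Rightarrow> bool" where
  "NP_hard L \<longleftrightarrow> (\<forall>L'\<in>NP. poly_reducible L' L)"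

definition NP_complete :: "bool list set \<Rightarrow> bool" where
  "NP_complete L \<longleftrightarrow> L \<in> NP \<and> NP_hard L"

end

theory Submission imports Defs
begin

text \<open>
  Membership in NP: a formula is certified as the list of its subformulas together with the truth
  values of each of them in all states of all structures. For \<open>F\<close> and \<open>G\<close> the truth values are least
  or greatest fixed points, which become locally checkable once every state is given a rank.

  Hardness: let \<open>a\<^sub>j\<close> be the state at distance \<open>j\<close> from a loop of states labelled \<open>p\<close> on a chain of
  otherwise unlabelled states. No formula with less than \<open>D\<close> nested \<open>X\<close>-operators distinguishes \<open>a\<^sub>D\<close>
  from \<open>a\<^bsub>D + 1\<^esub>\<close>, whatever other operators it contains, because all of them preserve being constant on
  the far part of the chain. Within size \<open>D + 1\<close> there is therefore only room for
  \<open>Q\<^sub>0 X \<dots> Q\<^bsub>D - 1\<^esub> X p\<close>, which is the same as a truth assignment to \<open>D\<close> variables. A positive example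
  can require one quantifier of a given set to be existential and a negative example can require one
  of them to be universal, which suffices to express the clauses of the Cook--Levin tableau.

  Both directions need polynomial-time Turing machines. All required functions are defined by
  arithmetic terms with bounded sums over bits and lengths of the inputs. Such terms have
  polynomially bounded values, so they can be evaluated in unary on tapes used as counters.
\<close>

section \<open>Structured programs for Turing machines\<close>

text \<open>The size budget is spent completely: depth \<open>D\<close> of Next plus one atom
  already means \<open>D + 1\<close> subformulas, and no binary operator occurs in
  \<open>xform\<close>. This is why one reduction serves all \<open>Bl\<close>, all \<open>n\<close>
  and all further unary operators, which enter membership only as side conditions on certificate
  nodes. A positive example can only ask for existential quantifiers and a negative one only for
  universal ones, so literals of both signs take two quantifiers per variable; negative examples
  forbid that both are existential. Both being universal is harmless, as the demands of the clauses
  are monotone. A clause of any length costs one structure, so the tableau is translated directly.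
  Tableau and translation form a single term, hence closure of polynomial time under composition
  never has to be proved. On the machine side every time bound concerns a concrete Turing machine;
  storing a number as a head position makes increment, decrement and zero test cheap and leaves the
  tape contents untouched.\<close>

datatype prog =
    Mv nat move
  | Wr nat nat move
  | Seq prog prog
  | If nat "nat \<Rightarrow> bool" prog prog
  | While nat "nat \<Rightarrow> bool" prog

text \<open>Running times are exact, so that a derivation translates into a power of
  \<open>step\<close>. \<open>Wr\<close> caps the symbol at 3, which keeps every program inside the
  alphabet of \<open>tm_of\<close>: blank, two bits and a marker 3.\<close>

inductive exec :: "prog \<Rightarrow> tape list \<Rightarrow> nat \<Rightarrow> tape list \<Rightarrow> bool" where
  Mv: "j < length Ts \<Longrightarrow> exec (Mv j d) Ts 1 (Ts[j := act (read (Ts ! j), d) (Ts ! j)])"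
| Wr: "j < length Ts \<Longrightarrow> exec (Wr j s d) Ts 1 (Ts[j := act (min s 3, d) (Ts ! j)])"
| Seq: "exec c1 Ts t1 Ts1 \<Longrightarrow> exec c2 Ts1 t2 Ts2 \<Longrightarrow> exec (Seq c1 c2) Ts (t1 + t2) Ts2"
| IfT: "j < length Ts \<Longrightarrow> P (read (Ts ! j)) \<Longrightarrow> exec c1 Ts t Ts' \<Longrightarrow> exec (If j P c1 c2) Ts (Suc t) Ts'"
| IfF: "j < length Ts \<Longrightarrow> \<not> P (read (Ts ! j)) \<Longrightarrow> exec c2 Ts t Ts' \<Longrightarrow> exec (If j P c1 c2) Ts (Suc t) Ts'"
| WhileF: "j < length Ts \<Longrightarrow> \<not> P (read (Ts ! j)) \<Longrightarrow> exec (While j P c) Ts 1 Ts"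
| WhileT: "j < length Ts \<Longrightarrow> P (read (Ts ! j)) \<Longrightarrow> exec c Ts t1 Ts1 \<Longrightarrow> exec (While j P c) Ts1 t2 Ts2 \<Longrightarrow>
    exec (While j P c) Ts (Suc (t1 + t2)) Ts2"

fun psize :: "prog \<Rightarrow> nat" where
  "psize (Mv j d) = 1"
| "psize (Wr j s d) = 1"
| "psize (Seq c1 c2) = psize c1 + psize c2"
| "psize (If j P c1 c2) = Suc (psize c1 + psize c2)"
| "psize (While j P c) = Suc (psize c)"

definition stay :: "nat list \<Rightarrow> (nat \<times> move) list" where
  "stay rs = map (\<lambda>s. (s, Stay)) rs"

text \<open>The states of a program are \<open>0, \<dots>, psize c\<close>, where \<open>psize c\<close> is the exit.\<close>

fun code :: "prog \<Rightarrow> nat \<Rightarrow> nat list \<Rightarrow> nat \<times> (nat \<times> move) list" where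
  "code (Mv j d) q rs = (1, (stay rs)[j := (rs ! j, d)])"
| "code (Wr j s d) q rs = (1, (stay rs)[j := (min s 3, d)])"
| "code (Seq c1 c2) q rs =
     (if q < psize c1 then code c1 q rs
      else apfst (\<lambda>q'. psize c1 + q') (code c2 (q - psize c1) rs))"
| "code (If j P c1 c2) q rs =
     (case q of 0 \<Rightarrow> (if P (rs ! j) then 1 else Suc (psize c1), stay rs)
      | Suc p \<Rightarrow> if p < psize c1
          then apfst (\<lambda>q'. if q' = psize c1 then Suc (psize c1 + psize c2) else Suc q') (code c1 p rs)
          else apfst (\<lambda>q'. Suc (psize c1 + q')) (code c2 (p - psize c1) rs))"
| "code (While j P c) q rs =
     (case q of 0 \<Rightarrow> (if P (rs ! j) then 1 else Suc (psize c), stay rs)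
      | Suc p \<Rightarrow> apfst (\<lambda>q'. if q' = psize c then 0 else Suc q') (code c p rs))"

text \<open>\<open>e\<close> places the states of \<open>c\<close> inside \<open>M\<close>. Its
  value at the exit \<open>psize c\<close> is left unconstrained: the exit may become the entry of
  the next program, the head of a loop or the halting state.\<close>

definition embeds :: "tm \<Rightarrow> prog \<Rightarrow> (nat \<Rightarrow> nat) \<Rightarrow> bool" where
  "embeds M c e \<longleftrightarrow> (\<forall>q<psize c. e q < num_states M \<and>
     (\<forall>rs. delta M (e q) rs = apfst e (code c q rs)))"

lemma psize_pos: "0 < psize c"
  by (induction c) auto

lemma code_le: "q < psize c \<Longrightarrow> fst (code c q rs) \<le> psize c"
proof (induction c arbitrary: q)
  case (Seq c1 c2)
  show ?case
    using Seq.IH(1)[of q] Seq.IH(2)[of "q - psize c1"] Seq.prems by auto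
next
  case (If j P c1 c2)
  show ?case
  proof (cases q)
    case (Suc p)
    show ?thesis
      using If.IH(1)[of p] If.IH(2)[of "p - psize c1"] If.prems Suc by auto
  qed auto
next
  case (While j P c)
  show ?case
  proof (cases q)
    case (Suc p)
    show ?thesis
      using While.IH[of p] While.prems Suc by auto
  qed auto
qed auto

lemma code_acts:
  "length (snd (code c q rs)) = length rs \<and>
   (\<forall>a\<in>set (snd (code c q rs)). (\<forall>s\<in>set rs. s < 4) \<longrightarrow>
      fst a < 4)"
proof (induction c arbitrary: q)
  case (Mv j d)
  show ?case
    by (cases "j < length rs")
      (auto simp: stay_def not_less list_update_beyond dest!: set_update_subset_insert[THEN subsetD])
next
  case (Wr j s d)
  show ?case
    by (auto simp: stay_def dest!: set_update_subset_insert[THEN subsetD])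
next
  case (Seq c1 c2)
  show ?case using Seq.IH by auto
next
  case (If j P c1 c2)
  show ?case using If.IH by (auto split: nat.split simp: stay_def)
next
  case (While j P c)
  show ?case using While.IH by (auto split: nat.split simp: stay_def)
qed

lemma act_stay: "act (read T, Stay) T = T"
  by (simp add: act_def read_def)

lemma map2_stay: "map2 act (stay (map read Ts)) Ts = Ts"
  by (rule nth_equalityI) (auto simp: stay_def act_stay)

lemma map2_stay_update:
  "j < length Ts \<Longrightarrow> map2 act ((stay (map read Ts))[j := a]) Ts = Ts[j := act a (Ts ! j)]"
  by (rule nth_equalityI) (auto simp: stay_def act_stay nth_list_update)

lemma step_embeds:
  "embeds M c e \<Longrightarrow> q < psize c \<Longrightarrow>
   step M (e q, Ts) = (e (fst (code c q (map read Ts))), map2 act (snd (code c q (map read Ts))) Ts)"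
  by (auto simp: step_def embeds_def apfst_def map_prod_def split: prod.splits)

lemma embeds_sub:
  assumes "embeds M c e"
    and "\<And>q. q < psize c' \<Longrightarrow> f q < psize c"
    and "\<And>q rs. q < psize c' \<Longrightarrow> code c (f q) rs = apfst f (code c' q rs)"
  shows "embeds M c' (e \<circ> f)"
  using assms by (auto simp: embeds_def apfst_def map_prod_def split: prod.splits)

lemma funpow_compose: "(f ^^ m) x = y \<Longrightarrow> (f ^^ n) y = z \<Longrightarrow> (f ^^ (m + n)) x = z"
  by (subst add.commute) (simp add: funpow_add)

text \<open>The generalisation over the placement \<open>e\<close> carries the induction: each
  construct hands to its parts \<open>e\<close> composed with the renumbering of states in
  \<open>code\<close>, so the layout of the whole machine never has to be described.\<close>

lemma exec_step:
  "exec c Ts t Ts' \<Longrightarrow> embeds M c e \<Longrightarrow> (step M ^^ t) (e 0, Ts) = (e (psize c), Ts')"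
proof (induction arbitrary: e rule: exec.induct)
  case (Mv j Ts d)
  then show ?case using step_embeds[OF Mv.prems, of 0 Ts] by (simp add: map2_stay_update)
next
  case (Wr j Ts s d)
  then show ?case using step_embeds[OF Wr.prems, of 0 Ts] by (simp add: map2_stay_update)
next
  case (Seq c1 Ts t1 Ts1 c2 t2 Ts2)
  have e1: "embeds M c1 (e \<circ> (\<lambda>q. q))"
    by (rule embeds_sub[OF Seq.prems]) (auto simp: apfst_def map_prod_def)
  have e2: "embeds M c2 (e \<circ> (\<lambda>q. psize c1 + q))"
    by (rule embeds_sub[OF Seq.prems]) auto
  show ?case
    using funpow_compose[OF Seq.IH(1)[OF e1, unfolded o_def] Seq.IH(2)[OF e2, unfolded o_def, simplified]]
    by simp
next
  case (IfT j Ts P c1 t Ts' c2)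
  \<comment> \<open>The exit of the first branch jumps over the code of the second one to the common
    exit.\<close>
  have e1: "embeds M c1 (e \<circ> (\<lambda>q'. if q' = psize c1 then Suc (psize c1 + psize c2) else Suc q'))"
    by (rule embeds_sub[OF IfT.prems]) (auto)
  have 1: "(step M ^^ 1) (e 0, Ts) = (e (Suc 0), Ts)"
    using step_embeds[OF IfT.prems, of 0 Ts] IfT.hyps by (simp add: map2_stay)
  show ?case
    using funpow_compose[OF 1 IfT.IH[OF e1, unfolded o_def, simplified psize_pos[of c1, THEN less_not_refl2[THEN not_sym]], simplified]] psize_pos[of c1]
    by simp
next
  case (IfF j Ts P c2 t Ts' c1)
  have e1: "embeds M c2 (e \<circ> (\<lambda>q'. Suc (psize c1 + q')))"
    by (rule embeds_sub[OF IfF.prems]) (auto)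
  have 1: "(step M ^^ 1) (e 0, Ts) = (e (Suc (psize c1)), Ts)"
    using step_embeds[OF IfF.prems, of 0 Ts] IfF.hyps by (simp add: map2_stay)
  show ?case
    using funpow_compose[OF 1 IfF.IH[OF e1, unfolded o_def, simplified]] by simp
next
  case (WhileF j Ts P c)
  then show ?case using step_embeds[OF WhileF.prems, of 0 Ts] by (simp add: map2_stay)
next
  case (WhileT j Ts P c t1 Ts1 t2 Ts2)
  \<comment> \<open>The exit of the body is identified with state 0, the test of the loop.\<close>
  have e1: "embeds M c (e \<circ> (\<lambda>q'. if q' = psize c then 0 else Suc q'))"
    by (rule embeds_sub[OF WhileT.prems]) (auto)
  have 1: "(step M ^^ 1) (e 0, Ts) = (e (Suc 0), Ts)"
    using step_embeds[OF WhileT.prems, of 0 Ts] WhileT.hyps by (simp add: map2_stay)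
  have 2: "(step M ^^ t1) (e (Suc 0), Ts) = (e 0, Ts1)"
    using WhileT.IH(1)[OF e1] psize_pos[of c] by simp
  show ?case
    using funpow_compose[OF funpow_compose[OF 1 2] WhileT.IH(2)[OF WhileT.prems]] by simp
qed

definition tm_of :: "nat \<Rightarrow> prog \<Rightarrow> tm" where
  "tm_of k c = \<lparr>num_tapes = k, num_syms = 4, num_states = psize c, delta = code c\<rparr>"

lemma is_tm_tm_of: "1 \<le> k \<Longrightarrow> is_tm (tm_of k c)"
  unfolding is_tm_def tm_of_def
proof (simp, intro allI impI)
  fix q rs q' as
  assume "q < psize c \<and> length rs = k \<and> (\<forall>s\<in>set rs. s < 4) \<and> code c q rs = (q', as)"
  then show "q' \<le> psize c \<and> length as = k \<and> (\<forall>(s, d)\<in>set as. s < 4)"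
    using code_le[of q c rs] code_acts[of c q rs] by (auto split: prod.splits)
qed

lemma exec_tm_of:
  assumes "exec c Ts t Ts'"
  shows "(step (tm_of k c) ^^ t) (0, Ts) = (num_states (tm_of k c), Ts')"
  using exec_step[OF assms, of "tm_of k c" "\<lambda>q. q"]
  by (simp add: embeds_def tm_of_def apfst_def map_prod_def)

lemma step_halted: "step M (num_states M, Ts) = (num_states M, Ts)"
  by (simp add: step_def)

lemma steps_halted: "(step M ^^ t) (num_states M, Ts) = (num_states M, Ts)"
  by (induction t) (auto simp: step_halted)

section \<open>Counters as head positions\<close>

definition list_tape :: "nat list \<Rightarrow> int \<Rightarrow> tape" where
  "list_tape ss h = ((\<lambda>i. if 0 \<le> i \<and> i < int (length ss) then ss ! nat i else 0), h)"

lemma read_list_tape: "read (list_tape ss (int h)) = (if h < length ss then ss ! h else 0)"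
  by (simp add: read_def list_tape_def)

lemma act_read_list_tape: "act (read (list_tape ss h), d) (list_tape ss h) = list_tape ss (h + offset d)"
  by (auto simp: act_def read_def list_tape_def fun_eq_iff)

lemma act_append_list_tape: "act (s, MoveRight) (list_tape ss (int (length ss))) = list_tape (ss @ [s]) (int (Suc (length ss)))"
  by (auto simp: act_def list_tape_def nth_append fun_eq_iff)

lemma word_tape_list_tape: "word_tape w = list_tape (map sym w) 0"
  by (auto simp: word_tape_def list_tape_def fun_eq_iff)

text \<open>Tape 0 holds a fixed prefix and the output so far, with the head on the first free cell.
  Tape \<open>Suc i\<close> keeps the content \<open>cn i\<close> forever; its datum is the head
  position \<open>hs i\<close>.\<close>

definition tapes :: "nat list \<Rightarrow> (nat \<Rightarrow> nat list) \<Rightarrow> nat \<Rightarrow> bool list \<Rightarrow> (nat \<Rightarrow> nat) \<Rightarrow> tape list" where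
  "tapes pre cn K out hs =
     list_tape (pre @ map sym out) (int (length pre + length out)) # map (\<lambda>i. list_tape (cn i) (int (hs i))) [0..<K]"

lemma tapes_nth: "i < K \<Longrightarrow> tapes pre cn K out hs ! Suc i = list_tape (cn i) (int (hs i))"
  by (simp add: tapes_def)

lemma tapes_length: "length (tapes pre cn K out hs) = Suc K"
  by (simp add: tapes_def)

lemma tapes_update: "i < K \<Longrightarrow> (tapes pre cn K out hs)[Suc i := list_tape (cn i) (int h)] = tapes pre cn K out (hs(i := h))"
  by (auto simp: tapes_def intro!: nth_equalityI simp: nth_list_update)

lemma tapes_output:
  "(tapes pre cn K out hs)[0 := act (sym b, MoveRight) (tapes pre cn K out hs ! 0)] = tapes pre cn K (out @ [b]) hs"
  using act_append_list_tape[of "sym b" "pre @ map sym out"] by (simp add: tapes_def)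

definition skip :: prog where "skip = Mv 0 Stay"
definition inc :: "nat \<Rightarrow> prog" where "inc i = Mv (Suc i) MoveRight"
definition dec :: "nat \<Rightarrow> prog" where "dec i = Mv (Suc i) MoveLeft"
definition emit :: "bool \<Rightarrow> prog" where "emit b = Wr 0 (sym b) MoveRight"
text \<open>On a counter tape with the single marker 3 at cell 0 the symbol 3 is read exactly at
  position 0, so the test asks whether the counter is nonzero.\<close>

definition loop :: "nat \<Rightarrow> prog \<Rightarrow> prog" where
  "loop i c = While (Suc i) (\<lambda>s. s \<noteq> 3) (Seq (dec i) c)"

locale counters =
  fixes pre :: "nat list" and cn :: "nat \<Rightarrow> nat list" and K :: nat
begin

definition runs :: "prog \<Rightarrow> bool list \<Rightarrow> (nat \<Rightarrow> nat) \<Rightarrow> nat \<Rightarrow> bool list \<Rightarrow> (nat \<Rightarrow> nat) \<Rightarrow> bool" where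
  "runs c out hs t out' hs' \<longleftrightarrow> (\<exists>t'\<le>t. exec c (tapes pre cn K out hs) t' (tapes pre cn K out' hs'))"

definition rd :: "(nat \<Rightarrow> nat) \<Rightarrow> nat \<Rightarrow> nat" where
  "rd hs i = (if hs i < length (cn i) then cn i ! hs i else 0)"

lemma runs_mono: "runs c out hs t out' hs' \<Longrightarrow> t \<le> t' \<Longrightarrow> runs c out hs t' out' hs'"
  unfolding runs_def using le_trans by blast

lemma runs_eq: "runs c out hs t out' hs' \<Longrightarrow> hs' = hs'' \<Longrightarrow> t \<le> t' \<Longrightarrow> runs c out hs t' out' hs''"
  using runs_mono by blast

lemma runsI: "exec c (tapes pre cn K out hs) t (tapes pre cn K out' hs') \<Longrightarrow> runs c out hs t out' hs'"
  unfolding runs_def by blast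

lemma runs_skip: "runs skip out hs 1 out hs"
proof (rule runsI)
  show "exec skip (tapes pre cn K out hs) 1 (tapes pre cn K out hs)"
    using exec.Mv[of 0 "tapes pre cn K out hs" Stay] by (simp add: skip_def act_stay tapes_length)
qed

lemma runs_Mv:
  assumes "i < K" "int (hs i) + offset d = int h"
  shows "runs (Mv (Suc i) d) out hs 1 out (hs(i := h))"
proof (rule runsI)
  have "exec (Mv (Suc i) d) (tapes pre cn K out hs) 1
     ((tapes pre cn K out hs)[Suc i := act (read (tapes pre cn K out hs ! Suc i), d) (tapes pre cn K out hs ! Suc i)])"
    by (rule exec.Mv) (simp add: tapes_length assms)
  also have "(tapes pre cn K out hs)[Suc i := act (read (tapes pre cn K out hs ! Suc i), d) (tapes pre cn K out hs ! Suc i)]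
     = tapes pre cn K out (hs(i := h))"
    using assms tapes_update[OF assms(1), of pre cn out hs h] by (simp only: tapes_nth act_read_list_tape)
  finally show "exec (Mv (Suc i) d) (tapes pre cn K out hs) 1 (tapes pre cn K out (hs(i := h)))" .
qed

lemma runs_inc: "i < K \<Longrightarrow> runs (inc i) out hs 1 out (hs(i := Suc (hs i)))"
  unfolding inc_def by (rule runs_Mv) auto

lemma runs_dec: "i < K \<Longrightarrow> runs (dec i) out (hs(i := Suc h)) 1 out (hs(i := h))"
  unfolding dec_def using runs_Mv[of i "hs(i := Suc h)" MoveLeft h out] by simp

lemma runs_emit: "runs (emit b) out hs 1 (out @ [b]) hs"
proof (rule runsI)
  have "exec (emit b) (tapes pre cn K out hs) 1
     ((tapes pre cn K out hs)[0 := act (min (sym b) 3, MoveRight) (tapes pre cn K out hs ! 0)])"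
    unfolding emit_def by (rule exec.Wr) (simp add: tapes_length)
  moreover have "min (sym b) 3 = sym b" by (simp add: sym_def)
  ultimately show "exec (emit b) (tapes pre cn K out hs) 1 (tapes pre cn K (out @ [b]) hs)"
    by (simp only: tapes_output)
qed

lemma runsE:
  assumes "runs c out hs t out' hs'"
  obtains t' where "t' \<le> t" "exec c (tapes pre cn K out hs) t' (tapes pre cn K out' hs')"
  using assms unfolding runs_def by blast

lemma runs_Seq:
  assumes "runs c1 out hs t1 out1 hs1" "runs c2 out1 hs1 t2 out2 hs2"
  shows "runs (Seq c1 c2) out hs (t1 + t2) out2 hs2"
  by (rule runsE[OF assms(1)], rule runsE[OF assms(2)], rule runs_mono[OF runsI[OF exec.Seq]]) auto

lemma read_tapes: "i < K \<Longrightarrow> read (tapes pre cn K out hs ! Suc i) = rd hs i"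
  by (simp add: tapes_nth read_list_tape rd_def)

lemma runs_If:
  assumes "i < K"
    and 1: "P (rd hs i) \<Longrightarrow> runs c1 out hs t out' hs'"
    and 2: "\<not> P (rd hs i) \<Longrightarrow> runs c2 out hs t out' hs'"
  shows "runs (If (Suc i) P c1 c2) out hs (Suc t) out' hs'"
proof (cases "P (rd hs i)")
  case True
  show ?thesis
    by (rule runsE[OF 1[OF True]], rule runs_mono[OF runsI[OF exec.IfT]])
      (use True assms(1) in \<open>auto simp: tapes_length read_tapes\<close>)
next
  case False
  show ?thesis
    by (rule runsE[OF 2[OF False]], rule runs_mono[OF runsI[OF exec.IfF]])
      (use False assms(1) in \<open>auto simp: tapes_length read_tapes\<close>)
qed

lemma runs_While:
  assumes "i < K"
    and "\<And>j. j < n \<Longrightarrow> P (rd (H j) i)"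
    and "\<And>j. j < n \<Longrightarrow> runs c (Q j) (H j) t (Q (Suc j)) (H (Suc j))"
    and "\<not> P (rd (H n) i)"
  shows "runs (While (Suc i) P c) (Q 0) (H 0) (n * (t + 1) + 1) (Q n) (H n)"
  using assms
proof (induction n arbitrary: H Q)
  case 0
  have "exec (While (Suc i) P c) (tapes pre cn K (Q 0) (H 0)) 1 (tapes pre cn K (Q 0) (H 0))"
    by (rule exec.WhileF) (use 0 in \<open>auto simp: tapes_length read_tapes\<close>)
  then show ?case by (simp add: runsI)
next
  case (Suc n)
  have "runs (While (Suc i) P c) (Q (Suc 0)) (H (Suc 0)) (n * (t + 1) + 1) (Q (Suc n)) (H (Suc n))"
    using Suc.IH[of "\<lambda>j. H (Suc j)" "\<lambda>j. Q (Suc j)"] Suc.prems by simp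
  then obtain t2 where t2: "t2 \<le> n * (t + 1) + 1"
    "exec (While (Suc i) P c) (tapes pre cn K (Q (Suc 0)) (H (Suc 0))) t2 (tapes pre cn K (Q (Suc n)) (H (Suc n)))"
    by (rule runsE)
  have "runs c (Q 0) (H 0) t (Q (Suc 0)) (H (Suc 0))" using Suc.prems(3)[of 0] by simp
  then obtain t1 where t1: "t1 \<le> t" "exec c (tapes pre cn K (Q 0) (H 0)) t1 (tapes pre cn K (Q (Suc 0)) (H (Suc 0)))"
    by (rule runsE)
  have "exec (While (Suc i) P c) (tapes pre cn K (Q 0) (H 0)) (Suc (t1 + t2)) (tapes pre cn K (Q (Suc n)) (H (Suc n)))"
    by (rule exec.WhileT[OF _ _ t1(2) t2(2)])
      (use Suc.prems(1) Suc.prems(2)[of 0] in \<open>auto simp: tapes_length read_tapes\<close>)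
  moreover have "Suc (t1 + t2) \<le> Suc n * (t + 1) + 1" using t1(1) t2(1) by simp
  ultimately show ?case using runs_mono[OF runsI] by blast
qed

text \<open>The decrement comes before the body, so round \<open>j\<close> runs with
  \<open>n - Suc j\<close> in the loop counter. \<open>H\<close> describes the other counters; its
  entry at \<open>i\<close> is overwritten.\<close>

lemma runs_loop:
  assumes "i < K" and "cn i = [3]"
    and body: "\<And>j. j < n \<Longrightarrow>
      runs c (Q j) ((H j)(i := n - Suc j)) t (Q (Suc j)) ((H (Suc j))(i := n - Suc j))"
  shows "runs (loop i c) (Q 0) ((H 0)(i := n)) (n * (t + 2) + 1) (Q n) ((H n)(i := 0))"
proof -
  have "runs (While (Suc i) (\<lambda>s. s \<noteq> 3) (Seq (dec i) c)) (Q 0) ((\<lambda>j. (H j)(i := n - j)) 0)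
     (n * ((1 + t) + 1) + 1) (Q n) ((\<lambda>j. (H j)(i := n - j)) n)"
  proof (rule runs_While)
    fix j assume j: "j < n"
    then show "rd ((H j)(i := n - j)) i \<noteq> 3" by (simp add: rd_def assms(2))
    have "runs (dec i) (Q j) ((H j)(i := n - j)) 1 (Q j) ((H j)(i := n - Suc j))"
      using runs_dec[OF assms(1), of "Q j" "H j" "n - Suc j"] j by (simp add: Suc_diff_Suc)
    from runs_Seq[OF this body[OF j]]
    show "runs (Seq (dec i) c) (Q j) ((H j)(i := n - j)) (1 + t) (Q (Suc j)) ((H (Suc j))(i := n - Suc j))" .
  qed (use assms in \<open>auto simp: rd_def\<close>)
  then show ?thesis by (simp add: loop_def)
qed

lemma runs_loop_gen:
  assumes "i < K" and "cn i = [3]"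
    and "\<And>j. j < n \<Longrightarrow> runs c (Q j) ((H j)(i := n - Suc j)) t (Q (Suc j)) ((H (Suc j))(i := n - Suc j))"
    and "hs = (H 0)(i := n)" and "hs' = (H n)(i := 0)" and "out = Q 0" and "out' = Q n" and "n * (t + 2) + 1 \<le> t'"
  shows "runs (loop i c) out hs t' out' hs'"
  using runs_eq[OF runs_loop[of i n c Q H t]] assms by simp

lemma runs_loop_same:
  assumes "i < K" and "cn i = [3]"
    and "\<And>j. j < n \<Longrightarrow> runs c out ((H j)(i := n - Suc j)) t out ((H (Suc j))(i := n - Suc j))"
    and "hs = (H 0)(i := n)" and "hs' = (H n)(i := 0)" and "n * (t + 2) + 1 \<le> t'"
  shows "runs (loop i c) out hs t' out hs'"
  using runs_eq[OF runs_loop[of i n c "\<lambda>_. out" H t]] assms by simp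

lemma runs_transfer:
  assumes "i < K" "cn i = [3]" "d < K" "d \<noteq> i"
  shows "runs (loop i (inc d)) out (hs(i := n)) (3 * n + 1) out (hs(i := 0, d := hs d + n))"
proof (rule runs_loop_same[OF assms(1,2), where H = "\<lambda>j. hs(d := hs d + j)" and t = 1])
  fix j
  show "runs (inc d) out ((hs(d := hs d + j))(i := n - Suc j)) 1 out ((hs(d := hs d + Suc j))(i := n - Suc j))"
    by (rule runs_eq[OF runs_inc[OF assms(3)]]) (use assms(4) in auto)
qed (use assms(4) in auto)

lemma runs_clear:
  assumes "i < K" "cn i = [3]"
  shows "runs (loop i skip) out (hs(i := n)) (3 * n + 1) out (hs(i := 0))"
  by (rule runs_eq[OF runs_loop[OF assms, of n skip "\<lambda>_. out" "\<lambda>_. hs" 1]]) (use runs_skip in auto)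

end

section \<open>Arithmetic expressions with bounded sums\<close>

text \<open>Products, comparisons and bounded quantifiers are derived from sums and truncated
  subtraction, which keeps the compiler small. The only iteration is a sum whose range is computed
  beforehand, so values cannot outgrow a polynomial.\<close>

datatype expr =
    Cn nat
  | Vr nat
  | Add expr expr
  | Sub expr expr
  | Sm expr expr
  | Lk nat expr
  | Ln nat

definition word :: "bool list list \<Rightarrow> nat \<Rightarrow> bool list" where
  "word ws k = (if k < length ws then ws ! k else [])"

definition bit :: "bool list \<Rightarrow> nat \<Rightarrow> bool" where
  "bit w i \<longleftrightarrow> i < length w \<and> w ! i"

primrec eval :: "expr \<Rightarrow> bool list list \<Rightarrow> (nat \<Rightarrow> nat) \<Rightarrow> nat" where
  "eval (Cn c) ws ns = c"
| "eval (Vr v) ws ns = ns v"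
| "eval (Add a b) ws ns = eval a ws ns + eval b ws ns"
| "eval (Sub a b) ws ns = eval a ws ns - eval b ws ns"
| "eval (Sm a b) ws ns = (\<Sum>j<eval a ws ns. eval b ws (case_nat j ns))"
| "eval (Lk k a) ws ns = of_bool (bit (word ws k) (eval a ws ns))"
| "eval (Ln k) ws ns = length (word ws k)"

primrec scratch :: "expr \<Rightarrow> nat" where
  "scratch (Cn c) = 1"
| "scratch (Vr v) = 2"
| "scratch (Add a b) = scratch a + scratch b + 2"
| "scratch (Sub a b) = scratch a + scratch b + 2"
| "scratch (Sm a b) = scratch a + scratch b + 4"
| "scratch (Lk k a) = scratch a + 3"
| "scratch (Ln k) = 2"

text \<open>Counters below \<open>r\<close> are the input tapes, \<open>\<rho> v\<close> holds the
  variable \<open>v\<close>, the result goes to \<open>d\<close>, and the counters above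
  \<open>d\<close> are free. Counting down destroys a counter, so a variable is moved to two
  counters and restored from the second; an input head is taken back by the recorded distance. In a
  sum, \<open>d + 1\<close> is the index seen by the body, \<open>d + 2\<close> the number of rounds
  left and \<open>d + 3\<close> the summand.\<close>

primrec comp :: "nat \<Rightarrow> expr \<Rightarrow> (nat \<Rightarrow> nat) \<Rightarrow> nat \<Rightarrow> prog" where
  "comp r (Cn c) \<rho> d = ((\<lambda>p. Seq p (inc d)) ^^ c) skip"
| "comp r (Vr v) \<rho> d = Seq (loop (\<rho> v) (Seq (inc d) (inc (Suc d)))) (loop (Suc d) (inc (\<rho> v)))"
| "comp r (Add a b) \<rho> d = Seq (Seq (comp r a \<rho> d) (comp r b \<rho> (Suc d))) (loop (Suc d) (inc d))"
| "comp r (Sub a b) \<rho> d = Seq (Seq (comp r a \<rho> d) (comp r b \<rho> (Suc d)))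
     (loop (Suc d) (If (Suc d) (\<lambda>s. s = 3) skip (dec d)))"
| "comp r (Sm a b) \<rho> d = Seq (comp r a \<rho> (d + 2))
     (Seq (loop (d + 2) (Seq (comp r b (case_nat (d + 1) \<rho>) (d + 3))
        (Seq (loop (d + 3) (inc d)) (inc (d + 1)))))
       (loop (d + 1) skip))"
| "comp r (Lk k a) \<rho> d =
     (if k < r then Seq (comp r a \<rho> (d + 1)) (Seq (loop (d + 1) (Seq (inc (d + 2)) (inc k)))
        (Seq (If (Suc k) (\<lambda>s. s = 2) (inc d) skip) (loop (d + 2) (dec k)))) else skip)"
| "comp r (Ln k) \<rho> d =
     (if k < r then Seq (While (Suc k) (\<lambda>s. s \<noteq> 0) (Seq (inc k) (Seq (inc d) (inc (d + 1)))))
        (loop (d + 1) (dec k)) else skip)"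

lemma poly_nat_mono: "x \<le> y \<Longrightarrow> poly (p :: nat poly) x \<le> poly p y"
  by (induction p) (auto intro!: add_mono mult_mono)

lemma length_word_le: "\<forall>w\<in>set ws. length w \<le> N \<Longrightarrow> length (word ws k) \<le> N"
  by (simp add: word_def)

definition bnd :: "expr \<Rightarrow> nat poly \<Rightarrow> bool" where
  "bnd e p \<longleftrightarrow> (\<forall>ws ns N. (\<forall>w\<in>set ws. length w \<le> N) \<longrightarrow> (\<forall>i. ns i \<le> N) \<longrightarrow> eval e ws ns \<le> poly p N)"

text \<open>Under a sum the fresh index stays below the bound \<open>poly p N\<close> of the range,
  so the bound of the body is composed with \<open>N + poly p N\<close>.\<close>

lemma eval_bound: "\<exists>p. bnd e p"
  unfolding bnd_def
proof (induction e)
  case (Cn c)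
  then show ?case by (intro exI[of _ "[:c:]"]) auto
next
  case (Vr v)
  then show ?case by (intro exI[of _ "[:0, 1:]"]) auto
next
  case (Add a b)
  then obtain p q where "\<forall>ws ns N. (\<forall>w\<in>set ws. length w \<le> N) \<longrightarrow> (\<forall>i. ns i \<le> N) \<longrightarrow> eval a ws ns \<le> poly p N"
    "\<forall>ws ns N. (\<forall>w\<in>set ws. length w \<le> N) \<longrightarrow> (\<forall>i. ns i \<le> N) \<longrightarrow> eval b ws ns \<le> poly q N" by blast
  then show ?case by (intro exI[of _ "p + q"]) (auto intro: add_mono)
next
  case (Sub a b)
  then obtain p where "\<forall>ws ns N. (\<forall>w\<in>set ws. length w \<le> N) \<longrightarrow> (\<forall>i. ns i \<le> N) \<longrightarrow> eval a ws ns \<le> poly p N"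
    by blast
  then show ?case by (intro exI[of _ p]) (auto intro: le_trans[OF diff_le_self])
next
  case (Sm a b)
  then obtain p q where p: "\<forall>ws ns N. (\<forall>w\<in>set ws. length w \<le> N) \<longrightarrow> (\<forall>i. ns i \<le> N) \<longrightarrow> eval a ws ns \<le> poly p N"
    and q: "\<forall>ws ns N. (\<forall>w\<in>set ws. length w \<le> N) \<longrightarrow> (\<forall>i. ns i \<le> N) \<longrightarrow> eval b ws ns \<le> poly q N" by blast
  show ?case
  proof (intro exI[of _ "p * pcompose q ([:0, 1:] + p)"] allI impI)
    fix ws :: "bool list list" and ns N assume A: "\<forall>w\<in>set ws. length w \<le> N" "\<forall>i. (ns :: nat \<Rightarrow> nat) i \<le> N"
    have "eval (Sm a b) ws ns \<le> (\<Sum>j<eval a ws ns. poly q (N + poly p N))"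
      unfolding eval.simps
    proof (rule sum_mono)
      fix j assume "j \<in> {..<eval a ws ns}"
      then have "j \<le> poly p N" using p A by (meson le_trans lessThan_iff less_imp_le)
      then have "\<forall>i. case_nat j ns i \<le> N + poly p N" using A by (auto split: nat.split simp: trans_le_add1)
      moreover have "\<forall>w\<in>set ws. length w \<le> N + poly p N" using A by (auto simp: trans_le_add1)
      ultimately show "eval b ws (case_nat j ns) \<le> poly q (N + poly p N)" using q by blast
    qed
    also have "\<dots> \<le> poly p N * poly q (N + poly p N)" using p A by simp
    finally show "eval (Sm a b) ws ns \<le> poly (p * pcompose q ([:0, 1:] + p)) N"
      by (simp add: poly_pcompose)
  qed
next
  case (Lk k a)
  show ?case by (intro exI[of _ 1]) auto
next
  case (Ln k)
  show ?case by (intro exI[of _ "[:0, 1:]"]) (auto intro: length_word_le)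
qed

section \<open>Correctness and running time of compiled expressions\<close>

locale input_counters = counters +
  fixes ws :: "bool list list"
  assumes input: "i < length ws \<Longrightarrow> cn i = map sym (ws ! i)"
    and counter: "length ws \<le> i \<Longrightarrow> cn i = [3]"
begin

text \<open>Variables lie above the input tapes and below \<open>d\<close>, so storing a result
  never changes a variable; the input heads rest at 0, so every lookup starts from a known
  position.\<close>

definition ok :: "nat \<Rightarrow> nat \<Rightarrow> (nat \<Rightarrow> nat) \<Rightarrow> (nat \<Rightarrow> nat) \<Rightarrow> nat \<Rightarrow> bool" where
  "ok h d \<rho> hs N \<longleftrightarrow> d + h < K \<and> length ws \<le> d \<and> (\<forall>i. d \<le> i \<or> i < length ws \<longrightarrow> hs i = 0) \<and>
     (\<forall>v. length ws \<le> \<rho> v \<and> \<rho> v < d \<and> hs (\<rho> v) \<le> N) \<and> (\<forall>w\<in>set ws. length w \<le> N)"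

text \<open>All counters except \<open>d\<close> are restored, which allows subterms to be evaluated
  one after the other with the same variables.\<close>

definition works :: "expr \<Rightarrow> nat poly \<Rightarrow> bool" where
  "works e p \<longleftrightarrow> (\<forall>d \<rho> hs N out. ok (scratch e) d \<rho> hs N \<longrightarrow>
     runs (comp (length ws) e \<rho> d) out hs (poly p N) out (hs(d := eval e ws (\<lambda>v. hs (\<rho> v)))))"

lemma works_Cn: "works (Cn c) [:1 + c:]"
  unfolding works_def
proof (intro allI impI)
  fix d \<rho> hs N out assume "ok (scratch (Cn c)) d \<rho> hs N"
  then have d: "d < K" "hs d = 0" by (auto simp: ok_def)
  have "runs (((\<lambda>p. Seq p (inc d)) ^^ c) skip) out hs (1 + c) out (hs(d := c))"
  proof (induction c)
    case 0
    then show ?case using runs_skip[of out hs] d by (simp add: fun_upd_idem)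
  next
    case (Suc c)
    show ?case
      by simp (rule runs_eq[OF runs_Seq[OF Suc runs_inc[OF d(1)]]], auto)
  qed
  then show "runs (comp (length ws) (Cn c) \<rho> d) out hs (poly [:1 + c:] N) out (hs(d := eval (Cn c) ws (\<lambda>v. hs (\<rho> v))))"
    by simp
qed

lemma works_Vr: "works (Vr v) [:2, 7:]"
  unfolding works_def
proof (intro allI impI)
  fix d \<rho> hs N out assume A: "ok (scratch (Vr v)) d \<rho> hs N"
  define i n where "i = \<rho> v" and "n = hs i"
  have d: "d < K" "Suc d < K" "hs d = 0" "hs (Suc d) = 0" "i < d" "i < K" "cn i = [3]" "cn (Suc d) = [3]" "n \<le> N"
    using A counter[of i] counter[of "Suc d"] by (auto simp: ok_def i_def n_def intro: less_trans)
  have "runs (loop i (Seq (inc d) (inc (Suc d)))) out hs (n * 4 + 1) out (hs(d := n, i := 0, Suc d := n))"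
  proof (rule runs_loop_same[OF d(6,7), where H = "\<lambda>j. hs(d := j, Suc d := j)" and t = 2])
    fix j
    show "runs (Seq (inc d) (inc (Suc d))) out ((hs(d := j, Suc d := j))(i := n - Suc j)) 2 out
      ((hs(d := Suc j, Suc d := Suc j))(i := n - Suc j))"
      by (rule runs_eq[OF runs_Seq[OF runs_inc[OF d(1)] runs_inc[OF d(2)]]]) (use d in auto)
  qed (use d in \<open>auto simp: n_def\<close>)
  moreover have "runs (loop (Suc d) (inc i)) out (hs(d := n, i := 0, Suc d := n)) (3 * n + 1) out (hs(d := n))"
    by (rule runs_eq[OF runs_transfer[OF d(2,8,6)]]) (use d in \<open>auto simp: n_def\<close>)
  ultimately have "runs (Seq (loop i (Seq (inc d) (inc (Suc d)))) (loop (Suc d) (inc i))) out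
    hs ((n * 4 + 1) + (3 * n + 1)) out (hs(d := n))"
    by (rule runs_Seq)
  then show "runs (comp (length ws) (Vr v) \<rho> d) out hs (poly [:2, 7:] N) out
     (hs(d := eval (Vr v) ws (\<lambda>v. hs (\<rho> v))))"
    using d(9) by (auto simp: i_def[symmetric] n_def[symmetric] intro: runs_mono)
qed

lemma ok_sub: "ok h d \<rho> hs N \<Longrightarrow> h' + k \<le> h \<Longrightarrow> ok h' (d + k) \<rho> (hs(d := x)) N" if "0 < k"
proof -
  assume A: "ok h d \<rho> hs N" "h' + k \<le> h"
  have "\<rho> v \<noteq> d" for v using A unfolding ok_def by (metis nat_neq_iff)
  moreover have "\<rho> v < d + k" for v using A by (auto simp: ok_def intro: trans_less_add1)
  ultimately show ?thesis using A that by (auto simp: ok_def)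
qed

lemma ok_le: "ok h d \<rho> hs N \<Longrightarrow> h' \<le> h \<Longrightarrow> ok h' d \<rho> hs N"
  by (auto simp: ok_def)

lemma ok_ne: "ok h d \<rho> hs N \<Longrightarrow> \<rho> v \<noteq> d"
  unfolding ok_def by (metis nat_neq_iff)

lemma works_two:
  assumes "works a p" "works b q" "ok (scratch a + scratch b + 2) d \<rho> hs N"
  shows "runs (Seq (comp (length ws) a \<rho> d) (comp (length ws) b \<rho> (Suc d))) out hs (poly (p + q) N) out
    (hs(d := eval a ws (\<lambda>v. hs (\<rho> v)), Suc d := eval b ws (\<lambda>v. hs (\<rho> v))))"
proof -
  define x where "x = eval a ws (\<lambda>v. hs (\<rho> v))"
  have 1: "runs (comp (length ws) a \<rho> d) out hs (poly p N) out (hs(d := x))"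
    using assms ok_le[OF assms(3), of "scratch a"] by (auto simp: works_def x_def)
  have "ok (scratch b) (d + 1) \<rho> (hs(d := x)) N" by (rule ok_sub[OF _ assms(3)]) auto
  then have 2: "runs (comp (length ws) b \<rho> (d + 1)) out (hs(d := x)) (poly q N) out
     (hs(d := x, d + 1 := eval b ws (\<lambda>v. (hs(d := x)) (\<rho> v))))"
    using assms(2) unfolding works_def by blast
  show ?thesis
    using runs_Seq[OF 1 2] ok_ne[OF assms(3)] by (simp add: x_def)
qed

lemma ok_shift: "ok h d \<rho> hs N \<Longrightarrow> h' + k \<le> h \<Longrightarrow> ok h' (d + k) \<rho> hs N"
  by (auto simp: ok_def intro: trans_less_add1)

lemma ok_facts:
  assumes "ok h d \<rho> hs N" "k \<le> h"
  shows "d + k < K" "cn (d + k) = [3]" "hs (d + k) = 0"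
  using assms counter[of "d + k"] by (auto simp: ok_def)

lemma ok_eval: "bnd e p \<Longrightarrow> ok h d \<rho> hs N \<Longrightarrow> eval e ws (\<lambda>v. hs (\<rho> v)) \<le> poly p N"
  by (auto simp: ok_def bnd_def)

lemma works_Add:
  assumes "works a p" "works b q" "bnd b b'"
  shows "works (Add a b) (p + q + (1 + smult 3 b'))"
  unfolding works_def
proof (intro allI impI)
  fix d \<rho> hs N out assume A: "ok (scratch (Add a b)) d \<rho> hs N"
  define x y where "x = eval a ws (\<lambda>v. hs (\<rho> v))" and "y = eval b ws (\<lambda>v. hs (\<rho> v))"
  note f = ok_facts[OF A, of 0, simplified] ok_facts[OF A, of 1, simplified]
  have y: "y \<le> poly b' N" unfolding y_def by (rule ok_eval[OF assms(3) A])
  have "runs (Seq (comp (length ws) a \<rho> d) (comp (length ws) b \<rho> (Suc d))) out hs (poly (p + q) N) out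
    (hs(d := x, Suc d := y))"
    using works_two[OF assms(1,2), of d \<rho> hs N out] A by (simp add: x_def y_def)
  from runs_Seq[OF this runs_transfer[OF f(4,5,1)]]
  show "runs (comp (length ws) (Add a b) \<rho> d) out hs (poly (p + q + (1 + smult 3 b')) N) out
     (hs(d := eval (Add a b) ws (\<lambda>v. hs (\<rho> v))))"
    by (simp, elim runs_eq) (use f y in \<open>auto simp: x_def y_def\<close>)
qed

lemma works_Sub:
  assumes "works a p" "works b q" "bnd b b'"
  shows "works (Sub a b) (p + q + (1 + smult 4 b'))"
  unfolding works_def
proof (intro allI impI)
  fix d \<rho> hs N out assume A: "ok (scratch (Sub a b)) d \<rho> hs N"
  define x y where "x = eval a ws (\<lambda>v. hs (\<rho> v))" and "y = eval b ws (\<lambda>v. hs (\<rho> v))"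
  note f = ok_facts[OF A, of 0, simplified] ok_facts[OF A, of 1, simplified]
  have y: "y \<le> poly b' N" unfolding y_def by (rule ok_eval[OF assms(3) A])
  have 1: "runs (Seq (comp (length ws) a \<rho> d) (comp (length ws) b \<rho> (Suc d))) out hs (poly (p + q) N) out
    (hs(d := x, Suc d := y))"
    using works_two[OF assms(1,2), of d \<rho> hs N out] A by (simp add: x_def y_def)
  have 2: "runs (loop (Suc d) (If (Suc d) (\<lambda>s. s = 3) skip (dec d))) out
     (hs(d := x, Suc d := y)) (y * 4 + 1) out (hs(d := x - y))"
  proof (rule runs_loop_same[OF f(4,5), where H = "\<lambda>j. hs(d := x - j)" and t = 2])
    fix j
    \<comment> \<open>The guard stops the decrements at 0 and so realises truncated
      subtraction.\<close>
    have "runs (If (Suc d) (\<lambda>s. s = 3) skip (dec d)) out ((hs(d := x - j))(Suc d := y - Suc j)) (Suc 1) out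
      ((hs(d := x - Suc j))(Suc d := y - Suc j))"
    proof (rule runs_If[OF f(1)])
      assume "rd ((hs(d := x - j))(Suc d := y - Suc j)) d = 3"
      then have "x - j = 0" using f by (auto simp: rd_def split: if_splits)
      then show "runs skip out ((hs(d := x - j))(Suc d := y - Suc j)) 1 out ((hs(d := x - Suc j))(Suc d := y - Suc j))"
        by (intro runs_eq[OF runs_skip]) auto
    next
      assume "rd ((hs(d := x - j))(Suc d := y - Suc j)) d \<noteq> 3"
      then have "x - j = Suc (x - Suc j)" using f by (auto simp: rd_def split: if_splits)
      then show "runs (dec d) out ((hs(d := x - j))(Suc d := y - Suc j)) 1 out ((hs(d := x - Suc j))(Suc d := y - Suc j))"
        using runs_dec[OF f(1), of out "hs(Suc d := y - Suc j)" "x - Suc j"] by (simp add: fun_upd_twist)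
    qed
    then show "runs (If (Suc d) (\<lambda>s. s = 3) skip (dec d)) out ((hs(d := x - j))(Suc d := y - Suc j)) 2 out
      ((hs(d := x - Suc j))(Suc d := y - Suc j))" by (simp add: numeral_2_eq_2)
  qed (use f in auto)
  from runs_Seq[OF 1 2]
  show "runs (comp (length ws) (Sub a b) \<rho> d) out hs (poly (p + q + (1 + smult 4 b')) N) out
     (hs(d := eval (Sub a b) ws (\<lambda>v. hs (\<rho> v))))"
    by (simp, elim runs_eq) (use f y in \<open>auto simp: x_def y_def\<close>)
qed

lemma works_Sm:
  assumes "works a p" "works b q" "bnd a a'" "bnd b b'"
  shows "works (Sm a b) (p + (a' * (pcompose q ([:0, 1:] + a') + smult 3 (pcompose b' ([:0, 1:] + a')) + [:4:]) + 1) + (1 + smult 3 a'))"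
  unfolding works_def
proof (intro allI impI)
  fix d \<rho> hs N out assume A: "ok (scratch (Sm a b)) d \<rho> hs N"
  define n where "n = eval a ws (\<lambda>v. hs (\<rho> v))"
  define B where "B = (\<lambda>j. eval b ws (case_nat j (\<lambda>v. hs (\<rho> v))))"
  define S where "S = (\<lambda>j. \<Sum>i<j. B i)"
  \<comment> \<open>The index is a new variable with values up to \<open>poly a' N\<close>, so the
    body is run with this larger bound.\<close>
  define N' where "N' = N + poly a' N"
  define t where "t = poly q N' + (3 * poly b' N' + 1) + 1"
  note f = ok_facts[OF A, of 0, simplified] ok_facts[OF A, of 1, simplified] ok_facts[OF A, of 2, simplified]
    ok_facts[OF A, of 3, simplified]
  have n: "n \<le> poly a' N" unfolding n_def by (rule ok_eval[OF assms(3) A])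
  have below: "\<rho> v < d" for v using A by (simp add: ok_def)
  have "ok (scratch a) (d + 2) \<rho> hs N" by (rule ok_shift[OF A]) simp
  then have 1: "runs (comp (length ws) a \<rho> (d + 2)) out hs (poly p N) out (hs(d + 2 := n))"
    using assms(1) unfolding works_def n_def by blast
  have 2: "runs (loop (d + 2) (Seq (comp (length ws) b (case_nat (d + 1) \<rho>) (d + 3))
        (Seq (loop (d + 3) (inc d)) (inc (d + 1))))) out (hs(d + 2 := n)) (n * (t + 2) + 1) out (hs(d := S n, d + 1 := n))"
  proof (rule runs_loop_same[where H = "\<lambda>j. hs(d := S j, d + 1 := j)" and t = t])
    fix j assume j: "j < n"
    define hs' where "hs' = (hs(d := S j, d + 1 := j))(d + 2 := n - Suc j)"
    have hs': "hs' (case_nat (d + 1) \<rho> v) = case_nat j (\<lambda>v. hs (\<rho> v)) v" for v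
      using below[of "v - 1"] by (auto simp: hs'_def split: nat.split)
    have "ok (scratch b) (d + 3) (case_nat (d + 1) \<rho>) hs' N'"
      unfolding ok_def
    proof (intro conjI allI impI)
      fix i assume "d + 3 \<le> i \<or> i < length ws"
      then show "hs' i = 0" using A by (auto simp: ok_def hs'_def)
    next
      fix v
      show "length ws \<le> case_nat (d + 1) \<rho> v" "case_nat (d + 1) \<rho> v < d + 3"
        using A below by (auto simp: ok_def split: nat.split intro: less_trans trans_less_add1)
      show "hs' (case_nat (d + 1) \<rho> v) \<le> N'"
        using A j n by (auto simp: ok_def hs' N'_def split: nat.split intro: trans_le_add1)
    qed (use A in \<open>auto simp: ok_def N'_def intro: trans_le_add1\<close>)
    note okb = this
    have 3: "runs (comp (length ws) b (case_nat (d + 1) \<rho>) (d + 3)) out hs' (poly q N') out (hs'(d + 3 := B j))"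
      using assms(2) okb unfolding works_def B_def hs'[symmetric] by blast
    have Bj: "B j \<le> poly b' N'" using ok_eval[OF assms(4) okb] by (simp add: B_def hs')
    have 4: "runs (loop (d + 3) (inc d)) out (hs'(d + 3 := B j)) (3 * B j + 1) out (hs'(d := S (Suc j)))"
      by (rule runs_eq[OF runs_transfer[of "d + 3" d]]) (use f in \<open>auto simp: hs'_def S_def\<close>)
    have 5: "runs (inc (d + 1)) out (hs'(d := S (Suc j))) 1 out ((hs(d := S (Suc j), d + 1 := Suc j))(d + 2 := n - Suc j))"
      by (rule runs_eq[OF runs_inc]) (use f in \<open>auto simp: hs'_def\<close>)
    have "runs (Seq (comp (length ws) b (case_nat (d + 1) \<rho>) (d + 3))
        (Seq (loop (d + 3) (inc d)) (inc (d + 1)))) out hs' t out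
        ((hs(d := S (Suc j), d + 1 := Suc j))(d + 2 := n - Suc j))"
      by (rule runs_eq[OF runs_Seq[OF 3 runs_Seq[OF 4 5]]]) (use Bj in \<open>auto simp: t_def\<close>)
    then show "runs (Seq (comp (length ws) b (case_nat (d + 1) \<rho>) (d + 3))
        (Seq (loop (d + 3) (inc d)) (inc (d + 1)))) out ((hs(d := S j, d + 1 := j))(d + 2 := n - Suc j)) t out
        ((hs(d := S (Suc j), d + 1 := Suc j))(d + 2 := n - Suc j))" by (simp add: hs'_def)
  qed (use f in \<open>auto simp: S_def\<close>)
  have 6: "runs (loop (d + 1) skip) out (hs(d := S n, d + 1 := n)) (3 * n + 1) out (hs(d := S n))"
    by (rule runs_eq[OF runs_clear]) (use f in auto)
  have time: "n * (t + 2) + 1 \<le> poly a' N * (t + 2) + 1" by (intro add_mono mult_mono) (use n in auto)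
  show "runs (comp (length ws) (Sm a b) \<rho> d) out hs
     (poly (p + (a' * (pcompose q ([:0, 1:] + a') + smult 3 (pcompose b' ([:0, 1:] + a')) + [:4:]) + 1) + (1 + smult 3 a')) N) out
     (hs(d := eval (Sm a b) ws (\<lambda>v. hs (\<rho> v))))"
    unfolding comp.simps
    by (rule runs_eq[OF runs_Seq[OF 1 runs_Seq[OF 2 6]]])
      (use n time in \<open>auto simp: S_def B_def n_def[symmetric] poly_pcompose t_def N'_def algebra_simps\<close>)
qed

lemma works_Lk:
  assumes "works a p" "bnd a a'"
  shows "works (Lk k a) (p + smult 7 a' + [:4:])"
  unfolding works_def
proof (intro allI impI)
  fix d \<rho> hs N out assume A: "ok (scratch (Lk k a)) d \<rho> hs N"
  note f = ok_facts[OF A, of 0, simplified] ok_facts[OF A, of 1, simplified] ok_facts[OF A, of 2, simplified]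
  define x where "x = eval a ws (\<lambda>v. hs (\<rho> v))"
  have x: "x \<le> poly a' N" unfolding x_def by (rule ok_eval[OF assms(2) A])
  show "runs (comp (length ws) (Lk k a) \<rho> d) out hs (poly (p + smult 7 a' + [:4:]) N) out
     (hs(d := eval (Lk k a) ws (\<lambda>v. hs (\<rho> v))))"
  proof (cases "k < length ws")
    case False
    then show ?thesis using f by (simp add: word_def bit_def) (rule runs_eq[OF runs_skip], auto)
  next
    case True
    have k: "k < d" "k < K" "hs k = 0" "cn k = map sym (ws ! k)" using A True input by (auto simp: ok_def)
    define b where "b = bit (word ws k) x"
    have "ok (scratch a) (d + 1) \<rho> hs N" by (rule ok_shift[OF A]) simp
    then have 1: "runs (comp (length ws) a \<rho> (d + 1)) out hs (poly p N) out (hs(d + 1 := x))"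
      using assms(1) unfolding works_def x_def by blast
    have 2: "runs (loop (d + 1) (Seq (inc (d + 2)) (inc k))) out (hs(d + 1 := x)) (x * 4 + 1) out (hs(d + 2 := x, k := x, d + 1 := 0))"
    proof (rule runs_loop_same[where H = "\<lambda>j. hs(d + 2 := j, k := j)" and t = 2])
      fix j
      show "runs (Seq (inc (d + 2)) (inc k)) out (hs(d + 2 := j, k := j, d + 1 := x - Suc j)) 2 out
        (hs(d + 2 := Suc j, k := Suc j, d + 1 := x - Suc j))"
        by (rule runs_eq[OF runs_Seq[OF runs_inc runs_inc]]) (use f k in auto)
    qed (use f k in auto)
    have 3: "runs (If (Suc k) (\<lambda>s. s = 2) (inc d) skip) out (hs(d + 2 := x, k := x, d + 1 := 0)) (Suc 1) out
       (hs(d + 2 := x, k := x, d + 1 := 0, d := of_bool b))"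
    proof (rule runs_If[OF k(2)])
      assume "rd (hs(d + 2 := x, k := x, d + 1 := 0)) k = 2"
      then have "b" using k True by (auto simp: rd_def b_def bit_def word_def sym_def split: if_splits)
      then show "runs (inc d) out (hs(d + 2 := x, k := x, d + 1 := 0)) 1 out
       (hs(d + 2 := x, k := x, d + 1 := 0, d := of_bool b))"
        by (intro runs_eq[OF runs_inc]) (use f k in auto)
    next
      assume "rd (hs(d + 2 := x, k := x, d + 1 := 0)) k \<noteq> 2"
      then have "\<not> b" using k True by (auto simp: rd_def b_def bit_def word_def sym_def split: if_splits)
      then show "runs skip out (hs(d + 2 := x, k := x, d + 1 := 0)) 1 out
       (hs(d + 2 := x, k := x, d + 1 := 0, d := of_bool b))"
        by (intro runs_eq[OF runs_skip]) (use f k in auto)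
    qed
    have 4: "runs (loop (d + 2) (dec k)) out (hs(d + 2 := x, k := x, d + 1 := 0, d := of_bool b)) (x * 3 + 1) out
       (hs(d := of_bool b))"
    proof (rule runs_loop_same[where H = "\<lambda>j. hs(k := x - j, d := of_bool b)" and t = 1])
      fix j assume "j < x"
      then have e: "hs(k := x - j, d := of_bool b, d + 2 := x - Suc j) = (hs(d := of_bool b, d + 2 := x - Suc j))(k := Suc (x - Suc j))"
        using k by (auto simp: fun_eq_iff Suc_diff_Suc)
      show "runs (dec k) out (hs(k := x - j, d := of_bool b, d + 2 := x - Suc j)) 1 out
        (hs(k := x - Suc j, d := of_bool b, d + 2 := x - Suc j))"
        unfolding e by (rule runs_eq[OF runs_dec]) (use k in auto)
    qed (use f k in auto)
    show ?thesis
      using True unfolding comp.simps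
      by (simp only: if_True) (rule runs_eq[OF runs_Seq[OF 1 runs_Seq[OF 2 runs_Seq[OF 3 4]]]],
         use f k x in \<open>auto simp: b_def x_def[symmetric]\<close>)
  qed
qed

lemma works_Ln: "works (Ln k) [:2, 7:]"
  unfolding works_def
proof (intro allI impI)
  fix d \<rho> hs N out assume A: "ok (scratch (Ln k)) d \<rho> hs N"
  note f = ok_facts[OF A, of 0, simplified] ok_facts[OF A, of 1, simplified]
  show "runs (comp (length ws) (Ln k) \<rho> d) out hs (poly [:2, 7:] N) out
     (hs(d := eval (Ln k) ws (\<lambda>v. hs (\<rho> v))))"
  proof (cases "k < length ws")
    case False
    then show ?thesis using f by (simp add: word_def bit_def) (rule runs_eq[OF runs_skip], auto)
  next
    case True
    have k: "k < d" "k < K" "hs k = 0" "cn k = map sym (ws ! k)" using A True input by (auto simp: ok_def)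
    define n where "n = length (ws ! k)"
    have n: "n \<le> N" using A True by (auto simp: ok_def n_def)
    have 1: "runs (While (Suc k) (\<lambda>s. s \<noteq> 0) (Seq (inc k) (Seq (inc d) (inc (d + 1))))) ((\<lambda>_. out) 0)
       ((\<lambda>j. hs(k := j, d := j, d + 1 := j)) 0) (n * (3 + 1) + 1) ((\<lambda>_. out) n) ((\<lambda>j. hs(k := j, d := j, d + 1 := j)) n)"
    proof (rule runs_While)
      fix j assume "j < n"
      then show "rd (hs(k := j, d := j, d + 1 := j)) k \<noteq> 0" using k by (auto simp: rd_def n_def sym_def)
      show "runs (Seq (inc k) (Seq (inc d) (inc (d + 1)))) out (hs(k := j, d := j, d + 1 := j)) 3 out
         (hs(k := Suc j, d := Suc j, d + 1 := Suc j))"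
        by (rule runs_eq[OF runs_Seq[OF runs_inc runs_Seq[OF runs_inc runs_inc]]]) (use k f in auto)
    qed (use k in \<open>auto simp: rd_def n_def\<close>)
    have 2: "runs (loop (d + 1) (dec k)) out (hs(k := n, d := n, d + 1 := n)) (n * 3 + 1) out (hs(d := n))"
    proof (rule runs_loop_same[where H = "\<lambda>j. hs(k := n - j, d := n)" and t = 1])
      fix j assume "j < n"
      then have e: "hs(k := n - j, d := n, d + 1 := n - Suc j) = (hs(d := n, d + 1 := n - Suc j))(k := Suc (n - Suc j))"
        using k by (auto simp: fun_eq_iff Suc_diff_Suc)
      show "runs (dec k) out (hs(k := n - j, d := n, d + 1 := n - Suc j)) 1 out
        (hs(k := n - Suc j, d := n, d + 1 := n - Suc j))"
        unfolding e by (rule runs_eq[OF runs_dec]) (use k in auto)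
    qed (use f k in auto)
    have e0: "(\<lambda>j. hs(k := j, d := j, d + 1 := j)) 0 = hs" using f k by auto
    show ?thesis
      using True unfolding comp.simps
      by (simp only: if_True) (rule runs_eq[OF runs_Seq[OF 1[unfolded e0] 2]],
         use f k n in \<open>auto simp: word_def n_def[symmetric]\<close>)
  qed
qed

end

text \<open>The polynomial is chosen before the words, the tape contents and the number of counters;
  only such a uniform bound is a running time in the sense of \<open>polytime\<close>.\<close>

lemma works_ex: "\<exists>p. \<forall>pre cn K ws. input_counters cn ws \<longrightarrow> input_counters.works pre cn K ws e p"
proof (induction e)
  case (Cn c)
  show ?case using input_counters.works_Cn by blast
next
  case (Vr v)
  show ?case using input_counters.works_Vr by blast
next
  case (Add a b)
  then show ?case using input_counters.works_Add eval_bound[of b] by meson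
next
  case (Sub a b)
  then show ?case using input_counters.works_Sub eval_bound[of b] by meson
next
  case (Sm a b)
  then show ?case using input_counters.works_Sm eval_bound[of a] eval_bound[of b] by meson
next
  case (Lk k a)
  then show ?case using input_counters.works_Lk eval_bound[of a] by meson
next
  case (Ln k)
  show ?case using input_counters.works_Ln by blast
qed

section \<open>Programs producing words\<close>

datatype wprog = Em expr | WSq wprog wprog | WFr expr wprog

primrec weval :: "wprog \<Rightarrow> bool list list \<Rightarrow> (nat \<Rightarrow> nat) \<Rightarrow> bool list" where
  "weval (Em e) ws ns = [eval e ws ns \<noteq> 0]"
| "weval (WSq a b) ws ns = weval a ws ns @ weval b ws ns"
| "weval (WFr e a) ws ns = concat (map (\<lambda>j. weval a ws (case_nat j ns)) [0..<eval e ws ns])"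

primrec wscratch :: "wprog \<Rightarrow> nat" where
  "wscratch (Em e) = scratch e + 1"
| "wscratch (WSq a b) = wscratch a + wscratch b"
| "wscratch (WFr e a) = scratch e + wscratch a + 3"

primrec wcomp :: "nat \<Rightarrow> wprog \<Rightarrow> (nat \<Rightarrow> nat) \<Rightarrow> nat \<Rightarrow> prog" where
  "wcomp r (Em e) \<rho> d = Seq (comp r e \<rho> d)
     (Seq (If (Suc d) (\<lambda>s. s = 3) (emit False) (emit True)) (loop d skip))"
| "wcomp r (WSq a b) \<rho> d = Seq (wcomp r a \<rho> d) (wcomp r b \<rho> d)"
| "wcomp r (WFr e a) \<rho> d = Seq (comp r e \<rho> (d + 1))
     (Seq (loop (d + 1) (Seq (wcomp r a (case_nat d \<rho>) (d + 2)) (inc d))) (loop d skip))"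

context input_counters
begin

definition wworks :: "wprog \<Rightarrow> nat poly \<Rightarrow> bool" where
  "wworks a p \<longleftrightarrow> (\<forall>d \<rho> hs N out. ok (wscratch a) d \<rho> hs N \<longrightarrow>
     runs (wcomp (length ws) a \<rho> d) out hs (poly p N) (out @ weval a ws (\<lambda>v. hs (\<rho> v))) hs)"

lemma wworks_Em:
  assumes "works e p" "bnd e p'"
  shows "wworks (Em e) (p + smult 3 p' + [:3:])"
  unfolding wworks_def
proof (intro allI impI)
  fix d \<rho> hs N out assume A: "ok (wscratch (Em e)) d \<rho> hs N"
  define x where "x = eval e ws (\<lambda>v. hs (\<rho> v))"
  note f = ok_facts[OF A, of 0, simplified]
  have x: "x \<le> poly p' N" unfolding x_def by (rule ok_eval[OF assms(2) A])
  have "ok (scratch e) d \<rho> hs N" by (rule ok_le[OF A]) simp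
  then have 1: "runs (comp (length ws) e \<rho> d) out hs (poly p N) out (hs(d := x))"
    using assms(1) unfolding works_def x_def by blast
  have 2: "runs (If (Suc d) (\<lambda>s. s = 3) (emit False) (emit True)) out (hs(d := x)) (Suc 1) (out @ [x \<noteq> 0]) (hs(d := x))"
  proof (rule runs_If[OF f(1)])
    assume "rd (hs(d := x)) d = 3"
    then have "(x \<noteq> 0) = False" using f by (auto simp: rd_def split: if_splits)
    then show "runs (emit False) out (hs(d := x)) 1 (out @ [x \<noteq> 0]) (hs(d := x))"
      using runs_emit[of False] by simp
  next
    assume "rd (hs(d := x)) d \<noteq> 3"
    then have "(x \<noteq> 0) = True" using f by (auto simp: rd_def split: if_splits)
    then show "runs (emit True) out (hs(d := x)) 1 (out @ [x \<noteq> 0]) (hs(d := x))"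
      using runs_emit[of True] by simp
  qed
  have 3: "runs (loop d skip) (out @ [x \<noteq> 0]) (hs(d := x)) (3 * x + 1) (out @ [x \<noteq> 0]) hs"
    by (rule runs_eq[OF runs_clear]) (use f in auto)
  show "runs (wcomp (length ws) (Em e) \<rho> d) out hs (poly (p + smult 3 p' + [:3:]) N)
     (out @ weval (Em e) ws (\<lambda>v. hs (\<rho> v))) hs"
    unfolding wcomp.simps weval.simps x_def[symmetric]
    by (rule runs_eq[OF runs_Seq[OF 1 runs_Seq[OF 2 3]]]) (use x in auto)
qed

lemma wworks_WSq:
  assumes "wworks a p" "wworks b q"
  shows "wworks (WSq a b) (p + q)"
  unfolding wworks_def
proof (intro allI impI)
  fix d \<rho> hs N out assume A: "ok (wscratch (WSq a b)) d \<rho> hs N"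
  have 1: "runs (wcomp (length ws) a \<rho> d) out hs (poly p N) (out @ weval a ws (\<lambda>v. hs (\<rho> v))) hs"
    using assms(1) ok_le[OF A, of "wscratch a"] by (auto simp: wworks_def)
  have 2: "runs (wcomp (length ws) b \<rho> d) out hs (poly q N) (out @ weval b ws (\<lambda>v. hs (\<rho> v))) hs" for out
    using assms(2) ok_le[OF A, of "wscratch b"] by (auto simp: wworks_def)
  show "runs (wcomp (length ws) (WSq a b) \<rho> d) out hs (poly (p + q) N)
     (out @ weval (WSq a b) ws (\<lambda>v. hs (\<rho> v))) hs"
    using runs_Seq[OF 1 2] by simp
qed

lemma wworks_WFr:
  assumes "works e p" "bnd e p'" "wworks a q"
  shows "wworks (WFr e a) (p + (p' * (pcompose q ([:0, 1:] + p') + [:3:]) + 1) + (1 + smult 3 p'))"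
  unfolding wworks_def
proof (intro allI impI)
  fix d \<rho> hs N out assume A: "ok (wscratch (WFr e a)) d \<rho> hs N"
  define n where "n = eval e ws (\<lambda>v. hs (\<rho> v))"
  define B where "B = (\<lambda>j. weval a ws (case_nat j (\<lambda>v. hs (\<rho> v))))"
  define N' where "N' = N + poly p' N"
  define t where "t = poly q N' + 1"
  note f = ok_facts[OF A, of 0, simplified] ok_facts[OF A, of 1, simplified]
  have n: "n \<le> poly p' N" unfolding n_def by (rule ok_eval[OF assms(2) A])
  have below: "\<rho> v < d" for v using A by (simp add: ok_def)
  have "ok (scratch e) (d + 1) \<rho> hs N" by (rule ok_shift[OF A]) simp
  then have 1: "runs (comp (length ws) e \<rho> (d + 1)) out hs (poly p N) out (hs(d + 1 := n))"
    using assms(1) unfolding works_def n_def by blast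
  have 2: "runs (loop (d + 1) (Seq (wcomp (length ws) a (case_nat d \<rho>) (d + 2)) (inc d))) out
     (hs(d + 1 := n)) (n * (t + 2) + 1) (out @ concat (map B [0..<n])) (hs(d := n))"
  proof (rule runs_loop_gen[where H = "\<lambda>j. hs(d := j)" and Q = "\<lambda>j. out @ concat (map B [0..<j])" and t = t])
    fix j assume j: "j < n"
    define hs' where "hs' = hs(d := j, d + 1 := n - Suc j)"
    have hs': "hs' (case_nat d \<rho> v) = case_nat j (\<lambda>v. hs (\<rho> v)) v" for v
      using below[of "v - 1"] by (auto simp: hs'_def split: nat.split)
    have okb: "ok (wscratch a) (d + 2) (case_nat d \<rho>) hs' N'"
      unfolding ok_def
    proof (intro conjI allI impI)
      fix i assume "d + 2 \<le> i \<or> i < length ws"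
      then show "hs' i = 0" using A by (auto simp: ok_def hs'_def)
    next
      fix v
      show "length ws \<le> case_nat d \<rho> v" "case_nat d \<rho> v < d + 2"
        using A below by (auto simp: ok_def split: nat.split intro: less_trans trans_less_add1)
      show "hs' (case_nat d \<rho> v) \<le> N'"
        using A j n by (auto simp: ok_def hs' N'_def split: nat.split intro: trans_le_add1)
    qed (use A in \<open>auto simp: ok_def N'_def intro: trans_le_add1\<close>)
    have 3: "runs (wcomp (length ws) a (case_nat d \<rho>) (d + 2)) (out @ concat (map B [0..<j])) hs' (poly q N')
      ((out @ concat (map B [0..<j])) @ B j) hs'"
      using assms(3) okb unfolding wworks_def B_def hs'[symmetric] by blast
    have 4: "runs (inc d) ((out @ concat (map B [0..<j])) @ B j) hs' 1 (out @ concat (map B [0..<Suc j])) (hs(d := Suc j, d + 1 := n - Suc j))"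
      by (simp add: hs'_def) (rule runs_eq[OF runs_inc[OF f(1)]], auto)
    show "runs (Seq (wcomp (length ws) a (case_nat d \<rho>) (d + 2)) (inc d)) (out @ concat (map B [0..<j])) (hs(d := j, d + 1 := n - Suc j)) t
       (out @ concat (map B [0..<Suc j])) (hs(d := Suc j, d + 1 := n - Suc j))"
      using runs_Seq[OF 3 4] by (simp add: t_def hs'_def)
  qed (use f in auto)
  have 6: "runs (loop d skip) out' (hs(d := n)) (3 * n + 1) out' hs" for out'
    by (rule runs_eq[OF runs_clear]) (use f in auto)
  have time: "n * (t + 2) + 1 \<le> poly p' N * (t + 2) + 1" by (intro add_mono mult_mono) (use n in auto)
  show "runs (wcomp (length ws) (WFr e a) \<rho> d) out hs
     (poly (p + (p' * (pcompose q ([:0, 1:] + p') + [:3:]) + 1) + (1 + smult 3 p')) N)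
     (out @ weval (WFr e a) ws (\<lambda>v. hs (\<rho> v))) hs"
    unfolding wcomp.simps weval.simps n_def[symmetric] B_def[symmetric]
    by (rule runs_eq[OF runs_Seq[OF 1 runs_Seq[OF 2 6]]])
      (use n time in \<open>auto simp: poly_pcompose t_def N'_def algebra_simps\<close>)
qed

end

lemma wworks_ex: "\<exists>p. \<forall>pre cn K ws. input_counters cn ws \<longrightarrow> input_counters.wworks pre cn K ws a p"
proof (induction a)
  case (Em e)
  then show ?case using input_counters.wworks_Em eval_bound[of e] works_ex[of e] by meson
next
  case (WSq a b)
  then show ?case using input_counters.wworks_WSq by meson
next
  case (WFr e a)
  then show ?case using input_counters.wworks_WFr eval_bound[of e] works_ex[of e] by meson
qed

section \<open>Preparing the tapes and delivering the output\<close>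

lemma exec_While:
  assumes "\<And>j. j \<le> n \<Longrightarrow> i < length (T j)"
    and "\<And>j. j < n \<Longrightarrow> P (read (T j ! i))"
    and "\<And>j. j < n \<Longrightarrow> exec c (T j) t (T (Suc j))"
    and "\<not> P (read (T n ! i))"
  shows "exec (While i P c) (T 0) (n * (t + 1) + 1) (T n)"
  using assms
proof (induction n arbitrary: T)
  case 0
  then show ?case using exec.WhileF[of i "T 0" P c] by simp
next
  case (Suc n)
  have "exec (While i P c) (T (Suc 0)) (n * (t + 1) + 1) (T (Suc n))"
    by (rule Suc.IH[of "\<lambda>j. T (Suc j)"]) (use Suc.prems in auto)
  from exec.WhileT[where j = i and Ts = "T 0" and ?Ts1.0 = "T (Suc 0)" and ?t1.0 = t, OF _ _ _ this]
  show ?case using Suc.prems(1)[of 0] Suc.prems(2)[of 0] Suc.prems(3)[of 0] by (simp add: algebra_simps)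
qed

lemma exec_Mv_list_tape:
  "j < length Ts \<Longrightarrow> Ts ! j = list_tape ss h \<Longrightarrow> h' = h + offset d \<Longrightarrow> exec (Mv j d) Ts 1 (Ts[j := list_tape ss h'])"
  using exec.Mv[of j Ts d] by (simp add: act_read_list_tape)

lemma exec_Wr_list_tape:
  "j < length Ts \<Longrightarrow> Ts ! j = list_tape ss (int (length ss)) \<Longrightarrow> s \<le> 3 \<Longrightarrow>
   exec (Wr j s MoveRight) Ts 1 (Ts[j := list_tape (ss @ [s]) (int (Suc (length ss)))])"
  using exec.Wr[of j Ts s MoveRight] by (simp add: act_append_list_tape min_def)

lemma exec_Seq': "exec c1 Ts t1 Ts1 \<Longrightarrow> exec c2 Ts1 t2 Ts2 \<Longrightarrow> t = t1 + t2 \<Longrightarrow> exec (Seq c1 c2) Ts t Ts2"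
  using exec.Seq by blast

definition copy :: "nat \<Rightarrow> prog" where
  "copy r = While 0 (\<lambda>s. s \<noteq> 0) (Seq (If 0 (\<lambda>s. s = 2) (Wr r 2 MoveRight) (Wr r 1 MoveRight)) (Mv 0 MoveRight))"

text \<open>The head stands on the blank behind the word, hence the first move to the left. The
  blank at cell -1 of the two-way infinite tape stops the walk, also for the empty word.\<close>

definition rewind :: "nat \<Rightarrow> prog" where
  "rewind r = Seq (Mv r MoveLeft) (Seq (While r (\<lambda>s. s \<noteq> 0) (Mv r MoveLeft)) (Mv r MoveRight))"

lemma exec_copy:
  assumes "0 < r" "r < length Ts"
  shows "exec (copy r) (Ts[0 := list_tape (map sym x) 0, r := list_tape [] 0]) (4 * length x + 1)
     (Ts[0 := list_tape (map sym x) (int (length x)), r := list_tape (map sym x) (int (length x))])"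
proof -
  define T where "T = (\<lambda>j. Ts[0 := list_tape (map sym x) (int j), r := list_tape (map sym (take j x)) (int j)])"
  have "exec (copy r) (T 0) (length x * (3 + 1) + 1) (T (length x))"
    unfolding copy_def
  proof (rule exec_While)
    fix j assume j: "j < length x"
    have rd: "read (T j ! 0) = sym (x ! j)"
    proof -
      have "T j ! 0 = list_tape (map sym x) (int j)" using assms less_trans[OF assms] by (simp add: T_def)
      then show ?thesis using j by (simp add: read_list_tape)
    qed
    then show "read (T j ! 0) \<noteq> 0" by (simp add: sym_def)
    have tr: "T j ! r = list_tape (map sym (take j x)) (int (length (map sym (take j x))))"
      using assms j by (simp add: T_def)
    have 1: "exec (Wr r (sym (x ! j)) MoveRight) (T j) 1 ((T j)[r := list_tape (map sym (take (Suc j) x)) (int (Suc j))])"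
      using exec_Wr_list_tape[OF _ tr, of "sym (x ! j)"] assms j by (simp add: T_def sym_def take_Suc_conv_app_nth)
    have 2: "exec (If 0 (\<lambda>s. s = 2) (Wr r 2 MoveRight) (Wr r 1 MoveRight)) (T j) (Suc 1)
       ((T j)[r := list_tape (map sym (take (Suc j) x)) (int (Suc j))])"
    proof (cases "x ! j")
      case True
      show ?thesis by (rule exec.IfT) (use rd 1 True assms in \<open>auto simp: T_def sym_def\<close>)
    next
      case False
      show ?thesis by (rule exec.IfF) (use rd 1 False assms in \<open>auto simp: T_def sym_def\<close>)
    qed
    have 3: "exec (Mv 0 MoveRight) ((T j)[r := list_tape (map sym (take (Suc j) x)) (int (Suc j))]) 1 (T (Suc j))"
      using exec_Mv_list_tape[of 0 "(T j)[r := list_tape (map sym (take (Suc j) x)) (int (Suc j))]" "map sym x" "int j" "int (Suc j)" MoveRight]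
        assms less_trans[OF assms] by (auto simp: T_def list_update_swap)
    show "exec (Seq (If 0 (\<lambda>s. s = 2) (Wr r 2 MoveRight) (Wr r 1 MoveRight)) (Mv 0 MoveRight)) (T j) 3 (T (Suc j))"
      by (rule exec_Seq'[OF 2 3]) simp
  next
    have "T (length x) ! 0 = list_tape (map sym x) (int (length x))" using assms less_trans[OF assms] by (simp add: T_def)
    then show "\<not> read (T (length x) ! 0) \<noteq> 0" by (simp add: read_list_tape)
  qed (use assms in \<open>auto simp: T_def\<close>)
  then show ?thesis by (simp add: T_def mult.commute)
qed

lemma exec_rewind:
  assumes "r < length Ts"
  shows "exec (rewind r) (Ts[r := list_tape (map sym x) (int (length x))]) (2 * length x + 3) (Ts[r := list_tape (map sym x) 0])"
proof -
  define T where "T = (\<lambda>j. Ts[r := list_tape (map sym x) (int (length x) - 1 - int j)])"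
  have 1: "exec (Mv r MoveLeft) (Ts[r := list_tape (map sym x) (int (length x))]) 1 (T 0)"
    using exec_Mv_list_tape[of r "Ts[r := list_tape (map sym x) (int (length x))]" "map sym x" "int (length x)" "int (length x) - 1" MoveLeft]
      assms by (simp add: T_def)
  have 2: "exec (While r (\<lambda>s. s \<noteq> 0) (Mv r MoveLeft)) (T 0) (length x * (1 + 1) + 1) (T (length x))"
  proof (rule exec_While)
    fix j assume j: "j < length x"
    then have e: "int (length x) - 1 - int j = int (length x - 1 - j)" by simp
    have "T j ! r = list_tape (map sym x) (int (length x - 1 - j))" unfolding T_def e using assms by simp
    then show "read (T j ! r) \<noteq> 0" using j by (simp only: read_list_tape) (simp add: sym_def)
    show "exec (Mv r MoveLeft) (T j) 1 (T (Suc j))"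
      using exec_Mv_list_tape[of r "T j" "map sym x" "int (length x) - 1 - int j" "int (length x) - 1 - int (Suc j)" MoveLeft]
      assms by (simp add: T_def)
  qed (use assms in \<open>auto simp: T_def read_def list_tape_def\<close>)
  have 3: "exec (Mv r MoveRight) (T (length x)) 1 (Ts[r := list_tape (map sym x) 0])"
    using exec_Mv_list_tape[of r "T (length x)" "map sym x" "-1" 0 MoveRight] assms by (simp add: T_def)
  show ?thesis unfolding rewind_def by (rule exec_Seq'[OF 1 exec_Seq'[OF 2 3 refl]]) simp
qed

primrec marks :: "nat \<Rightarrow> nat \<Rightarrow> prog" where
  "marks i 0 = Mv 0 Stay"
| "marks i (Suc m) = Seq (marks i m) (Wr (i + m) 3 Stay)"

lemma exec_marks:
  assumes "0 < length Ts" "i + m \<le> length Ts" "\<And>j. j < m \<Longrightarrow> Ts ! (i + j) = list_tape [] 0"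
  shows "exec (marks i m) Ts (Suc m) (map (\<lambda>j. if i \<le> j \<and> j < i + m then list_tape [3] 0 else Ts ! j) [0..<length Ts])"
  using assms
proof (induction m)
  case 0
  have "Ts = map (\<lambda>j. if i \<le> j \<and> j < i + 0 then list_tape [3] 0 else Ts ! j) [0..<length Ts]"
    by (rule nth_equalityI) auto
  then show ?case using exec.Mv[of 0 Ts Stay] 0 by (simp add: act_stay)
next
  case (Suc m)
  let ?T = "\<lambda>m. map (\<lambda>j. if i \<le> j \<and> j < i + m then list_tape [3] 0 else Ts ! j) [0..<length Ts]"
  have 1: "exec (marks i m) Ts (Suc m) (?T m)" using Suc by simp
  have a: "act (3, Stay) (list_tape [] 0) = list_tape [3] 0" by (auto simp: act_def list_tape_def fun_eq_iff)
  have "exec (Wr (i + m) 3 Stay) (?T m) 1 ((?T m)[i + m := act (min 3 3, Stay) (?T m ! (i + m))])"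
    by (rule exec.Wr) (use Suc.prems in auto)
  also have "act (min 3 3, Stay) (?T m ! (i + m)) = list_tape [3] 0"
    using Suc.prems a by simp
  also have "(?T m)[i + m := list_tape [3] 0] = ?T (Suc m)"
    by (rule nth_equalityI) (use Suc.prems in \<open>auto simp: nth_list_update less_Suc_eq\<close>)
  finally have 2: "exec (Wr (i + m) 3 Stay) (?T m) 1 (?T (Suc m))" .
  show ?case unfolding marks.simps by (rule exec_Seq'[OF 1 2]) simp
qed

text \<open>The output is produced on the first tape to the right of a marker behind the input, since the
  first input word has to stay readable; it is read from a copy on the tape \<open>r\<close>.\<close>

definition main :: "nat \<Rightarrow> wprog \<Rightarrow> prog" where
  "main r a = Seq (copy r) (Seq (rewind r) (Seq (Wr 0 3 MoveRight) (Seq (marks (Suc r) (wscratch a + 2))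
     (Seq (wcomp r a (\<lambda>_. r) (Suc r)) (Seq (While 0 (\<lambda>s. s \<noteq> 3) (Mv 0 MoveLeft)) (Mv 0 MoveRight))))))"

text \<open>Bounds the last phase of \<open>main\<close>, in which the head walks back across the
  output to the marker.\<close>

lemma weval_length:
  "\<exists>p. \<forall>ws ns N. (\<forall>w\<in>set ws. length w \<le> N) \<longrightarrow> (\<forall>i. ns i \<le> N) \<longrightarrow> length (weval a ws ns) \<le> poly p N"
proof (induction a)
  case (Em e)
  show ?case by (intro exI[of _ 1]) auto
next
  case (WSq a b)
  then obtain p q where "\<forall>ws ns N. (\<forall>w\<in>set ws. length w \<le> N) \<longrightarrow> (\<forall>i. ns i \<le> N) \<longrightarrow> length (weval a ws ns) \<le> poly p N"
    "\<forall>ws ns N. (\<forall>w\<in>set ws. length w \<le> N) \<longrightarrow> (\<forall>i. ns i \<le> N) \<longrightarrow> length (weval b ws ns) \<le> poly q N" by blast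
  then show ?case by (intro exI[of _ "p + q"]) (auto intro: add_mono)
next
  case (WFr a b)
  obtain p where p: "\<forall>ws ns N. (\<forall>w\<in>set ws. length w \<le> N) \<longrightarrow> (\<forall>i. ns i \<le> N) \<longrightarrow> eval a ws ns \<le> poly p N"
    using eval_bound[of a] unfolding bnd_def by blast
  obtain q where q: "\<forall>ws ns N. (\<forall>w\<in>set ws. length w \<le> N) \<longrightarrow> (\<forall>i. ns i \<le> N) \<longrightarrow> length (weval b ws ns) \<le> poly q N"
    using WFr by blast
  show ?case
  proof (intro exI[of _ "p * pcompose q ([:0, 1:] + p)"] allI impI)
    fix ws :: "bool list list" and ns N assume A: "\<forall>w\<in>set ws. length w \<le> N" "\<forall>i. (ns :: nat \<Rightarrow> nat) i \<le> N"
    have "length (weval (WFr a b) ws ns) = (\<Sum>j<eval a ws ns. length (weval b ws (case_nat j ns)))"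
      by (simp add: length_concat sum_list_sum_nth atLeast0LessThan)
    also have "\<dots> \<le> (\<Sum>j<eval a ws ns. poly q (N + poly p N))"
    proof (rule sum_mono)
      fix j assume "j \<in> {..<eval a ws ns}"
      then have "j \<le> poly p N" using p A by (meson le_trans lessThan_iff less_imp_le)
      then have "\<forall>i. case_nat j ns i \<le> N + poly p N" using A by (auto split: nat.split simp: trans_le_add1)
      moreover have "\<forall>w\<in>set ws. length w \<le> N + poly p N" using A by (auto simp: trans_le_add1)
      ultimately show "length (weval b ws (case_nat j ns)) \<le> poly q (N + poly p N)" using q by blast
    qed
    also have "\<dots> \<le> poly p N * poly q (N + poly p N)" using p A by simp
    finally show "length (weval (WFr a b) ws ns) \<le> poly (p * pcompose q ([:0, 1:] + p)) N"
      by (simp add: poly_pcompose)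
  qed
qed

text \<open>Tape 0 becomes the output tape and its word is copied to tape \<open>r\<close>. As
  counter \<open>i\<close> is tape \<open>Suc i\<close>, the program sees the words in rotated
  order, with the first argument last.\<close>

lemma polytime_weval:
  assumes r: "1 \<le> r"
  shows "polytime r (\<lambda>xs. weval a (rotate1 xs) (\<lambda>_. 0))"
proof -
  obtain p where p: "\<And>pre cn K ws. input_counters cn ws \<Longrightarrow> input_counters.wworks pre cn K ws a p"
    using wworks_ex by blast
  obtain q where q: "\<And>ws ns N. (\<forall>w\<in>set ws. length w \<le> N) \<Longrightarrow> (\<forall>i. ns i \<le> N) \<Longrightarrow> length (weval a ws ns) \<le> poly q N"
    using weval_length by blast
  \<comment> \<open>The \<open>r\<close> input tapes, one counter that stays 0 and stands for every
    free variable, and \<open>wscratch a + 1\<close> counters for scratch work.\<close>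
  define K where "K = r + wscratch a + 2"
  define M where "M = tm_of (Suc K) (main r a)"
  define P where "P = [:4 * 0 + 1 + 3 + 1 + (wscratch a + 3) + 1 + 1, 4 + 2:] + p + smult 2 q + [:2:]"
  show ?thesis
    unfolding polytime_def
  proof (intro exI[of _ M] exI[of _ P] conjI allI impI)
    show "is_tm M" by (simp add: M_def is_tm_tm_of)
    show "r \<le> num_tapes M" by (simp add: M_def tm_of_def K_def)
    fix xs :: "bool list list"
    assume len: "length xs = r"
    then obtain x ys where xs: "xs = x # ys" using r by (cases xs) auto
    define ws where "ws = rotate1 xs"
    have ws: "ws = ys @ [x]" "length ws = r" using xs len by (auto simp: ws_def)
    define N where "N = sum_list (map length xs)"
    have N: "\<forall>w\<in>set ws. length w \<le> N"
      using member_le_sum_list[of _ "map length xs"] by (auto simp: ws xs N_def)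
    then have xN: "length x \<le> N" by (simp add: ws)
    define out where "out = weval a ws (\<lambda>_. 0)"
    have outN: "length out \<le> poly q N" unfolding out_def by (rule q[OF N]) simp
    define cn where "cn = (\<lambda>i. if i < r then map sym (ws ! i) else [3])"
    define pre where "pre = map sym x @ [3]"
    interpret input_counters pre cn K ws by unfold_locales (use len in \<open>auto simp: cn_def ws xs\<close>)
    define T0 where "T0 = map word_tape (xs @ replicate (Suc K - r) [])"
    have lT0: "length T0 = Suc K" using len by (simp add: T0_def K_def)
    have T0_0: "T0 ! 0 = list_tape (map sym x) 0" by (simp add: T0_def xs word_tape_list_tape)
    have T0_r: "T0 ! i = list_tape [] 0" if "r \<le> i" "i \<le> K" for i
      using that len by (simp add: T0_def nth_append word_tape_list_tape K_def del: replicate_Suc)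
    have T0_s: "T0 ! Suc i = list_tape (map sym (ys ! i)) 0" if "Suc i < r" for i
      using that len xs by (simp add: T0_def nth_append word_tape_list_tape)
    have "T0[0 := list_tape (map sym x) 0, r := list_tape [] 0] = T0"
      using T0_0 T0_r[of r] by (metis K_def add.assoc le_add1 list_update_id order.refl)
    then have 1: "exec (copy r) T0 (4 * length x + 1) (T0[0 := list_tape (map sym x) (int (length x)), r := list_tape (map sym x) (int (length x))])"
      using exec_copy[of r T0 x] r lT0 T0_0 T0_r[of r] by (simp add: K_def)
    have 2: "exec (rewind r) (T0[0 := list_tape (map sym x) (int (length x)), r := list_tape (map sym x) (int (length x))])
       (2 * length x + 3) (T0[0 := list_tape (map sym x) (int (length x)), r := list_tape (map sym x) 0])"
      using exec_rewind[of r "T0[0 := list_tape (map sym x) (int (length x))]" x] lT0 by (simp add: K_def)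
    have 3: "exec (Wr 0 3 MoveRight) (T0[0 := list_tape (map sym x) (int (length x)), r := list_tape (map sym x) 0]) 1
       (T0[0 := list_tape pre (int (length pre)), r := list_tape (map sym x) 0])"
      using exec_Wr_list_tape[of 0 "T0[0 := list_tape (map sym x) (int (length x)), r := list_tape (map sym x) 0]" "map sym x" 3] lT0 r
      by (simp add: pre_def list_update_swap)
    have "exec (marks (Suc r) (wscratch a + 2)) (T0[0 := list_tape pre (int (length pre)), r := list_tape (map sym x) 0]) (Suc (wscratch a + 2))
       (map (\<lambda>j. if Suc r \<le> j \<and> j < Suc r + (wscratch a + 2) then list_tape [3] 0 else T0[0 := list_tape pre (int (length pre)), r := list_tape (map sym x) 0] ! j)
         [0..<length (T0[0 := list_tape pre (int (length pre)), r := list_tape (map sym x) 0])])"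
      by (rule exec_marks) (use lT0 T0_r in \<open>auto simp: K_def nth_list_update\<close>)
    also have "map (\<lambda>j. if Suc r \<le> j \<and> j < Suc r + (wscratch a + 2) then list_tape [3] 0 else T0[0 := list_tape pre (int (length pre)), r := list_tape (map sym x) 0] ! j)
         [0..<length (T0[0 := list_tape pre (int (length pre)), r := list_tape (map sym x) 0])] = tapes pre cn K [] (\<lambda>_. 0)" (is "?L = ?R")
    proof (rule nth_equalityI)
      show "length ?L = length ?R" by (simp add: lT0 tapes_length)
      fix j assume "j < length ?L"
      then have j: "j \<le> K" by (simp add: lT0)
      show "?L ! j = ?R ! j"
      proof (cases j)
        case 0
        then show ?thesis using lT0 r by (simp add: tapes_def del: upt_Suc)
      next
        case (Suc i)
        then have R: "?R ! j = list_tape (cn i) 0" using tapes_nth[of i K pre cn "[]" "\<lambda>_. 0"] j by simp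
        consider "Suc i < r" | "Suc i = r" | "r < Suc i" by linarith
        then show ?thesis
        proof cases
          case 1
          then have "ws ! i = ys ! i" using ws len xs by (simp add: nth_append)
          then show ?thesis using 1 Suc lT0 r T0_s[of i] R by (simp add: cn_def K_def del: upt_Suc)
        next
          case 2
          then have "ws ! i = x" using ws len xs by (auto simp: nth_append)
          then show ?thesis using 2 Suc lT0 r R by (auto simp: cn_def K_def simp del: upt_Suc)
        next
          case 3
          then show ?thesis using Suc lT0 r R j by (auto simp: cn_def K_def simp del: upt_Suc)
        qed
      qed
    qed
    finally have 4: "exec (marks (Suc r) (wscratch a + 2)) (T0[0 := list_tape pre (int (length pre)), r := list_tape (map sym x) 0]) (Suc (wscratch a + 2))
       (tapes pre cn K [] (\<lambda>_. 0))" .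
    have "ok (wscratch a) (Suc r) (\<lambda>_. r) (\<lambda>_. 0) N" unfolding ok_def using N ws by (auto simp: K_def)
    from p[OF input_counters_axioms, of pre K, unfolded wworks_def ws(2), rule_format, OF this, of "[]"]
    have "runs (wcomp r a (\<lambda>_. r) (Suc r)) [] (\<lambda>_. 0) (poly p N) out (\<lambda>_. 0)"
      by (simp add: out_def)
    then obtain t where t: "t \<le> poly p N"
      and 5: "exec (wcomp r a (\<lambda>_. r) (Suc r)) (tapes pre cn K [] (\<lambda>_. 0)) t (tapes pre cn K out (\<lambda>_. 0))"
      by (rule runsE)
    \<comment> \<open>The distance from the free cell behind the output to the marker in front of
      it.\<close>
    define n where "n = Suc (length out)"
    define c where "c = pre @ map sym out"
    define T where "T = (\<lambda>j. (tapes pre cn K out (\<lambda>_. 0))[0 := list_tape c (int (length pre + length out) - int j)])"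
    have "exec (While 0 (\<lambda>s. s \<noteq> 3) (Mv 0 MoveLeft)) (T 0) (n * (1 + 1) + 1) (T n)"
    proof (rule exec_While)
      fix j assume j: "j < n"
      then have e: "int (length pre + length out) - int j = int (length pre + length out - j)" by (simp add: n_def)
      have "T j ! 0 = list_tape c (int (length pre + length out - j))" unfolding T_def e by (simp add: tapes_def)
      then have "read (T j ! 0) = (if j = 0 then 0 else sym (out ! (length out - j)))"
        using j by (simp only: read_list_tape) (auto simp: c_def nth_append n_def)
      then show "read (T j ! 0) \<noteq> 3" by (auto simp: sym_def)
      show "exec (Mv 0 MoveLeft) (T j) 1 (T (Suc j))"
        using exec_Mv_list_tape[of 0 "T j" c "int (length pre + length out) - int j" "int (length pre + length out) - int (Suc j)" MoveLeft]
        by (simp add: T_def tapes_length)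
    next
      have e: "int (length pre + length out) - int n = int (length x)" by (simp add: n_def pre_def)
      have "T n ! 0 = list_tape c (int (length x))" unfolding T_def e by (simp add: tapes_def)
      then show "\<not> read (T n ! 0) \<noteq> 3"
        by (simp only: read_list_tape) (simp add: c_def nth_append pre_def)
    qed (simp_all add: T_def tapes_length)
    moreover have "T 0 = tapes pre cn K out (\<lambda>_. 0)" by (simp add: T_def c_def tapes_def)
    ultimately have 6: "exec (While 0 (\<lambda>s. s \<noteq> 3) (Mv 0 MoveLeft)) (tapes pre cn K out (\<lambda>_. 0)) (n * (1 + 1) + 1) (T n)"
      by simp
    have 7: "exec (Mv 0 MoveRight) (T n) 1 ((T n)[0 := list_tape c (int (length pre))])"
      by (rule exec_Mv_list_tape[where h = "int (length pre + length out) - int n"]) (auto simp: T_def tapes_length n_def tapes_def)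
    define t' where "t' = (4 * length x + 1) + ((2 * length x + 3) + (1 + (Suc (wscratch a + 2) + (t + ((n * (1 + 1) + 1) + 1)))))"
    have "exec (main r a) T0 t' ((T n)[0 := list_tape c (int (length pre))])"
      unfolding main_def t'_def by (intro exec.Seq[OF 1] exec.Seq[OF 2] exec.Seq[OF 3] exec.Seq[OF 4] exec.Seq[OF 5] exec.Seq[OF 6] 7)
    from exec_tm_of[OF this, of "Suc K"]
    have run: "(step M ^^ t') (0, T0) = (num_states M, (T n)[0 := list_tape c (int (length pre))])" by (simp add: M_def)
    have "t' \<le> poly P N" using t xN outN by (simp add: t'_def P_def n_def)
    then obtain u where u: "poly P N = t' + u" using le_Suc_ex by blast
    have "(step M ^^ poly P N) (0, T0) = (num_states M, (T n)[0 := list_tape c (int (length pre))])"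
      unfolding u by (rule funpow_compose[OF run steps_halted])
    moreover have "start_config M xs = (0, T0)" by (simp add: start_config_def T0_def M_def tm_of_def len)
    moreover have "tape_word (hd ((T n)[0 := list_tape c (int (length pre))])) out"
      by (simp add: T_def tapes_def tape_word_def list_tape_def c_def nth_append nat_add_distrib)
    ultimately show "computes_within M xs (weval a (rotate1 xs) (\<lambda>_. 0)) (poly P (sum_list (map length xs)))"
      by (simp add: computes_within_def N_def out_def ws_def)
  qed
qed

section \<open>Polynomial time by inspection of the defining term\<close>

primrec ren :: "expr \<Rightarrow> (nat \<Rightarrow> nat) \<Rightarrow> expr" where
  "ren (Cn c) f = Cn c"
| "ren (Vr v) f = Vr (f v)"
| "ren (Add a b) f = Add (ren a f) (ren b f)"
| "ren (Sub a b) f = Sub (ren a f) (ren b f)"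
| "ren (Sm a b) f = Sm (ren a f) (ren b (case_nat 0 (\<lambda>i. Suc (f i))))"
| "ren (Lk k a) f = Lk k (ren a f)"
| "ren (Ln k) f = Ln k"

lemma eval_ren: "eval (ren e f) ws ns = eval e ws (\<lambda>i. ns (f i))"
proof (induction e arbitrary: f ns)
  case (Sm a b)
  have "(\<lambda>i. case_nat j ns (case_nat 0 (\<lambda>i. Suc (f i)) i)) = case_nat j (\<lambda>i. ns (f i))" for j
    by (auto split: nat.split)
  then show ?case by (simp add: Sm)
qed auto

text \<open>Functions and predicates of the input words and of a stack of numbers, addressed by
  de Bruijn indices.\<close>

definition pn :: "(bool list list \<Rightarrow> (nat \<Rightarrow> nat) \<Rightarrow> nat) \<Rightarrow> bool" where
  "pn F \<longleftrightarrow> (\<exists>e. \<forall>ws ns. F ws ns = eval e ws ns)"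

definition pb :: "(bool list list \<Rightarrow> (nat \<Rightarrow> nat) \<Rightarrow> bool) \<Rightarrow> bool" where
  "pb P \<longleftrightarrow> pn (\<lambda>ws ns. of_bool (P ws ns))"

definition pw :: "(bool list list \<Rightarrow> (nat \<Rightarrow> nat) \<Rightarrow> bool list) \<Rightarrow> bool" where
  "pw F \<longleftrightarrow> (\<exists>a. \<forall>ws ns. F ws ns = weval a ws ns)"

lemma pn_ren: "pn F \<Longrightarrow> pn (\<lambda>ws ns. F ws (\<lambda>i. ns (f i)))"
  unfolding pn_def using eval_ren by metis

lemma pn_const: "pn (\<lambda>ws ns. c)"
  unfolding pn_def by (rule exI[of _ "Cn c"]) simp

lemma pn_var: "pn (\<lambda>ws ns. ns i)"
  unfolding pn_def by (rule exI[of _ "Vr i"]) simp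

lemma pn_length: "pn (\<lambda>ws ns. length (word ws k))"
  unfolding pn_def by (rule exI[of _ "Ln k"]) simp

lemma pn_add: "pn F \<Longrightarrow> pn G \<Longrightarrow> pn (\<lambda>ws ns. F ws ns + G ws ns)"
  unfolding pn_def by (metis eval.simps(3))

lemma pn_diff: "pn F \<Longrightarrow> pn G \<Longrightarrow> pn (\<lambda>ws ns. F ws ns - G ws ns)"
  unfolding pn_def by (metis eval.simps(4))

text \<open>The second premise presents the body with the index as entry 0 of the stack and the rest
  shifted. In this form \<open>intro\<close> finds \<open>G\<close> by higher-order unification and
  descends below the binder, so closure proofs follow the syntax of a definition.\<close>

lemma pn_sum:
  assumes "pn F" "pn (\<lambda>ws ns. G ws (ns 0) (\<lambda>i. ns (Suc i)))"
  shows "pn (\<lambda>ws ns. \<Sum>j<F ws ns. G ws j ns)"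
proof -
  obtain a b where a: "\<And>ws ns. F ws ns = eval a ws ns"
    and b: "\<And>ws ns. G ws (ns 0) (\<lambda>i. ns (Suc i)) = eval b ws ns"
    using assms unfolding pn_def by blast
  have "G ws j ns = eval b ws (case_nat j ns)" for ws j ns
    using b[of ws "case_nat j ns"] by simp
  then show ?thesis unfolding pn_def by (intro exI[of _ "Sm a b"]) (simp add: a)
qed

lemma pn_Suc: "pn F \<Longrightarrow> pn (\<lambda>ws ns. Suc (F ws ns))"
  using pn_add[OF pn_const[of 1]] by simp

text \<open>A product is a sum with constant summand; the body is renamed by \<open>Suc\<close>
  because the index occupies entry 0.\<close>

lemma pn_mult:
  assumes "pn F" "pn G" shows "pn (\<lambda>ws ns. F ws ns * G ws ns)"
  using pn_sum[of F "\<lambda>ws j ns. G ws ns", OF assms(1) pn_ren[of G Suc, OF assms(2)]] by simp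

lemma pn_of_bool: "pb P \<Longrightarrow> pn (\<lambda>ws ns. of_bool (P ws ns))"
  by (simp add: pb_def)

lemma pn_poly: "pn F \<Longrightarrow> pn (\<lambda>ws ns. poly p (F ws ns))"
  by (induction p) (auto intro: pn_const pn_add pn_mult)

lemma pb_eqI: "pn F \<Longrightarrow> (\<And>ws ns. of_bool (P ws ns) = F ws ns) \<Longrightarrow> pb P"
  by (simp add: pb_def)

lemma pb_const: "pb (\<lambda>ws ns. c)"
  unfolding pb_def by (rule pn_const)

lemma pb_bit: "pn F \<Longrightarrow> pb (\<lambda>ws ns. bit (word ws k) (F ws ns))"
  unfolding pb_def pn_def by (metis eval.simps(6))

lemma pb_not: "pb P \<Longrightarrow> pb (\<lambda>ws ns. \<not> P ws ns)"
  by (rule pb_eqI[OF pn_diff[OF pn_const[of 1] pn_of_bool]]) auto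

lemma pb_and:
  assumes "pb P" "pb Q" shows "pb (\<lambda>ws ns. P ws ns \<and> Q ws ns)"
proof (rule pb_eqI)
  show "pn (\<lambda>ws ns. of_bool (P ws ns) * of_bool (Q ws ns))" by (intro pn_mult pn_of_bool assms)
qed auto

lemma pb_or:
  assumes "pb P" "pb Q" shows "pb (\<lambda>ws ns. P ws ns \<or> Q ws ns)"
proof -
  have "pb (\<lambda>ws ns. \<not> (\<not> P ws ns \<and> \<not> Q ws ns))" by (intro pb_not pb_and assms)
  then show ?thesis by simp
qed

lemma pb_imp:
  assumes "pb P" "pb Q" shows "pb (\<lambda>ws ns. P ws ns \<longrightarrow> Q ws ns)"
proof -
  have "pb (\<lambda>ws ns. \<not> P ws ns \<or> Q ws ns)" by (intro pb_not pb_or assms)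
  then show ?thesis by simp
qed

lemma pb_iff:
  assumes "pb P" "pb Q" shows "pb (\<lambda>ws ns. P ws ns = Q ws ns)"
proof -
  have "pb (\<lambda>ws ns. (P ws ns \<longrightarrow> Q ws ns) \<and> (Q ws ns \<longrightarrow> P ws ns))" by (intro pb_and pb_imp assms)
  then show ?thesis by (simp only: iff_conv_conj_imp)
qed

text \<open>The truth value is \<open>1 - (F - G)\<close> in truncated subtraction.\<close>

lemma pb_le: "pn F \<Longrightarrow> pn G \<Longrightarrow> pb (\<lambda>ws ns. F ws ns \<le> G ws ns)"
proof (rule pb_eqI[OF pn_diff[OF pn_const[of 1]]])
  assume "pn F" "pn G" then show "pn (\<lambda>ws ns. F ws ns - G ws ns)" by (rule pn_diff)
qed auto

lemma pb_less:
  assumes "pn F" "pn G" shows "pb (\<lambda>ws ns. F ws ns < G ws ns)"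
proof -
  have "pb (\<lambda>ws ns. \<not> G ws ns \<le> F ws ns)" by (intro pb_not pb_le assms)
  then show ?thesis by (simp add: not_le)
qed

lemma pb_eq:
  assumes "pn F" "pn G" shows "pb (\<lambda>ws ns. F ws ns = G ws ns)"
proof -
  have "pb (\<lambda>ws ns. F ws ns \<le> G ws ns \<and> G ws ns \<le> F ws ns)" by (intro pb_and pb_le assms)
  then show ?thesis by (simp add: eq_iff)
qed

lemma pb_ex_less:
  assumes "pn F" "pb (\<lambda>ws ns. P ws (ns 0) (\<lambda>i. ns (Suc i)))"
  shows "pb (\<lambda>ws ns. \<exists>j<F ws ns. P ws j ns)"
proof -
  have "pb (\<lambda>ws ns. 0 < (\<Sum>j<F ws ns. of_bool (P ws j ns) :: nat))"
    by (intro pb_less pn_const pn_sum assms pn_of_bool)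
  moreover have "0 < (\<Sum>j<F ws ns. of_bool (P ws j ns) :: nat) \<longleftrightarrow> (\<exists>j<F ws ns. P ws j ns)" for ws ns
    by (auto simp: zero_less_iff_neq_zero)
  ultimately show ?thesis by simp
qed

lemma pb_all_less:
  assumes "pn F" "pb (\<lambda>ws ns. P ws (ns 0) (\<lambda>i. ns (Suc i)))"
  shows "pb (\<lambda>ws ns. \<forall>j<F ws ns. P ws j ns)"
  using pb_not[OF pb_ex_less[OF assms(1) pb_not[OF assms(2)]]] by simp

text \<open>For finite sets fixed independently of the input, such as operators or machine labels:
  the disjunction is unfolded inside the term.\<close>

lemma pb_bex: "finite A \<Longrightarrow> (\<And>a. a \<in> A \<Longrightarrow> pb (P a)) \<Longrightarrow> pb (\<lambda>ws ns. \<exists>a\<in>A. P a ws ns)"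
  by (induction A rule: finite_induct) (auto intro: pb_const pb_or)

lemma pn_if: "pb P \<Longrightarrow> pn F \<Longrightarrow> pn G \<Longrightarrow> pn (\<lambda>ws ns. if P ws ns then F ws ns else G ws ns)"
proof -
  assume "pb P" "pn F" "pn G"
  then have "pn (\<lambda>ws ns. of_bool (P ws ns) * F ws ns + of_bool (\<not> P ws ns) * G ws ns)"
    by (intro pn_add pn_mult pn_of_bool pb_not)
  moreover have "of_bool (P ws ns) * F ws ns + of_bool (\<not> P ws ns) * G ws ns = (if P ws ns then F ws ns else G ws ns)"
    for ws ns by simp
  ultimately show ?thesis by simp
qed

lemma pw_Nil: "pw (\<lambda>ws ns. [])"
  unfolding pw_def by (rule exI[of _ "WFr (Cn 0) (Em (Cn 0))"]) simp

lemma pw_append: "pw F \<Longrightarrow> pw G \<Longrightarrow> pw (\<lambda>ws ns. F ws ns @ G ws ns)"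
  unfolding pw_def by (metis weval.simps(2))

lemma pw_single: "pb P \<Longrightarrow> pw (\<lambda>ws ns. [P ws ns])"
proof -
  assume "pb P"
  then obtain e where e: "\<And>ws ns. of_bool (P ws ns) = eval e ws ns" unfolding pb_def pn_def by blast
  have "[P ws ns] = weval (Em e) ws ns" for ws ns using e[of ws ns, symmetric] by simp
  then show ?thesis unfolding pw_def by blast
qed

lemma pw_Cons: "pb P \<Longrightarrow> pw F \<Longrightarrow> pw (\<lambda>ws ns. P ws ns # F ws ns)"
  using pw_append[OF pw_single] by simp

lemma pw_concat:
  assumes "pn F" "pw (\<lambda>ws ns. G ws (ns 0) (\<lambda>i. ns (Suc i)))"
  shows "pw (\<lambda>ws ns. concat (map (\<lambda>j. G ws j ns) [0..<F ws ns]))"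
proof -
  obtain a b where a: "\<And>ws ns. F ws ns = eval a ws ns"
    and b: "\<And>ws ns. G ws (ns 0) (\<lambda>i. ns (Suc i)) = weval b ws ns"
    using assms unfolding pn_def pw_def by blast
  have "G ws j ns = weval b ws (case_nat j ns)" for ws j ns
    using b[of ws "case_nat j ns"] by simp
  then show ?thesis unfolding pw_def by (intro exI[of _ "WFr a b"]) (simp add: a)
qed

lemma concat_map_single: "concat (map (\<lambda>j. [f j]) xs) = map f xs"
  by (induction xs) auto

lemma pw_map:
  assumes "pn F" "pb (\<lambda>ws ns. P ws (ns 0) (\<lambda>i. ns (Suc i)))"
  shows "pw (\<lambda>ws ns. map (\<lambda>j. P ws j ns) [0..<F ws ns])"
  using pw_concat[OF assms(1) pw_single[OF assms(2)]] by (simp add: concat_map_single)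

lemma pw_unary: "pn F \<Longrightarrow> pw (\<lambda>ws ns. unary (F ws ns))"
  using pw_append[OF pw_map[of F "\<lambda>ws j ns. True"] pw_single[OF pb_const[of False]]]
  by (simp add: unary_def pb_const map_replicate_const)

lemma pw_concat_list:
  "(\<And>a. a \<in> set l \<Longrightarrow> pw (F a)) \<Longrightarrow> pw (\<lambda>ws ns. concat (map (\<lambda>a. F a ws ns) l))"
  by (induction l) (auto intro: pw_Nil pw_append)

lemmas pn_intros = pn_const pn_var pn_length pn_add pn_diff pn_sum pn_Suc pn_mult pn_of_bool pn_poly pn_if
  pb_const pb_bit pb_not pb_and pb_or pb_imp pb_iff pb_le pb_less pb_eq pb_ex_less pb_all_less

lemmas pw_intros = pw_Nil pw_append pw_Cons pw_map pw_concat pw_unary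

lemma polytime_pw: "pw F \<Longrightarrow> 1 \<le> r \<Longrightarrow> polytime r (\<lambda>xs. F (rotate1 xs) (\<lambda>_. 0))"
  unfolding pw_def using polytime_weval by auto

section \<open>Semantics of CTL\<close>

lemma paths_states:
  assumes "is_kripke K" "q \<in> states K" "\<rho> \<in> paths K q"
  shows "\<rho> i \<in> states K"
proof (induction i)
  case (Suc i)
  then show ?case using assms(1,3) by (auto simp: is_kripke_def paths_def)
qed (use assms in \<open>simp add: paths_def\<close>)

text \<open>A record also fixes \<open>label\<close> and \<open>succ\<close> outside
  \<open>states\<close>, which an encoding cannot express; structures are therefore compared on
  their states only.\<close>

definition agree :: "('q, 'p) kripke \<Rightarrow> ('q, 'p) kripke \<Rightarrow> bool" where
  "agree K K' \<longleftrightarrow> states K = states K' \<and> init K = init K' \<and> props K = props K' \<and>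
     (\<forall>q\<in>states K. label K q = label K' q \<and> succ K q = succ K' q)"

lemma agree_sym: "agree K K' \<Longrightarrow> agree K' K"
  by (simp add: agree_def)

lemma agree_kripke: "agree K K' \<Longrightarrow> is_kripke K \<Longrightarrow> is_kripke K'"
  unfolding agree_def is_kripke_def by metis

lemma agree_paths_le:
  assumes "agree K K'" "is_kripke K" "q \<in> states K"
  shows "paths K q \<subseteq> paths K' q"
proof
  fix \<rho> assume \<rho>: "\<rho> \<in> paths K q"
  then show "\<rho> \<in> paths K' q"
    using paths_states[OF assms(2,3) \<rho>] assms(1) by (auto simp: paths_def agree_def)
qed

lemma agree_paths:
  assumes "agree K K'" "is_kripke K" "q \<in> states K"
  shows "paths K q = paths K' q"
  using agree_paths_le[OF assms] agree_paths_le[OF agree_sym[OF assms(1)] agree_kripke[OF assms(1,2)]] assms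
  by (auto simp: agree_def)

lemma sat_agree:
  assumes "agree K K'" "is_kripke K"
  shows "q \<in> states K \<Longrightarrow> sat K \<phi> q = sat K' \<phi> q"
proof (induction \<phi> arbitrary: q)
  case (Atom p)
  then show ?case using assms by (auto simp: agree_def)
next
  case (Exists t \<phi>)
  have "(\<lambda>i. sat K \<phi> (\<rho> i)) = (\<lambda>i. sat K' \<phi> (\<rho> i))" if "\<rho> \<in> paths K q" for \<rho>
    using Exists.IH paths_states[OF assms(2) Exists.prems that] by auto
  then show ?case using agree_paths[OF assms Exists.prems] by auto
next
  case (Forall t \<phi>)
  have "(\<lambda>i. sat K \<phi> (\<rho> i)) = (\<lambda>i. sat K' \<phi> (\<rho> i))" if "\<rho> \<in> paths K q" for \<rho>
    using Forall.IH paths_states[OF assms(2) Forall.prems that] by auto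
  then show ?case using agree_paths[OF assms Forall.prems] by auto
qed auto

lemma models_agree: "agree K K' \<Longrightarrow> is_kripke K \<Longrightarrow> models K \<phi> = models K' \<phi>"
  using sat_agree[of K K'] by (auto simp: models_def agree_def is_kripke_def subset_iff)

lemma path_step: "\<rho> \<in> paths K q \<Longrightarrow> \<rho> 1 \<in> succ K q \<and> (\<lambda>i. \<rho> (Suc i)) \<in> paths K (\<rho> 1)"
  by (auto simp: paths_def)

lemma path_Cons: "r \<in> succ K q \<Longrightarrow> \<rho> \<in> paths K r \<Longrightarrow> case_nat q \<rho> \<in> paths K q"
  by (auto simp: paths_def split: nat.split)

text \<open>Iterate a choice function for successors inside \<open>A\<close>. This gives both the
  existence of paths and the counterexample paths that avoid a set.\<close>

lemma path_within:
  assumes "q \<in> A" "\<And>r. r \<in> A \<Longrightarrow> \<exists>s\<in>A. s \<in> succ K r"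
  obtains \<rho> where "\<rho> \<in> paths K q" "\<And>i. \<rho> i \<in> A"
proof -
  define f where "f r = (SOME s. s \<in> A \<and> s \<in> succ K r)" for r
  have f: "f r \<in> A \<and> f r \<in> succ K r" if "r \<in> A" for r
    unfolding f_def using assms(2)[OF that] by (metis (mono_tags, lifting) someI)
  define \<rho> where "\<rho> i = (f ^^ i) q" for i
  have A: "\<rho> i \<in> A" for i by (induction i) (use assms(1) f in \<open>auto simp: \<rho>_def\<close>)
  have "\<rho> \<in> paths K q" using f A by (auto simp: paths_def) (auto simp: \<rho>_def)
  with A that show thesis by blast
qed

lemma path_ex:
  assumes "is_kripke K" "q \<in> states K"
  obtains \<rho> where "\<rho> \<in> paths K q"
  by (rule path_within[of q "states K" K]) (use assms in \<open>unfold is_kripke_def, blast+\<close>)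

text \<open>\<open>e\<close> encodes the path quantifier, existential if true; treating both at once
  halves the fixed point arguments.\<close>

definition quant :: "bool \<Rightarrow> 'q set \<Rightarrow> ('q \<Rightarrow> bool) \<Rightarrow> bool" where
  "quant e A P \<longleftrightarrow> (if e then \<exists>r\<in>A. P r else \<forall>r\<in>A. P r)"

lemma sat_Next:
  assumes "is_kripke K" "q \<in> states K"
  shows "sat K (Exists Next \<phi>) q \<longleftrightarrow> quant True (succ K q) (sat K \<phi>)"
    and "sat K (Forall Next \<phi>) q \<longleftrightarrow> quant False (succ K q) (sat K \<phi>)"
proof -
  have 1: "\<exists>\<rho>\<in>paths K q. \<rho> 1 = r" if r: "r \<in> succ K q" for r
  proof -
    have "r \<in> states K" using assms r by (auto simp: is_kripke_def)
    then obtain \<rho> where \<rho>: "\<rho> \<in> paths K r" using path_ex[OF assms(1)] by blast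
    then show ?thesis using path_Cons[OF r \<rho>] by (intro bexI[of _ "case_nat q \<rho>"]) (auto simp: paths_def)
  qed
  show "sat K (Exists Next \<phi>) q \<longleftrightarrow> quant True (succ K q) (sat K \<phi>)"
    using 1 path_step[of _ K q] by (auto simp: quant_def)
  show "sat K (Forall Next \<phi>) q \<longleftrightarrow> quant False (succ K q) (sat K \<phi>)"
    using 1 path_step[of _ K q] by (auto simp: quant_def)
qed

definition evt :: "('q, 'p) kripke \<Rightarrow> bool \<Rightarrow> ('q \<Rightarrow> bool) \<Rightarrow> 'q \<Rightarrow> bool" where
  "evt K e b q \<longleftrightarrow> (if e then \<exists>\<rho>\<in>paths K q. \<exists>i. b (\<rho> i) else \<forall>\<rho>\<in>paths K q. \<exists>i. b (\<rho> i))"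

text \<open>G is reduced to F by duality, which swaps the path quantifier. So the single notion
  \<open>evt\<close> covers four operators.\<close>

lemma sat_evt:
  "sat K (Exists Finally \<phi>) q = evt K True (sat K \<phi>) q"
  "sat K (Forall Finally \<phi>) q = evt K False (sat K \<phi>) q"
  "sat K (Exists Globally \<phi>) q = (\<not> evt K False (\<lambda>r. \<not> sat K \<phi> r) q)"
  "sat K (Forall Globally \<phi>) q = (\<not> evt K True (\<lambda>r. \<not> sat K \<phi> r) q)"
  by (auto simp: evt_def)

text \<open>A set is the least fixed point of \<open>Z = b \<union> pre Z\<close> iff it is closed and membership is
  justified along a decreasing rank; this makes reachability checkable locally.\<close>

definition ranked :: "('q, 'p) kripke \<Rightarrow> bool \<Rightarrow> ('q \<Rightarrow> bool) \<Rightarrow> ('q \<Rightarrow> bool) \<Rightarrow> ('q \<Rightarrow> nat) \<Rightarrow> bool" where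
  "ranked K e b z rk \<longleftrightarrow> (\<forall>q\<in>states K. (b q \<or> quant e (succ K q) z \<longrightarrow> z q) \<and>
     (z q \<longrightarrow> b q \<or> quant e (succ K q) (\<lambda>r. z r \<and> rk r < rk q)))"

text \<open>Induction on the rank: a state outside \<open>b\<close> passes the obligation on to
  successors of smaller rank, to one or to all of them according to \<open>e\<close>.\<close>

lemma ranked_imp_evt:
  assumes K: "is_kripke K" and R: "ranked K e b z rk" and "q \<in> states K" "z q"
  shows "evt K e b q"
  using assms(3,4)
proof (induction "rk q" arbitrary: q rule: less_induct)
  case less
  have c: "b q \<or> quant e (succ K q) (\<lambda>r. z r \<and> rk r < rk q)" using R less.prems by (auto simp: ranked_def)
  have sub: "r \<in> states K" if "r \<in> succ K q" for r using K less.prems(1) that by (auto simp: is_kripke_def)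
  show ?case
  proof (cases "b q")
    case True
    obtain \<rho> where "\<rho> \<in> paths K q" using path_ex[OF K less.prems(1)] by blast
    moreover have "b (\<rho> 0)" if "\<rho> \<in> paths K q" for \<rho> using True that by (simp add: paths_def)
    ultimately show ?thesis unfolding evt_def by auto
  next
    case b: False
    show ?thesis
    proof (cases e)
      case True
      then obtain r where r: "r \<in> succ K q" "z r" "rk r < rk q" using c b by (auto simp: quant_def)
      have "evt K e b r" by (rule less.hyps) (use r sub in auto)
      then obtain \<rho> i where "\<rho> \<in> paths K r" "b (\<rho> i)" using True by (auto simp: evt_def)
      then have "case_nat q \<rho> \<in> paths K q" "b (case_nat q \<rho> (Suc i))" using path_Cons[OF r(1)] by auto
      then have "\<exists>\<rho>\<in>paths K q. \<exists>i. b (\<rho> i)" by blast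
      then show ?thesis using True by (simp add: evt_def)
    next
      case False
      have "\<exists>i. b (\<rho> i)" if \<rho>: "\<rho> \<in> paths K q" for \<rho>
      proof -
        have s: "\<rho> 1 \<in> succ K q" "(\<lambda>i. \<rho> (Suc i)) \<in> paths K (\<rho> 1)" using path_step[OF \<rho>] by auto
        then have "z (\<rho> 1)" "rk (\<rho> 1) < rk q" using c b False by (auto simp: quant_def)
        then have "evt K e b (\<rho> 1)" using less.hyps sub s by blast
        then show ?thesis using s False unfolding evt_def by auto
      qed
      then show ?thesis using False unfolding evt_def by auto
    qed
  qed
qed

text \<open>Leastness. In the existential case go backwards along a path that reaches
  \<open>b\<close>. In the universal case every state outside \<open>z\<close> has a successor
  outside \<open>z\<close>, and following these gives a path that avoids \<open>b\<close>.\<close>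

lemma evt_imp_closed:
  assumes K: "is_kripke K" and R: "\<And>q. q \<in> states K \<Longrightarrow> b q \<or> quant e (succ K q) z \<Longrightarrow> z q"
    and q: "q \<in> states K" "evt K e b q"
  shows "z q"
proof (cases e)
  case True
  then obtain \<rho> i where "\<rho> \<in> paths K q" "b (\<rho> i)" using q by (auto simp: evt_def)
  then show ?thesis using q(1)
  proof (induction i arbitrary: \<rho> q)
    case 0
    then show ?case using R[of q] by (auto simp: paths_def)
  next
    case (Suc i)
    have s: "\<rho> 1 \<in> succ K q" "(\<lambda>i. \<rho> (Suc i)) \<in> paths K (\<rho> 1)" using path_step[OF Suc.prems(1)] by auto
    have "\<rho> 1 \<in> states K" using paths_states[OF K Suc.prems(3,1)] .
    then have "z (\<rho> 1)" using Suc.IH[OF s(2)] Suc.prems by simp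
    then show ?case using R[of q] Suc.prems s True by (auto simp: quant_def)
  qed
next
  case False
  show ?thesis
  proof (rule ccontr)
    assume "\<not> z q"
    obtain \<rho> where "\<rho> \<in> paths K q" "\<And>i. \<rho> i \<in> {r \<in> states K. \<not> z r}"
    proof (rule path_within[of q "{r \<in> states K. \<not> z r}" K])
      fix r assume r: "r \<in> {r \<in> states K. \<not> z r}"
      then obtain s where "s \<in> succ K r" "\<not> z s" using R[of r] False by (auto simp: quant_def)
      then show "\<exists>s\<in>{r \<in> states K. \<not> z r}. s \<in> succ K r" using K r by (auto simp: is_kripke_def)
    qed (use q \<open>\<not> z q\<close> in auto)
    then show False using q False R by (auto simp: evt_def)
  qed
qed

lemma ranked_evt:
  assumes "is_kripke K" "ranked K e b z rk" "q \<in> states K"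
  shows "z q = evt K e b q"
  using ranked_imp_evt[OF assms(1,2)] evt_imp_closed[OF assms(1), of b e z q] assms
  unfolding ranked_def by blast

lemma quant_mono:
  assumes "quant e A P" "\<And>r. r \<in> A \<Longrightarrow> P r \<Longrightarrow> Q r"
  shows "quant e A Q"
  using assms(1) by (cases e) (auto simp: quant_def intro: assms(2))

lemma quant_cong: "(\<And>r. r \<in> A \<Longrightarrow> P r = Q r) \<Longrightarrow> quant e A P = quant e A Q"
  by (auto simp: quant_def)

text \<open>The rank of a state comes from the stage at which the fixed point iteration from the
  empty set reaches it.\<close>

lemma evt_ranked:
  assumes K: "is_kripke K"
  shows "\<exists>rk. ranked K e b (evt K e b) rk \<and> (\<forall>q. rk q \<le> card (states K))"
proof -
  have fin: "finite (states K)" using K by (simp add: is_kripke_def)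
  define Z where "Z = rec_nat (\<lambda>q. False) (\<lambda>i z q. b q \<or> quant e (succ K q) z)"
  have Z0: "\<not> Z 0 q" and ZS: "Z (Suc i) q \<longleftrightarrow> b q \<or> quant e (succ K q) (Z i)" for i q by (auto simp: Z_def)
  have step: "Z i q \<Longrightarrow> Z (Suc i) q" for i q
  proof (induction i arbitrary: q)
    case (Suc i)
    then show ?case using quant_mono[of e "succ K q" "Z i" "Z (Suc i)"] by (auto simp: ZS)
  qed (simp add: Z0)
  have mono: "Z i q \<Longrightarrow> i \<le> j \<Longrightarrow> Z j q" for i j q
    by (induction j) (auto simp: le_Suc_eq step)
  define z where "z q \<longleftrightarrow> (\<exists>i. Z i q)" for q
  define rk where "rk q = (LEAST i. Z i q)" for q
  have rkZ: "Z (rk q) q" if "z q" for q unfolding rk_def using that by (auto simp: z_def intro: LeastI)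
  have rkle: "rk q \<le> i" if "Z i q" for i q unfolding rk_def using that by (rule Least_le)
  have R: "ranked K e b z rk"
    unfolding ranked_def
  proof (intro ballI conjI impI)
    fix q assume q: "q \<in> states K"
    have finq: "finite (succ K q)" using K q fin by (auto simp: is_kripke_def intro: finite_subset)
    { assume "b q \<or> quant e (succ K q) z"
      then show "z q"
      proof
        assume "b q" then have "Z (Suc 0) q" by (simp add: ZS) then show "z q" by (auto simp: z_def)
      next
        assume "quant e (succ K q) z"
        \<comment> \<open>A universal step needs one stage that serves all successors; finite
          branching provides the maximum.\<close>
        then have "quant e (succ K q) (Z (Max (rk ` succ K q)))"
          by (rule quant_mono) (use finq rkZ mono in \<open>blast intro: Max_ge finite_imageI imageI\<close>)
        then have "Z (Suc (Max (rk ` succ K q))) q" by (simp add: ZS)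
        then show "z q" unfolding z_def ..
      qed }
    assume zq: "z q"
    then obtain i where i: "rk q = Suc i" using rkZ[of q] Z0 by (cases "rk q") auto
    then have "b q \<or> quant e (succ K q) (Z i)" using rkZ[OF zq] by (simp add: ZS)
    then show "b q \<or> quant e (succ K q) (\<lambda>r. z r \<and> rk r < rk q)"
      using quant_mono[of e "succ K q" "Z i" "\<lambda>r. z r \<and> rk r < rk q"] rkle[of i]
      by (auto simp: i z_def less_Suc_eq_le)
  qed
  \<comment> \<open>Only the order of the ranks matters. Counting the states of smaller stage
    preserves it inside \<open>K\<close> and makes the bound by the number of states
    immediate.\<close>
  define rk' where "rk' q = card {r \<in> states K. rk r < rk q}" for q
  have mono': "rk' r < rk' q" if "rk r < rk q" "r \<in> states K" for r q
    unfolding rk'_def by (rule psubset_card_mono) (use that fin in auto)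
  have "ranked K e b (evt K e b) rk'"
    unfolding ranked_def
  proof (intro ballI)
    fix q assume q: "q \<in> states K"
    have sub: "r \<in> states K" if "r \<in> succ K q" for r using K q that by (auto simp: is_kripke_def)
    have eq: "evt K e b r = z r" if "r \<in> states K" for r using ranked_evt[OF K R that] by simp
    have "quant e (succ K q) (evt K e b) = quant e (succ K q) z" by (rule quant_cong) (simp add: eq sub)
    moreover have "quant e (succ K q) (\<lambda>r. evt K e b r \<and> rk' r < rk' q)" if "quant e (succ K q) (\<lambda>r. z r \<and> rk r < rk q)"
      by (rule quant_mono[OF that]) (use eq sub mono' in auto)
    ultimately show "(b q \<or> quant e (succ K q) (evt K e b) \<longrightarrow> evt K e b q) \<and>
       (evt K e b q \<longrightarrow> b q \<or> quant e (succ K q) (\<lambda>r. evt K e b r \<and> rk' r < rk' q))"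
      using R q eq[OF q] unfolding ranked_def by auto
  qed
  moreover have "rk' q \<le> card (states K)" for q unfolding rk'_def by (rule card_mono[OF fin]) auto
  ultimately show ?thesis by blast
qed

section \<open>Decoding instances\<close>

text \<open>The length of the block of ones starting at \<open>a\<close>, which decodes a unary
  number. It is written as a sum in order to be a term: \<open>j\<close> contributes iff the block
  is longer than \<open>j\<close>.\<close>

definition ones :: "bool list \<Rightarrow> nat \<Rightarrow> nat" where
  "ones x a = (\<Sum>j<length x. of_bool (\<forall>i<Suc j. bit x (a + i)))"

lemma ones_eq:
  assumes "\<And>i. i < m \<Longrightarrow> bit x (a + i)" "\<not> bit x (a + m)"
  shows "ones x a = m"
proof -
  have "m \<le> length x"
  proof (cases m)
    case (Suc i)
    then show ?thesis using assms(1)[of i] by (simp add: bit_def)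
  qed simp
  have "(\<forall>i<Suc j. bit x (a + i)) \<longleftrightarrow> j < m" for j
    using assms by (metis less_Suc_eq less_trans not_less_eq linorder_neqE_nat lessI)
  then have "ones x a = (\<Sum>j<length x. of_bool (j < m))" by (simp add: ones_def)
  also have "\<dots> = card {j. j < length x \<and> j < m}" by (simp add: of_bool_def sum.If_cases Int_def)
  also have "{j. j < length x \<and> j < m} = {..<m}" using \<open>m \<le> length x\<close> by auto
  finally show ?thesis by simp
qed

lemma ones: "i < ones x a \<Longrightarrow> bit x (a + i)" "\<not> bit x (a + ones x a)"
proof -
  define m where "m = (LEAST m. \<not> bit x (a + m))"
  have "\<not> bit x (a + length x)" by (simp add: bit_def)
  then have m: "\<not> bit x (a + m)" unfolding m_def by (rule LeastI)
  have l: "bit x (a + i)" if "i < m" for i using not_less_Least that unfolding m_def by blast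
  have "ones x a = m" by (rule ones_eq) (use m l in auto)
  then show "i < ones x a \<Longrightarrow> bit x (a + i)" "\<not> bit x (a + ones x a)" using l m by auto
qed

lemma ones_le: "ones x a \<le> length x"
  unfolding ones_def by (rule order.trans[OF sum_bounded_above[of _ _ 1]]) auto

lemma bit_append: "bit (u @ v) i = (if i < length u then u ! i else bit v (i - length u))"
  by (auto simp: bit_def nth_append)

lemma bit_shift: "bit (u @ v) (length u + i) = bit v i"
  by (simp add: bit_append)

lemma bit_unary: "bit (unary m @ v) i = (i < m \<or> m < i \<and> bit v (i - Suc m))"
proof -
  consider "i < m" | "i = m" | j where "i = Suc (m + j)" using less_iff_Suc_add by (metis linorder_neqE_nat)
  then show ?thesis by cases (auto simp: bit_def unary_def nth_append Suc_diff_le)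
qed

lemma length_unary: "length (unary m) = Suc m"
  by (simp add: unary_def)

lemma ones_unary: "ones (u @ unary m @ v) (length u) = m"
  by (rule ones_eq) (auto simp: bit_shift bit_unary)

lemma map_bit: "a + n \<le> length x \<Longrightarrow> map (\<lambda>i. bit x (a + i)) [0..<n] = take n (drop a x)"
  by (rule nth_equalityI) (auto simp: bit_def)

lemma drop_unary:
  assumes "a + ones x a < length x"
  shows "drop a x = unary (ones x a) @ drop (a + ones x a + 1) x"
proof -
  have "take (Suc (ones x a)) (drop a x) = unary (ones x a)"
  proof (rule nth_equalityI)
    fix i assume i: "i < length (take (Suc (ones x a)) (drop a x))"
    then show "take (Suc (ones x a)) (drop a x) ! i = unary (ones x a) ! i"
      using ones(1)[of i x a] ones(2)[of x a] assms by (auto simp: unary_def nth_append bit_def less_Suc_eq)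
  qed (use assms in \<open>simp add: length_unary\<close>)
  then show ?thesis using append_take_drop_id[of "Suc (ones x a)" "drop a x"] by (simp add: add.commute)
qed

text \<open>Total on all strings and positions, since bits behind the end count as 0. So parsing
  never fails, and well-formedness is tested afterwards by \<open>endN x = length x\<close> and
  \<open>is_kripke\<close>.\<close>

definition kdec :: "nat \<Rightarrow> bool list \<Rightarrow> nat \<Rightarrow> (nat, nat) kripke" where
  "kdec k x a = (let m = ones x a in
     \<lparr>states = {..<m}, init = {q. q < m \<and> bit x (a + Suc m + q)}, props = {..<k},
      label = (\<lambda>q. {p. p < k \<and> bit x (a + Suc m + m + q * (k + m) + p)}),
      succ = (\<lambda>q. {r. r < m \<and> bit x (a + Suc m + m + q * (k + m) + k + r)})\<rparr>)"

definition ksize :: "nat \<Rightarrow> nat \<Rightarrow> nat" where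
  "ksize k m = Suc m + m + m * (k + m)"

lemma nth_concat_uniform:
  "(\<And>q. q < m \<Longrightarrow> length (f q) = w) \<Longrightarrow> length (concat (map f [0..<m])) = m * w \<and>
   (\<forall>q<m. \<forall>p<w. concat (map f [0..<m]) ! (q * w + p) = f q ! p)"
proof (induction m)
  case (Suc m)
  then have IH: "length (concat (map f [0..<m])) = m * w"
    "\<And>q p. q < m \<Longrightarrow> p < w \<Longrightarrow> concat (map f [0..<m]) ! (q * w + p) = f q ! p" by auto
  have "q * w + p < m * w" if "q < m" "p < w" for q p
  proof -
    have "q * w + p < Suc q * w" using that by simp
    also have "\<dots> \<le> m * w" using that by (intro mult_le_mono1) simp
    finally show ?thesis .
  qed
  then show ?case using IH Suc.prems[of m] by (auto simp: nth_append less_Suc_eq)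
qed simp

definition valid :: "nat \<Rightarrow> (nat, nat) kripke \<Rightarrow> bool" where
  "valid k K \<longleftrightarrow> is_kripke K \<and> props K = {..<k} \<and> (\<exists>m. states K = {..<m})"

lemma encode_kripke_dec:
  assumes "valid k K"
  shows "agree K (kdec k (u @ encode_kripke K @ v) (length u))"
    and "length (encode_kripke K) = ksize k (ones (u @ encode_kripke K @ v) (length u))"
proof -
  obtain m where m: "states K = {..<m}" using assms by (auto simp: valid_def)
  have K: "is_kripke K" "props K = {..<k}" using assms by (auto simp: valid_def)
  define row where "row q = map (\<lambda>p. p \<in> label K q) [0..<k] @ map (\<lambda>r. r \<in> succ K q) [0..<m]" for q
  define ini where "ini = map (\<lambda>q. q \<in> init K) [0..<m]"
  define x where "x = u @ encode_kripke K @ v"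
  have enc: "encode_kripke K = unary m @ ini @ concat (map row [0..<m])"
    using m K by (simp add: encode_kripke_def row_def[abs_def] ini_def)
  have ones: "ones x (length u) = m" unfolding x_def enc using ones_unary by simp
  have rows: "length (concat (map row [0..<m])) = m * (k + m)"
    "\<And>q p. q < m \<Longrightarrow> p < k + m \<Longrightarrow> concat (map row [0..<m]) ! (q * (k + m) + p) = row q ! p"
    using nth_concat_uniform[of m row "k + m"] by (auto simp: row_def)
  have bi: "bit x (length u + Suc m + q) = (q \<in> init K)" if "q < m" for q
  proof -
    have "bit x (length u + Suc m + q) = bit (unary m @ ini @ concat (map row [0..<m]) @ v) (length (unary m) + q)"
      using bit_shift[of u "unary m @ ini @ concat (map row [0..<m]) @ v" "Suc m + q"]
      by (simp add: x_def enc length_unary add.assoc)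
    also have "\<dots> = (q \<in> init K)" unfolding bit_shift using that by (simp add: bit_append ini_def)
    finally show ?thesis .
  qed
  have br: "bit x (length u + Suc m + m + q * (k + m) + p) = row q ! p" if "q < m" "p < k + m" for q p
  proof -
    have e: "length u + Suc m + m + q * (k + m) + p = length (u @ unary m @ ini) + (q * (k + m) + p)"
      by (simp add: length_unary ini_def)
    have "bit x (length u + Suc m + m + q * (k + m) + p) = bit (concat (map row [0..<m]) @ v) (q * (k + m) + p)"
      unfolding e using bit_shift[of "u @ unary m @ ini" "concat (map row [0..<m]) @ v" "q * (k + m) + p"]
      by (simp add: x_def enc)
    moreover have "q * (k + m) + p < m * (k + m)"
    proof -
      have "q * (k + m) + p < Suc q * (k + m)" using that by simp
      also have "\<dots> \<le> m * (k + m)" using that by (intro mult_le_mono1) simp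
      finally show ?thesis .
    qed
    ultimately show ?thesis using rows that by (simp add: bit_append)
  qed
  have "label K q = label (kdec k x (length u)) q" "succ K q = succ (kdec k x (length u)) q" if "q < m" for q
  proof -
    have sub: "label K q \<subseteq> {..<k}" "succ K q \<subseteq> {..<m}" using K m that by (auto simp: is_kripke_def)
    have "p < k \<Longrightarrow> bit x (length u + Suc m + m + q * (k + m) + p) = (p \<in> label K q)" for p
      using br[of q p] that by (simp add: row_def nth_append)
    moreover have "r < m \<Longrightarrow> bit x (length u + Suc m + m + q * (k + m) + (k + r)) = (r \<in> succ K q)" for r
      using br[of q "k + r"] that by (simp add: row_def nth_append)
    ultimately show "label K q = label (kdec k x (length u)) q" "succ K q = succ (kdec k x (length u)) q"
      using sub by (auto simp: kdec_def ones Let_def add.assoc)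
  qed
  moreover have "init K = init (kdec k x (length u))"
    using K m bi by (auto simp: is_kripke_def kdec_def ones Let_def)
  ultimately show "agree K (kdec k (u @ encode_kripke K @ v) (length u))"
    using m K by (auto simp: agree_def x_def[symmetric]) (auto simp: kdec_def ones Let_def)
  show "length (encode_kripke K) = ksize k (ones (u @ encode_kripke K @ v) (length u))"
  proof -
    have "length (encode_kripke K) = ksize k (ones x (length u))"
      unfolding ones using rows by (simp add: enc length_unary ini_def ksize_def)
    then show ?thesis by (simp only: x_def)
  qed
qed

lemma concat_slices:
  "concat (map (\<lambda>q. take w (drop (a + q * w) x)) [0..<m]) = take (m * w) (drop a x)"
proof (induction m)
  case (Suc m)
  then show ?case using take_add[of "m * w" w "drop a x"] by (simp add: add.commute)
qed simp

lemma map_guard: "map (\<lambda>p. p < k \<and> f p) [0..<k] = map f [0..<k]"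
  by (rule map_cong) auto

text \<open>Works for arbitrary bits: as long as the input is long enough, a decoded structure is
  encoded again by exactly the slice it was read from.\<close>

lemma dec_encode_kripke:
  assumes "a + ksize k (ones x a) \<le> length x"
  shows "drop a x = encode_kripke (kdec k x a) @ drop (a + ksize k (ones x a)) x"
proof -
  define m where "m = ones x a"
  have len: "a + (Suc m + m + m * (k + m)) \<le> length x" using assms by (simp add: ksize_def m_def)
  have row: "map (\<lambda>p. p < k \<and> bit x (b + p)) [0..<k] @ map (\<lambda>r. r < m \<and> bit x (b + k + r)) [0..<m] = take (k + m) (drop b x)"
    if "b + (k + m) \<le> length x" for b
  proof -
    have "map (\<lambda>p. p < k \<and> bit x (b + p)) [0..<k] = take k (drop b x)"
      using map_bit[of b k x] that by (simp add: map_guard)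
    moreover have "map (\<lambda>r. r < m \<and> bit x (b + k + r)) [0..<m] = take m (drop (b + k) x)"
      using map_bit[of "b + k" m x] that by (simp add: map_guard)
    ultimately show ?thesis by (simp add: take_add add.commute)
  qed
  have rows: "concat (map (\<lambda>q. map (\<lambda>p. p \<in> label (kdec k x a) q) [0..<k] @ map (\<lambda>r. r \<in> succ (kdec k x a) q) [0..<m]) [0..<m])
     = concat (map (\<lambda>q. take (k + m) (drop (a + Suc m + m + q * (k + m)) x)) [0..<m])"
  proof (rule arg_cong[where f = concat], rule map_cong[OF refl])
    fix q assume "q \<in> set [0..<m]"
    then have "Suc q * (k + m) \<le> m * (k + m)" by (intro mult_le_mono1) auto
    then have "a + Suc m + m + q * (k + m) + (k + m) \<le> length x" using len by simp
    from row[OF this] show "map (\<lambda>p. p \<in> label (kdec k x a) q) [0..<k] @ map (\<lambda>r. r \<in> succ (kdec k x a) q) [0..<m]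
      = take (k + m) (drop (a + Suc m + m + q * (k + m)) x)"
      by (simp add: kdec_def Let_def m_def)
  qed
  have ini: "map (\<lambda>q. q \<in> init (kdec k x a)) [0..<m] = take m (drop (a + Suc m) x)"
    using map_bit[of "a + Suc m" m x] len by (simp add: kdec_def Let_def m_def map_guard)
  have "encode_kripke (kdec k x a) = unary m @ map (\<lambda>q. q \<in> init (kdec k x a)) [0..<m] @
     concat (map (\<lambda>q. map (\<lambda>p. p \<in> label (kdec k x a) q) [0..<k] @ map (\<lambda>r. r \<in> succ (kdec k x a) q) [0..<m]) [0..<m])"
    by (simp add: encode_kripke_def Let_def) (simp add: kdec_def Let_def m_def)
  also have "\<dots> = unary m @ take m (drop (a + Suc m) x) @ take (m * (k + m)) (drop (a + Suc m + m) x)"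
    unfolding rows ini concat_slices ..
  finally have enc: "encode_kripke (kdec k x a) = \<dots>" .
  have "drop a x = unary m @ drop (a + Suc m) x" using drop_unary[of a x] len by (simp add: m_def)
  also have "drop (a + Suc m) x = take m (drop (a + Suc m) x) @ drop (a + Suc m + m) x"
    using append_take_drop_id[of m "drop (a + Suc m) x"] by (simp add: add.commute)
  also have "drop (a + Suc m + m) x = take (m * (k + m)) (drop (a + Suc m + m) x) @ drop (a + Suc m + m + m * (k + m)) x"
    using append_take_drop_id[of "m * (k + m)" "drop (a + Suc m + m) x"] by (simp add: add.commute)
  finally show ?thesis unfolding enc ksize_def m_def[symmetric] by (simp add: add.assoc)
qed

definition nxt :: "nat \<Rightarrow> bool list \<Rightarrow> nat \<Rightarrow> nat" where
  "nxt k x a = a + ksize k (ones x a)"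

definition pos :: "nat \<Rightarrow> bool list \<Rightarrow> nat \<Rightarrow> nat \<Rightarrow> nat" where
  "pos k x a s = (nxt k x ^^ s) a"

definition kdecs :: "nat \<Rightarrow> bool list \<Rightarrow> nat \<Rightarrow> nat \<Rightarrow> (nat, nat) kripke list" where
  "kdecs k x a s = map (\<lambda>i. kdec k x (pos k x a i)) [0..<s]"

lemma pos_0: "pos k x a 0 = a"
  by (simp add: pos_def)

lemma pos_Suc: "pos k x a (Suc s) = nxt k x (pos k x a s)"
  by (simp add: pos_def)

lemma pos_Suc': "pos k x a (Suc s) = pos k x (nxt k x a) s"
  by (simp add: pos_def funpow_swap1)

lemma pos_mono: "s \<le> t \<Longrightarrow> pos k x a s \<le> pos k x a t"
  by (induction t) (auto simp: le_Suc_eq pos_Suc nxt_def trans_le_add1)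

lemma kdecs_Suc: "kdecs k x a (Suc s) = kdec k x a # kdecs k x (nxt k x a) s"
  by (simp add: kdecs_def upt_conv_Cons pos_0 map_Suc_upt[symmetric] pos_Suc' del: upt_Suc)

lemma kdecs_encode:
  assumes "\<forall>K\<in>set Ks. valid k K" "x = u @ concat (map encode_kripke Ks) @ v"
  shows "list_all2 agree Ks (kdecs k x (length u) (length Ks)) \<and>
     pos k x (length u) (length Ks) = length u + length (concat (map encode_kripke Ks))"
  using assms
proof (induction Ks arbitrary: u)
  case Nil
  then show ?case by (simp add: kdecs_def pos_0)
next
  case (Cons K Ks)
  have x: "x = u @ encode_kripke K @ (concat (map encode_kripke Ks) @ v)" using Cons.prems by simp
  have K: "valid k K" using Cons.prems by simp
  note 1 = encode_kripke_dec[OF K, of u "concat (map encode_kripke Ks) @ v", folded x]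
  have nx: "nxt k x (length u) = length (u @ encode_kripke K)" using 1(2) by (simp add: nxt_def)
  have "list_all2 agree Ks (kdecs k x (length (u @ encode_kripke K)) (length Ks)) \<and>
     pos k x (length (u @ encode_kripke K)) (length Ks) = length (u @ encode_kripke K) + length (concat (map encode_kripke Ks))"
    by (rule Cons.IH) (use Cons.prems in auto)
  then show ?case using 1(1) by (simp add: kdecs_Suc pos_Suc' nx)
qed

lemma encode_kdecs:
  "pos k x a s \<le> length x \<Longrightarrow> drop a x = concat (map encode_kripke (kdecs k x a s)) @ drop (pos k x a s) x"
proof (induction s arbitrary: a)
  case 0
  then show ?case by (simp add: kdecs_def pos_0)
next
  case (Suc s)
  have le: "nxt k x a \<le> length x" using Suc.prems pos_mono[of 0 s k x "nxt k x a"] by (simp add: pos_Suc' pos_0)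
  have "drop a x = encode_kripke (kdec k x a) @ drop (nxt k x a) x"
    using dec_encode_kripke[of a k x] le by (simp add: nxt_def)
  also have "drop (nxt k x a) x = concat (map encode_kripke (kdecs k x (nxt k x a) s)) @ drop (pos k x a (Suc s)) x"
    using Suc.IH[of "nxt k x a"] Suc.prems by (simp add: pos_Suc')
  finally show ?case by (simp add: kdecs_Suc)
qed

section \<open>Header fields and offsets of a whole instance\<close>

definition numP :: "bool list \<Rightarrow> nat" where "numP x = ones x 0"
definition bound :: "bool list \<Rightarrow> nat" where "bound x = ones x (numP x + 1)"
definition offP :: "bool list \<Rightarrow> nat" where
  "offP x = numP x + bound x + 2 + ones x (numP x + bound x + 2) + 1"
definition lenP :: "bool list \<Rightarrow> nat" where "lenP x = ones x (numP x + bound x + 2)"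
definition endP :: "bool list \<Rightarrow> nat" where "endP x = pos (numP x) x (offP x) (lenP x)"
definition lenN :: "bool list \<Rightarrow> nat" where "lenN x = ones x (endP x)"
definition offN :: "bool list \<Rightarrow> nat" where "offN x = endP x + lenN x + 1"
definition endN :: "bool list \<Rightarrow> nat" where "endN x = pos (numP x) x (offN x) (lenN x)"
definition structsP :: "bool list \<Rightarrow> (nat, nat) kripke list" where
  "structsP x = kdecs (numP x) x (offP x) (lenP x)"
definition structsN :: "bool list \<Rightarrow> (nat, nat) kripke list" where
  "structsN x = kdecs (numP x) x (offN x) (lenN x)"

lemma parse_encode:
  assumes "x = encode_instance k Ps Ns B" "\<forall>K\<in>set Ps \<union> set Ns. valid k K"
  shows "numP x = k" "bound x = B" "list_all2 agree Ps (structsP x)" "list_all2 agree Ns (structsN x)"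
    "endN x = length x"
proof -
  define cP cN where "cP = concat (map encode_kripke Ps)" and "cN = concat (map encode_kripke Ns)"
  have x: "x = unary k @ unary B @ unary (length Ps) @ cP @ unary (length Ns) @ cN"
    using assms(1) by (simp add: encode_instance_def encode_kripkes_def cP_def cN_def)
  show 1: "numP x = k" using ones_unary[of "[]" k] by (simp add: numP_def x)
  show 2: "bound x = B"
    using ones_unary[of "unary k" B] unfolding bound_def 1 by (simp add: x length_unary)
  have 3: "lenP x = length Ps"
    using ones_unary[of "unary k @ unary B" "length Ps"] unfolding lenP_def 1 2 by (simp add: x length_unary)
  have 4: "offP x = length (unary k @ unary B @ unary (length Ps))"
    using 3 unfolding offP_def lenP_def 1 2 by (simp add: length_unary)
  have P: "list_all2 agree Ps (structsP x) \<and> endP x = offP x + length cP"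
    unfolding structsP_def endP_def cP_def 1 3 4
    by (rule kdecs_encode[where v = "unary (length Ns) @ cN"]) (use assms in \<open>auto simp: x cP_def\<close>)
  then show "list_all2 agree Ps (structsP x)" by simp
  have 5: "endP x = length (unary k @ unary B @ unary (length Ps) @ cP)" using P 4 by simp
  have 6: "lenN x = length Ns"
    using ones_unary[of "unary k @ unary B @ unary (length Ps) @ cP" "length Ns"] unfolding lenN_def 5 by (simp add: x)
  have 7: "offN x = length (unary k @ unary B @ unary (length Ps) @ cP @ unary (length Ns))"
    unfolding offN_def 5 6 by (simp add: length_unary)
  have "list_all2 agree Ns (structsN x) \<and> endN x = offN x + length cN"
    unfolding structsN_def endN_def cN_def 1 6 7
    by (rule kdecs_encode[where v = "[]"]) (use assms in \<open>auto simp: x cN_def\<close>)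
  then show "list_all2 agree Ns (structsN x)" "endN x = length x" unfolding 7 by (auto simp: x)
qed

text \<open>If the last structure ends exactly at the end of the input, no block has been cut off,
  so every slice equals the encoding of what was decoded from it.\<close>

lemma encode_parse:
  assumes "endN x = length x"
  shows "x = encode_instance (numP x) (structsP x) (structsN x) (bound x)"
proof -
  \<comment> \<open>Positions only grow, so all earlier offsets lie inside the input as
    well.\<close>
  have N: "offN x \<le> length x" using assms pos_mono[of 0 "lenN x" "numP x" x "offN x"] by (simp add: endN_def pos_0)
  then have eP: "endP x + lenN x < length x" by (simp add: offN_def)
  then have oP: "offP x \<le> length x" using pos_mono[of 0 "lenP x" "numP x" x "offP x"] by (simp add: endP_def pos_0)
  have "x = unary (numP x) @ drop (numP x + 1) x"
    using drop_unary[of 0 x] oP by (simp add: numP_def offP_def)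
  also have "drop (numP x + 1) x = unary (bound x) @ drop (numP x + bound x + 2) x"
    using drop_unary[of "numP x + 1" x] oP by (simp add: bound_def offP_def)
  also have "drop (numP x + bound x + 2) x = unary (lenP x) @ drop (offP x) x"
    using drop_unary[of "numP x + bound x + 2" x] oP by (simp add: lenP_def offP_def)
  also have "drop (offP x) x = concat (map encode_kripke (structsP x)) @ drop (endP x) x"
    unfolding structsP_def endP_def by (rule encode_kdecs) (use eP in \<open>simp add: endP_def\<close>)
  also have "drop (endP x) x = unary (lenN x) @ drop (offN x) x"
    using drop_unary[of "endP x" x] eP by (simp add: lenN_def offN_def)
  also have "drop (offN x) x = concat (map encode_kripke (structsN x)) @ drop (endN x) x"
    unfolding structsN_def endN_def by (rule encode_kdecs) (use assms in \<open>simp add: endN_def\<close>)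
  finally show ?thesis
    using assms by (simp add: encode_instance_def encode_kripkes_def structsP_def structsN_def kdecs_def)
qed

lemma ctl_learn_agree_le:
  assumes "list_all2 agree Ps Ps'" "list_all2 agree Ns Ns'" "\<forall>K\<in>set Ps \<union> set Ns. is_kripke K"
    "ctl_learn Ut Bl n V (set Ps) (set Ns) B"
  shows "ctl_learn Ut Bl n V (set Ps') (set Ns') B"
proof -
  obtain \<phi> where \<phi>: "\<phi> \<in> ctl_fragment V Ut Bl" "fsize \<phi> \<le> B" "bin_size \<phi> \<le> n"
    "\<forall>K\<in>set Ps. models K \<phi>" "\<forall>K\<in>set Ns. \<not> models K \<phi>"
    using assms(4) unfolding ctl_learn_def by blast
  have "\<forall>K'\<in>set Ps'. models K' \<phi>"
    using assms(1,3) \<phi>(4) models_agree by (metis (no_types, opaque_lifting) UnCI in_set_conv_nth list_all2_conv_all_nth)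
  moreover have "\<forall>K'\<in>set Ns'. \<not> models K' \<phi>"
    using assms(2,3) \<phi>(5) models_agree by (metis (no_types, opaque_lifting) UnCI in_set_conv_nth list_all2_conv_all_nth)
  ultimately show ?thesis using \<phi> unfolding ctl_learn_def by blast
qed

lemma list_all2_agree_sym: "list_all2 agree Ks Ks' \<Longrightarrow> list_all2 agree Ks' Ks"
  by (simp add: list_all2_conv_all_nth agree_sym)

lemma list_all2_agree_kripke:
  "list_all2 agree Ks Ks' \<Longrightarrow> \<forall>K\<in>set Ks. is_kripke K \<Longrightarrow> \<forall>K\<in>set Ks'. is_kripke K"
  by (metis agree_kripke in_set_conv_nth list_all2_conv_all_nth)

lemma ctl_learn_agree:
  assumes "list_all2 agree Ps Ps'" "list_all2 agree Ns Ns'" "\<forall>K\<in>set Ps \<union> set Ns. is_kripke K"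
  shows "ctl_learn Ut Bl n V (set Ps) (set Ns) B = ctl_learn Ut Bl n V (set Ps') (set Ns') B"
  using ctl_learn_agree_le[OF assms]
    ctl_learn_agree_le[OF assms(1,2)[THEN list_all2_agree_sym], of Ut Bl n V B]
    list_all2_agree_kripke[OF assms(1)] list_all2_agree_kripke[OF assms(2)] assms(3) by blast

text \<open>The code determines the structures only up to \<open>agree\<close>, and learnability is
  invariant under \<open>agree\<close>. So it does not matter which preimage of the code witnesses
  membership.\<close>

lemma encode_in_CTL_Learn:
  assumes "\<forall>K\<in>set Ps \<union> set Ns. valid k K"
  shows "encode_instance k Ps Ns B \<in> CTL_Learn Ut Bl n \<longleftrightarrow> ctl_learn Ut Bl n {..<k} (set Ps) (set Ns) B"
proof
  assume "ctl_learn Ut Bl n {..<k} (set Ps) (set Ns) B"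
  then show "encode_instance k Ps Ns B \<in> CTL_Learn Ut Bl n"
    unfolding CTL_Learn_def mem_Collect_eq
    by (intro exI[of _ k] exI[of _ Ps] exI[of _ Ns] exI[of _ B])
      (use assms in \<open>auto simp: valid_def learn_instance_def\<close>)
next
  define x where "x = encode_instance k Ps Ns B"
  assume "encode_instance k Ps Ns B \<in> CTL_Learn Ut Bl n"
  then obtain k' Ps' Ns' B' where x': "x = encode_instance k' Ps' Ns' B'"
    "learn_instance {..<k'} (set Ps') (set Ns') B'" "\<forall>K\<in>set Ps' \<union> set Ns'. \<exists>m. states K = {..<m}"
    "ctl_learn Ut Bl n {..<k'} (set Ps') (set Ns') B'"
    unfolding CTL_Learn_def x_def by blast
  have v: "\<forall>K\<in>set Ps' \<union> set Ns'. valid k' K" using x' by (auto simp: valid_def learn_instance_def)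
  note e = parse_encode[OF x_def assms] and e' = parse_encode[OF x'(1) v]
  have K: "\<forall>K\<in>set Ps \<union> set Ns. is_kripke K" "\<forall>K\<in>set Ps' \<union> set Ns'. is_kripke K"
    using assms v by (auto simp: valid_def)
  show "ctl_learn Ut Bl n {..<k} (set Ps) (set Ns) B"
    using x'(4) ctl_learn_agree[OF e(3,4) K(1)] ctl_learn_agree[OF e'(3,4) K(2)] e(1,2) e'(1,2) by simp
qed

text \<open>The existential quantifier over preimages of the code is replaced by the canonical
  parse, which turns membership into a condition on the string itself.\<close>

lemma CTL_Learn_iff:
  "x \<in> CTL_Learn Ut Bl n \<longleftrightarrow> endN x = length x \<and> (\<forall>K\<in>set (structsP x) \<union> set (structsN x). is_kripke K) \<and>
     ctl_learn Ut Bl n {..<numP x} (set (structsP x)) (set (structsN x)) (bound x)"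
proof -
  have v: "valid (numP x) K" if "K \<in> set (structsP x) \<union> set (structsN x)" "is_kripke K" for K
    using that by (auto simp: valid_def structsP_def structsN_def kdecs_def kdec_def Let_def)
  show ?thesis
  proof
    assume x: "x \<in> CTL_Learn Ut Bl n"
    then obtain k Ps Ns B where e: "x = encode_instance k Ps Ns B" and
      l: "learn_instance {..<k} (set Ps) (set Ns) B" "\<forall>K\<in>set Ps \<union> set Ns. \<exists>m. states K = {..<m}"
      unfolding CTL_Learn_def by blast
    have "\<forall>K\<in>set Ps \<union> set Ns. valid k K" using l by (auto simp: valid_def learn_instance_def)
    note p = parse_encode[OF e this]
    have "\<forall>K\<in>set Ps. is_kripke K" "\<forall>K\<in>set Ns. is_kripke K" using l by (auto simp: learn_instance_def)
    then have K: "\<forall>K\<in>set (structsP x) \<union> set (structsN x). is_kripke K"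
      using list_all2_agree_kripke[OF p(3)] list_all2_agree_kripke[OF p(4)] by blast
    then have "\<forall>K\<in>set (structsP x) \<union> set (structsN x). valid (numP x) K" using v by blast
    from encode_in_CTL_Learn[OF this] show "endN x = length x \<and> (\<forall>K\<in>set (structsP x) \<union> set (structsN x). is_kripke K) \<and>
     ctl_learn Ut Bl n {..<numP x} (set (structsP x)) (set (structsN x)) (bound x)"
      using x K p(5) encode_parse[OF p(5)] by metis
  next
    assume a: "endN x = length x \<and> (\<forall>K\<in>set (structsP x) \<union> set (structsN x). is_kripke K) \<and>
     ctl_learn Ut Bl n {..<numP x} (set (structsP x)) (set (structsN x)) (bound x)"
    then have "\<forall>K\<in>set (structsP x) \<union> set (structsN x). valid (numP x) K" using v by blast
    from encode_in_CTL_Learn[OF this] show "x \<in> CTL_Learn Ut Bl n"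
      using a encode_parse[of x] by metis
  qed
qed

section \<open>Membership in NP\<close>

text \<open>A bit table with five axes; along the last one a value is the number of ones, so it is
  at most \<open>N\<close>. The default 0 outside the range makes every bit string a legal
  certificate.\<close>

definition cert :: "nat \<Rightarrow> bool list \<Rightarrow> nat \<Rightarrow> nat \<Rightarrow> nat \<Rightarrow> nat \<Rightarrow> nat" where
  "cert N c a i j l = (if a < 8 \<and> i < N \<and> j < N \<and> l < N
     then \<Sum>z<N. of_bool (bit c ((((a * N + i) * N + j) * N + l) * N + z)) else 0)"

lemma radix_less: "y < Y \<Longrightarrow> z < N \<Longrightarrow> y * N + z < Y * (N :: nat)"
proof -
  assume "y < Y" "z < N"
  then have "y * N + z < Suc y * N" by simp
  also have "\<dots> \<le> Y * N" using \<open>y < Y\<close> by (intro mult_le_mono1) simp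
  finally show ?thesis .
qed

lemma radix_div: "z < N \<Longrightarrow> (y * N + z) div N = (y :: nat)"
  by simp

lemma radix_mod: "z < N \<Longrightarrow> (y * N + z) mod N = (z :: nat)"
  by simp

lemma sum_of_bool_less: "g \<le> N \<Longrightarrow> (\<Sum>z<N. of_bool (z < g)) = (g :: nat)"
proof -
  assume "g \<le> N"
  then have "{..<N} \<inter> {z. z < g} = {..<g}" by auto
  then show ?thesis by (simp add: of_bool_def sum.If_cases)
qed

text \<open>The table is filled by splitting a bit position into its digits to base
  \<open>N\<close>; a value is stored as that many leading ones.\<close>

lemma cert_surj:
  assumes "\<And>a i j l. g a i j l \<le> N"
    and "\<And>a i j l. \<not> (a < 8 \<and> i < N \<and> j < N \<and> l < N) \<Longrightarrow> g a i j l = 0"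
  shows "\<exists>c. length c = 8 * N * N * N * N * N \<and> cert N c = g"
proof -
  define f where "f t = (let z = t mod N; t1 = t div N; l = t1 mod N; t2 = t1 div N; j = t2 mod N; t3 = t2 div N in
     z < g (t3 div N) (t3 mod N) j l)" for t
  define c where "c = map f [0..<8 * N * N * N * N * N]"
  have "cert N c a i j l = g a i j l" for a i j l
  proof (cases "a < 8 \<and> i < N \<and> j < N \<and> l < N")
    case True
    have "bit c ((((a * N + i) * N + j) * N + l) * N + z) = (z < g a i j l)" if z: "z < N" for z
    proof -
      have "(((a * N + i) * N + j) * N + l) * N + z < 8 * N * N * N * N * N"
        using True z by (intro radix_less) auto
      then have "bit c ((((a * N + i) * N + j) * N + l) * N + z) = f ((((a * N + i) * N + j) * N + l) * N + z)"
        by (simp add: bit_def c_def)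
      then show ?thesis using True z by (simp only: f_def Let_def radix_div radix_mod)
    qed
    then have "cert N c a i j l = (\<Sum>z<N. of_bool (z < g a i j l))" using True by (simp add: cert_def)
    then show ?thesis using sum_of_bool_less assms(1) by metis
  next
    case False
    then show ?thesis using assms(2)[OF False] by (auto simp: cert_def)
  qed
  then show ?thesis by (intro exI[of _ c]) (auto simp: c_def fun_eq_iff)
qed

section \<open>Local correctness of a single node of the formula\<close>

datatype opr = OAtom | ONeg | OBin bin_op | OTmp bool temp_op

definition mkf :: "opr \<Rightarrow> 'p \<Rightarrow> 'p ctl \<Rightarrow> 'p ctl \<Rightarrow> 'p ctl" where
  "mkf f p \<phi> \<psi> = (case f of OAtom \<Rightarrow> Atom p | ONeg \<Rightarrow> Neg \<phi> | OBin b \<Rightarrow> Bin b \<phi> \<psi>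
     | OTmp e t \<Rightarrow> if e then Exists t \<phi> else Forall t \<phi>)"

definition oprs :: "unary_op set \<Rightarrow> bin_op set \<Rightarrow> opr set" where
  "oprs Ut Bl = {OAtom} \<union> {ONeg |_ :: unit. Negation \<in> Ut} \<union> OBin ` Bl \<union> {OTmp e t | e t. Temporal t \<in> Ut}"

fun base_code :: "base_op \<Rightarrow> nat" where
  "base_code OrOp = 0" | "base_code AndOp = 1" | "base_code ImpliesOp = 2"
| "base_code ImpliedByOp = 3" | "base_code IffOp = 4"

fun temp_code :: "temp_op \<Rightarrow> nat" where
  "temp_code Next = 0" | "temp_code Finally = 1" | "temp_code Globally = 2"

text \<open>The binary operators have exactly the codes from 8 on, so counting binary nodes takes
  only a comparison.\<close>

fun opc :: "opr \<Rightarrow> nat" where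
  "opc OAtom = 0"
| "opc ONeg = 1"
| "opc (OTmp e t) = (if e then 2 else 5) + temp_code t"
| "opc (OBin (Plain b)) = 8 + base_code b"
| "opc (OBin (Negated b)) = 13 + base_code b"

text \<open>Operands have smaller numbers than \<open>u\<close>, which makes the list of nodes
  acyclic. For an atom the first argument is the proposition.\<close>

definition args_ok :: "opr \<Rightarrow> nat \<Rightarrow> nat \<Rightarrow> nat \<Rightarrow> nat \<Rightarrow> bool" where
  "args_ok f k u l r \<longleftrightarrow> (case f of OAtom \<Rightarrow> l < k | OBin b \<Rightarrow> l < u \<and> r < u | _ \<Rightarrow> l < u)"

text \<open>For G the ranks justify the complement: failing G means reaching a violation under the
  dual quantifier.\<close>

definition temporal_ok :: "('q, 'p) kripke \<Rightarrow> bool \<Rightarrow> temp_op \<Rightarrow> ('q \<Rightarrow> bool) \<Rightarrow> ('q \<Rightarrow> bool) \<Rightarrow> ('q \<Rightarrow> nat) \<Rightarrow> bool" where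
  "temporal_ok K e t z y rk = (case t of
     Next \<Rightarrow> \<forall>q\<in>states K. z q = quant e (succ K q) y
   | Finally \<Rightarrow> ranked K e y z rk
   | Globally \<Rightarrow> ranked K (\<not> e) (\<lambda>q. \<not> y q) (\<lambda>q. \<not> z q) rk)"

definition sem_ok :: "opr \<Rightarrow> ('q, 'p) kripke \<Rightarrow> 'p \<Rightarrow> ('q \<Rightarrow> bool) \<Rightarrow> ('q \<Rightarrow> bool) \<Rightarrow> ('q \<Rightarrow> bool) \<Rightarrow> ('q \<Rightarrow> nat) \<Rightarrow> bool" where
  "sem_ok f K p z y1 y2 rk = (case f of
     OAtom \<Rightarrow> \<forall>q\<in>states K. z q = (p \<in> label K q)
   | ONeg \<Rightarrow> \<forall>q\<in>states K. z q = (\<not> y1 q)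
   | OBin b \<Rightarrow> \<forall>q\<in>states K. z q = bin_sem b (y1 q) (y2 q)
   | OTmp e t \<Rightarrow> temporal_ok K e t z y1 rk)"

lemma evt_cong:
  assumes "is_kripke K" "q \<in> states K" "\<And>r. r \<in> states K \<Longrightarrow> b r = b' r"
  shows "evt K e b q = evt K e b' q"
  using paths_states[OF assms(1,2)] assms(3) by (auto simp: evt_def)

lemma temporal_ok_sat:
  assumes K: "is_kripke K" and ok: "temporal_ok K e t z y rk" and y: "\<And>q. q \<in> states K \<Longrightarrow> y q = sat K \<phi> q"
    and q: "q \<in> states K"
  shows "z q = sat K (mkf (OTmp e t) p \<phi> \<psi>) q"
proof (cases t)
  case Next
  have "quant e (succ K q) y = quant e (succ K q) (sat K \<phi>)"
    by (rule quant_cong) (use K q y in \<open>auto simp: is_kripke_def\<close>)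
  then show ?thesis using Next ok q sat_Next[OF K q, of \<phi>] by (cases e) (auto simp: temporal_ok_def mkf_def simp del: sat.simps)
next
  case Finally
  have "z q = evt K e y q" using ok Finally ranked_evt[OF K _ q] by (simp add: temporal_ok_def)
  also have "\<dots> = evt K e (sat K \<phi>) q" by (rule evt_cong[OF K q]) (rule y)
  finally show ?thesis using Finally by (cases e) (auto simp: mkf_def sat_evt simp del: sat.simps)
next
  case Globally
  have "(\<not> z q) = evt K (\<not> e) (\<lambda>q. \<not> y q) q"
    using ok Globally ranked_evt[OF K _ q, of "\<not> e" "\<lambda>q. \<not> y q" "\<lambda>q. \<not> z q"] by (simp add: temporal_ok_def)
  also have "\<dots> = evt K (\<not> e) (\<lambda>q. \<not> sat K \<phi> q) q" by (rule evt_cong[OF K q]) (simp add: y)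
  finally show ?thesis using Globally by (cases e) (auto simp: mkf_def sat_evt simp del: sat.simps)
qed

lemma temporal_ok_ex:
  assumes K: "is_kripke K"
  shows "\<exists>rk. temporal_ok K e t (sat K (mkf (OTmp e t) p \<phi> \<psi>)) (sat K \<phi>) rk \<and> (\<forall>q. rk q \<le> card (states K))"
proof (cases t)
  case Next
  then show ?thesis using sat_Next[OF K, of _ \<phi>]
    by (intro exI[of _ "\<lambda>_. 0"], cases e) (auto simp: temporal_ok_def mkf_def simp del: sat.simps)
next
  case Finally
  have "evt K e (sat K \<phi>) = sat K (mkf (OTmp e t) p \<phi> \<psi>)"
    using Finally by (cases e) (auto simp: mkf_def sat_evt fun_eq_iff simp del: sat.simps)
  then show ?thesis using evt_ranked[OF K, of e "sat K \<phi>"] Finally by (simp add: temporal_ok_def)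
next
  case Globally
  have "evt K (\<not> e) (\<lambda>q. \<not> sat K \<phi> q) = (\<lambda>q. \<not> sat K (mkf (OTmp e t) p \<phi> \<psi>) q)"
    using Globally by (cases e) (auto simp: mkf_def sat_evt fun_eq_iff simp del: sat.simps)
  then show ?thesis using evt_ranked[OF K, of "\<not> e" "\<lambda>q. \<not> sat K \<phi> q"] Globally by (simp add: temporal_ok_def)
qed

lemma sem_ok_sat:
  assumes "is_kripke K" "sem_ok f K p z y1 y2 rk" "q \<in> states K"
    and "\<And>q. f \<noteq> OAtom \<Longrightarrow> q \<in> states K \<Longrightarrow> y1 q = sat K \<phi> q"
    and "\<And>b q. f = OBin b \<Longrightarrow> q \<in> states K \<Longrightarrow> y2 q = sat K \<psi> q"
  shows "z q = sat K (mkf f p \<phi> \<psi>) q"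
proof (cases f)
  case (OTmp e t)
  then show ?thesis using temporal_ok_sat[OF assms(1) _ _ assms(3), of e t z y1 rk \<phi> p \<psi>] assms by (simp add: sem_ok_def)
qed (use assms in \<open>auto simp: sem_ok_def mkf_def\<close>)

lemma sem_ok_ex:
  assumes K: "is_kripke K"
  shows "\<exists>rk. sem_ok f K p (sat K (mkf f p \<phi> \<psi>)) (sat K \<phi>) (sat K \<psi>) rk \<and> (\<forall>q. rk q \<le> card (states K))"
proof (cases f)
  case (OTmp e t)
  then show ?thesis using temporal_ok_ex[OF K, of e t p \<phi> \<psi>] by (simp add: sem_ok_def)
qed (auto simp: sem_ok_def mkf_def)

lemma mkf_fragment:
  assumes "f \<in> oprs Ut Bl" "f = OAtom \<Longrightarrow> p \<in> V" "f \<noteq> OAtom \<Longrightarrow> \<phi> \<in> ctl_fragment V Ut Bl"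
    "\<And>b. f = OBin b \<Longrightarrow> \<psi> \<in> ctl_fragment V Ut Bl"
  shows "mkf f p \<phi> \<psi> \<in> ctl_fragment V Ut Bl"
  using assms by (cases f) (auto simp: mkf_def oprs_def intro: ctl_fragment.intros)

definition struct_pos :: "bool list \<Rightarrow> (nat \<Rightarrow> nat \<Rightarrow> nat \<Rightarrow> nat \<Rightarrow> nat) \<Rightarrow> nat \<Rightarrow> nat" where
  "struct_pos x g s = (if s < lenP x then g 5 s 0 0 else g 6 (s - lenP x) 0 0)"

text \<open>Checks the listed positions against the recurrence of \<open>pos\<close>. The entry
  \<open>g 5 (lenP x) 0 0\<close> is the end of the positive block, where the number of negative
  structures is written.\<close>

definition layout :: "bool list \<Rightarrow> (nat \<Rightarrow> nat \<Rightarrow> nat \<Rightarrow> nat \<Rightarrow> nat) \<Rightarrow> bool" where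
  "layout x g \<longleftrightarrow> g 5 0 0 0 = offP x \<and> (\<forall>s<lenP x. g 5 (Suc s) 0 0 = nxt (numP x) x (g 5 s 0 0)) \<and>
     g 6 0 0 0 = g 5 (lenP x) 0 0 + ones x (g 5 (lenP x) 0 0) + 1 \<and>
     (\<forall>s<ones x (g 5 (lenP x) 0 0). g 6 (Suc s) 0 0 = nxt (numP x) x (g 6 s 0 0)) \<and>
     g 6 (ones x (g 5 (lenP x) 0 0)) 0 0 = length x"

definition node_ok :: "bool list \<Rightarrow> (nat \<Rightarrow> nat \<Rightarrow> nat \<Rightarrow> nat \<Rightarrow> nat) \<Rightarrow> nat \<Rightarrow> nat \<Rightarrow> opr \<Rightarrow> bool" where
  "node_ok x g S u f \<longleftrightarrow> g 0 u 0 0 = opc f \<and> args_ok f (numP x) u (g 1 u 0 0) (g 2 u 0 0) \<and>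
     (\<forall>s<S. sem_ok f (kdec (numP x) x (struct_pos x g s)) (g 1 u 0 0) (\<lambda>q. 0 < g 3 u s q)
        (\<lambda>q. 0 < g 3 (g 1 u 0 0) s q) (\<lambda>q. 0 < g 3 (g 2 u 0 0) s q) (\<lambda>q. g 4 u s q))"

text \<open>The certificate consists of eight functions: the operator and the two operands of each node
  of the formula (0, 1, 2), the truth values and ranks of a node in a state of a structure (3, 4),
  the positions of the structures in the input (5, 6) and the root (7).\<close>

definition chk :: "unary_op set \<Rightarrow> bin_op set \<Rightarrow> nat \<Rightarrow> bool list \<Rightarrow> (nat \<Rightarrow> nat \<Rightarrow> nat \<Rightarrow> nat \<Rightarrow> nat) \<Rightarrow> bool" where
  "chk Ut Bl n x g \<longleftrightarrow> layout x g \<and>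
     (\<forall>s<lenP x + ones x (g 5 (lenP x) 0 0). is_kripke (kdec (numP x) x (struct_pos x g s))) \<and>
     g 7 0 0 0 < bound x \<and>
     (\<forall>u<Suc (g 7 0 0 0). \<exists>f\<in>oprs Ut Bl. node_ok x g (lenP x + ones x (g 5 (lenP x) 0 0)) u f) \<and>
     (\<Sum>u<Suc (g 7 0 0 0). of_bool (8 \<le> g 0 u 0 0)) \<le> n \<and>
     (\<forall>s<lenP x. \<forall>q\<in>init (kdec (numP x) x (struct_pos x g s)). 0 < g 3 (g 7 0 0 0) s q) \<and>
     (\<forall>s<ones x (g 5 (lenP x) 0 0). \<exists>q\<in>init (kdec (numP x) x (struct_pos x g (lenP x + s))).
        \<not> 0 < g 3 (g 7 0 0 0) (lenP x + s) q)"

section \<open>Soundness of the check\<close>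

lemma layout_pos:
  assumes "layout x g"
  shows "g 5 (lenP x) 0 0 = endP x" "ones x (endP x) = lenN x" "endN x = length x"
    "s < lenP x \<Longrightarrow> kdec (numP x) x (struct_pos x g s) = structsP x ! s"
    "s < lenN x \<Longrightarrow> kdec (numP x) x (struct_pos x g (lenP x + s)) = structsN x ! s"
proof -
  have 5: "s \<le> lenP x \<Longrightarrow> g 5 s 0 0 = pos (numP x) x (offP x) s" for s
    by (induction s) (use assms in \<open>auto simp: layout_def pos_0 pos_Suc\<close>)
  then show e: "g 5 (lenP x) 0 0 = endP x" by (simp add: endP_def)
  show l: "ones x (endP x) = lenN x" by (simp add: lenN_def)
  have 6: "s \<le> lenN x \<Longrightarrow> g 6 s 0 0 = pos (numP x) x (offN x) s" for s
    by (induction s) (use assms e l in \<open>auto simp: layout_def pos_0 pos_Suc offN_def\<close>)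
  then show "endN x = length x" using assms e l by (simp add: layout_def endN_def)
  show "s < lenP x \<Longrightarrow> kdec (numP x) x (struct_pos x g s) = structsP x ! s"
    by (simp add: struct_pos_def 5 structsP_def kdecs_def)
  show "s < lenN x \<Longrightarrow> kdec (numP x) x (struct_pos x g (lenP x + s)) = structsN x ! s"
    by (simp add: struct_pos_def 6 structsN_def kdecs_def)
qed

lemma length_structs: "length (structsP x) = lenP x" "length (structsN x) = lenN x"
  by (auto simp: structsP_def structsN_def kdecs_def)

lemma subformulas_refl: "\<phi> \<in> subformulas \<phi>"
  by (cases \<phi>) auto

lemma subformulas_mkf:
  "subformulas (mkf f p \<phi> \<psi>) \<subseteq> insert (mkf f p \<phi> \<psi>)
     ((if f = OAtom then {} else subformulas \<phi>) \<union> (if \<exists>b. f = OBin b then subformulas \<psi> else {}))"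
  by (cases f) (auto simp: mkf_def)

text \<open>Formulas are assigned to the nodes in the order of their numbers. Different nodes may
  get the same formula, but then counting nodes only overestimates \<open>fsize\<close> and
  \<open>bin_size\<close>.\<close>

lemma chk_sound:
  assumes "chk Ut Bl n x g"
  shows "x \<in> CTL_Learn Ut Bl n"
proof -
  define root where "root = g 7 0 0 0"
  define S where "S = lenP x + lenN x"
  define K where "K s = kdec (numP x) x (struct_pos x g s)" for s
  have L: "layout x g" using assms by (simp add: chk_def)
  note p = layout_pos[OF L]
  have kr: "is_kripke (K s)" if "s < S" for s using assms that by (simp add: chk_def K_def p S_def)
  have nodes: "\<exists>f\<in>oprs Ut Bl. node_ok x g S u f" if "u < Suc root" for u
    using assms that by (simp add: chk_def p S_def root_def)
  \<comment> \<open>The invariant for the first \<open>U\<close> nodes; the inclusion of the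
    subformulas is what later bounds the sizes by numbers of nodes.\<close>
  have "\<exists>F. \<forall>u<U. F u \<in> ctl_fragment {..<numP x} Ut Bl \<and>
     (\<forall>s<S. \<forall>q\<in>states (K s). (0 < g 3 u s q) = sat (K s) (F u) q) \<and>
     subformulas (F u) \<subseteq> F ` {..u} \<and> ((\<exists>b \<psi>1 \<psi>2. F u = Bin b \<psi>1 \<psi>2) \<longrightarrow> 8 \<le> g 0 u 0 0)"
    if "U \<le> Suc root" for U
    using that
  proof (induction U)
    case (Suc U)
    then obtain F where F: "\<And>u. u < U \<Longrightarrow> F u \<in> ctl_fragment {..<numP x} Ut Bl"
      "\<And>u s q. u < U \<Longrightarrow> s < S \<Longrightarrow> q \<in> states (K s) \<Longrightarrow> (0 < g 3 u s q) = sat (K s) (F u) q"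
      "\<And>u. u < U \<Longrightarrow> subformulas (F u) \<subseteq> F ` {..u}"
      "\<And>u b \<psi>1 \<psi>2. u < U \<Longrightarrow> F u = Bin b \<psi>1 \<psi>2 \<Longrightarrow> 8 \<le> g 0 u 0 0" by (metis Suc_leD)
    obtain f where f: "f \<in> oprs Ut Bl" "node_ok x g S U f" using nodes Suc.prems by (metis Suc_le_eq)
    define l r where "l = g 1 U 0 0" and "r = g 2 U 0 0"
    define \<phi> where "\<phi> = mkf f l (F l) (F r)"
    have args: "args_ok f (numP x) U l r" and opc: "g 0 U 0 0 = opc f" using f by (auto simp: node_ok_def l_def r_def)
    have l: "f \<noteq> OAtom \<Longrightarrow> l < U" and r: "f = OBin b \<Longrightarrow> r < U" for b
      using args by (auto simp: args_ok_def split: opr.splits)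
    have 1: "\<phi> \<in> ctl_fragment {..<numP x} Ut Bl"
      unfolding \<phi>_def by (rule mkf_fragment[OF f(1)]) (use args l r F(1) in \<open>auto simp: args_ok_def\<close>)
    have 2: "(0 < g 3 U s q) = sat (K s) \<phi> q" if s: "s < S" and q: "q \<in> states (K s)" for s q
    proof -
      have "sem_ok f (K s) l (\<lambda>q. 0 < g 3 U s q) (\<lambda>q. 0 < g 3 l s q) (\<lambda>q. 0 < g 3 r s q) (\<lambda>q. g 4 U s q)"
        using f s by (simp add: node_ok_def K_def l_def r_def)
      then show ?thesis
        unfolding \<phi>_def
      proof (rule sem_ok_sat[OF kr[OF s] _ q])
        show "(0 < g 3 l s q') = sat (K s) (F l) q'" if "f \<noteq> OAtom" "q' \<in> states (K s)" for q'
          by (rule F(2)[OF l[OF that(1)] s that(2)])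
        show "(0 < g 3 r s q') = sat (K s) (F r) q'" if "f = OBin b" "q' \<in> states (K s)" for q' b
          by (rule F(2)[OF r[OF that(1)] s that(2)])
      qed
    qed
    have "subformulas (F u) \<subseteq> F ` {..<U}" if "u < U" for u
      using F(3)[OF that] image_mono[of "{..u}" "{..<U}" F] that by auto
    then have 3: "subformulas \<phi> \<subseteq> insert \<phi> (F ` {..<U})"
      using subformulas_mkf[of f l "F l" "F r"] l r unfolding \<phi>_def[symmetric]
      by (cases "f = OAtom"; cases "\<exists>b. f = OBin b") (simp_all, blast+)
    have 4: "8 \<le> g 0 U 0 0" if "\<phi> = Bin b \<psi>1 \<psi>2" for b \<psi>1 \<psi>2
    proof -
      from that obtain b where "f = OBin b" unfolding \<phi>_def mkf_def by (cases f) (auto split: if_splits)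
      then show ?thesis unfolding opc by (cases b) auto
    qed
    have im: "F(U := \<phi>) ` {..u} = F ` {..u}" if "u < U" for u using that by auto
    have im': "F(U := \<phi>) ` {..U} = insert \<phi> (F ` {..<U})" by (auto simp: image_iff le_less)
    show ?case
    proof (intro exI[of _ "F(U := \<phi>)"] allI impI)
      fix u assume "u < Suc U"
      then consider "u = U" | "u < U" by linarith
      then show "(F(U := \<phi>)) u \<in> ctl_fragment {..<numP x} Ut Bl \<and>
       (\<forall>s<S. \<forall>q\<in>states (K s). (0 < g 3 u s q) = sat (K s) ((F(U := \<phi>)) u) q) \<and>
       subformulas ((F(U := \<phi>)) u) \<subseteq> F(U := \<phi>) ` {..u} \<and> ((\<exists>b \<psi>1 \<psi>2. (F(U := \<phi>)) u = Bin b \<psi>1 \<psi>2) \<longrightarrow> 8 \<le> g 0 u 0 0)"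
      proof cases
        case 1
        show ?thesis unfolding \<open>u = U\<close> fun_upd_same im' using \<open>\<phi> \<in> ctl_fragment _ _ _\<close> 2 3 4 by blast
      next
        case u: 2
        then have e: "(F(U := \<phi>)) u = F u" by simp
        show ?thesis unfolding e im[OF u] using F(1,2,4)[OF u] F(3)[OF u] by blast
      qed
    qed
  qed simp
  from this[of "Suc root"] obtain F where F: "\<And>u. u \<le> root \<Longrightarrow> F u \<in> ctl_fragment {..<numP x} Ut Bl"
      "\<And>u s q. u \<le> root \<Longrightarrow> s < S \<Longrightarrow> q \<in> states (K s) \<Longrightarrow> (0 < g 3 u s q) = sat (K s) (F u) q"
      "\<And>u. u \<le> root \<Longrightarrow> subformulas (F u) \<subseteq> F ` {..u}"
      "\<And>u b \<psi>1 \<psi>2. u \<le> root \<Longrightarrow> F u = Bin b \<psi>1 \<psi>2 \<Longrightarrow> 8 \<le> g 0 u 0 0" by (metis less_Suc_eq_le order.refl)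
  have "fsize (F root) \<le> card (F ` {..root})"
    unfolding fsize_def by (rule card_mono) (use F(3) in auto)
  also have "\<dots> \<le> Suc root" using card_image_le[of "{..root}" F] by simp
  also have "\<dots> \<le> bound x" using assms by (simp add: chk_def root_def)
  finally have size: "fsize (F root) \<le> bound x" .
  have "{\<psi> \<in> subformulas (F root). \<exists>b \<psi>1 \<psi>2. \<psi> = Bin b \<psi>1 \<psi>2} \<subseteq> F ` {u. u < Suc root \<and> 8 \<le> g 0 u 0 0}"
  proof
    fix \<psi> assume \<psi>: "\<psi> \<in> {\<psi> \<in> subformulas (F root). \<exists>b \<psi>1 \<psi>2. \<psi> = Bin b \<psi>1 \<psi>2}"
    then obtain u where u: "u \<le> root" "\<psi> = F u" using F(3)[of root] by auto
    with \<psi> F(4)[of u] show "\<psi> \<in> F ` {u. u < Suc root \<and> 8 \<le> g 0 u 0 0}" by fastforce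
  qed
  then have "bin_size (F root) \<le> card (F ` {u. u < Suc root \<and> 8 \<le> g 0 u 0 0})"
    unfolding bin_size_def by (rule card_mono[rotated]) simp
  also have "\<dots> \<le> card {u. u < Suc root \<and> 8 \<le> g 0 u 0 0}" by (rule card_image_le) simp
  also have "\<dots> = (\<Sum>u<Suc root. of_bool (8 \<le> g 0 u 0 0))"
    by (simp add: of_bool_def sum.If_cases Int_def del: sum.lessThan_Suc)
  also have "\<dots> \<le> n" using assms by (simp add: chk_def root_def)
  finally have bin: "bin_size (F root) \<le> n" .
  have P: "models M (F root)" if "M \<in> set (structsP x)" for M
  proof -
    from that obtain s where s: "s < lenP x" "M = structsP x ! s" by (auto simp: in_set_conv_nth length_structs)
    then have M: "M = K s" "s < S" using p(4) by (auto simp: K_def S_def)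
    have "init M \<subseteq> states M" using kr[OF M(2)] M by (auto simp: is_kripke_def)
    moreover have "\<forall>q\<in>init M. 0 < g 3 root s q" using assms s M by (simp add: chk_def root_def K_def)
    ultimately show ?thesis using F(2)[OF order.refl M(2)] M(1) unfolding models_def by (metis subsetD)
  qed
  have N: "\<not> models M (F root)" if "M \<in> set (structsN x)" for M
  proof -
    from that obtain s where s: "s < lenN x" "M = structsN x ! s" by (auto simp: in_set_conv_nth length_structs)
    then have M: "M = K (lenP x + s)" "lenP x + s < S" using p(5) by (auto simp: K_def S_def)
    have "init M \<subseteq> states M" using kr[OF M(2)] M by (auto simp: is_kripke_def)
    moreover have "\<exists>q\<in>init M. \<not> 0 < g 3 root (lenP x + s) q" using assms s M by (simp add: chk_def root_def K_def p)
    ultimately show ?thesis using F(2)[OF order.refl M(2)] M(1) unfolding models_def by (metis subsetD)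
  qed
  have "is_kripke M" if "M \<in> set (structsP x) \<union> set (structsN x)" for M
  proof -
    from that consider s where "s < lenP x" "M = structsP x ! s" | s where "s < lenN x" "M = structsN x ! s"
      by (auto simp: in_set_conv_nth length_structs)
    then show ?thesis
    proof cases
      case 1
      then show ?thesis using kr[of s] p(4)[of s] by (simp add: K_def S_def)
    next
      case 2
      then show ?thesis using kr[of "lenP x + s"] p(5)[of s] by (simp add: K_def S_def)
    qed
  qed
  moreover have "ctl_learn Ut Bl n {..<numP x} (set (structsP x)) (set (structsN x)) (bound x)"
    unfolding ctl_learn_def by (rule bexI[OF _ F(1)[OF order.refl]]) (use size bin P N in auto)
  ultimately show ?thesis unfolding CTL_Learn_iff using p(3) by blast
qed

section \<open>Completeness of the check\<close>

lemma ranked_cong: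
  assumes "is_kripke K" "\<And>q. q \<in> states K \<Longrightarrow> b q = b' q \<and> z q = z' q \<and> rk q = rk' q"
  shows "ranked K e b z rk = ranked K e b' z' rk'"
proof -
  have sub: "r \<in> states K" if "q \<in> states K" "r \<in> succ K q" for q r using assms(1) that by (auto simp: is_kripke_def)
  have 1: "quant e (succ K q) z = quant e (succ K q) z'" if "q \<in> states K" for q
    by (rule quant_cong) (use assms(2) sub that in auto)
  have 2: "quant e (succ K q) (\<lambda>r. z r \<and> rk r < rk q) = quant e (succ K q) (\<lambda>r. z' r \<and> rk' r < rk' q)"
    if "q \<in> states K" for q
    by (rule quant_cong) (use assms(2) sub that in auto)
  show ?thesis unfolding ranked_def using assms(2) 1 2 by auto
qed

lemma sem_ok_cong:
  assumes K: "is_kripke K" and z: "\<And>q. q \<in> states K \<Longrightarrow> z q = z' q" and rk: "\<And>q. q \<in> states K \<Longrightarrow> rk q = rk' q"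
    and y1: "\<And>q. f \<noteq> OAtom \<Longrightarrow> q \<in> states K \<Longrightarrow> y1 q = y1' q"
    and y2: "\<And>b q. f = OBin b \<Longrightarrow> q \<in> states K \<Longrightarrow> y2 q = y2' q"
  shows "sem_ok f K p z y1 y2 rk = sem_ok f K p z' y1' y2' rk'"
proof (cases f)
  case (OTmp e t)
  have 1: "quant e (succ K q) y1 = quant e (succ K q) y1'" if "q \<in> states K" for q
    by (rule quant_cong) (use y1 OTmp K that in \<open>auto simp: is_kripke_def\<close>)
  have 2: "ranked K e y1 z rk = ranked K e y1' z' rk'"
    by (rule ranked_cong[OF K]) (use y1 OTmp z rk in auto)
  have 3: "ranked K (\<not> e) (\<lambda>q. \<not> y1 q) (\<lambda>q. \<not> z q) rk = ranked K (\<not> e) (\<lambda>q. \<not> y1' q) (\<lambda>q. \<not> z' q) rk'"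
    by (rule ranked_cong[OF K]) (use y1 OTmp z rk in auto)
  show ?thesis using OTmp 1 2 3 z by (cases t) (auto simp: sem_ok_def temporal_ok_def)
qed (use z y1 y2 in \<open>auto simp: sem_ok_def\<close>)

fun opr_of :: "'p ctl \<Rightarrow> opr" where
  "opr_of (Atom p) = OAtom"
| "opr_of (Neg \<phi>) = ONeg"
| "opr_of (Bin b \<phi> \<psi>) = OBin b"
| "opr_of (Exists t \<phi>) = OTmp True t"
| "opr_of (Forall t \<phi>) = OTmp False t"

text \<open>An atom is its own left operand, and a formula without a second operand its own right
  one. These dummies make operands subformulas in all cases.\<close>

fun left :: "'p ctl \<Rightarrow> 'p ctl" where
  "left (Atom p) = Atom p"
| "left (Neg \<phi>) = \<phi>"
| "left (Bin b \<phi> \<psi>) = \<phi>"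
| "left (Exists t \<phi>) = \<phi>"
| "left (Forall t \<phi>) = \<phi>"

fun right :: "'p ctl \<Rightarrow> 'p ctl" where
  "right (Bin b \<phi> \<psi>) = \<psi>"
| "right \<phi> = \<phi>"

lemma mkf_opr_of: "(\<And>p'. \<phi> = Atom p' \<Longrightarrow> p = p') \<Longrightarrow> mkf (opr_of \<phi>) p (left \<phi>) (right \<phi>) = \<phi>"
  by (cases \<phi>) (auto simp: mkf_def)

lemma subformulas_trans: "\<psi> \<in> subformulas \<phi> \<Longrightarrow> subformulas \<psi> \<subseteq> subformulas \<phi>"
  by (induction \<phi>) auto

lemma left_right_sub: "left \<phi> \<in> subformulas \<phi>" "right \<phi> \<in> subformulas \<phi>"
  by (cases \<phi>; simp add: subformulas_refl)+

lemma left_size: "opr_of \<phi> \<noteq> OAtom \<Longrightarrow> size (left \<phi>) < size \<phi>"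
  by (cases \<phi>) auto

lemma right_size: "opr_of \<phi> = OBin b \<Longrightarrow> size (right \<phi>) < size \<phi>"
  by (cases \<phi>) auto

lemma finite_subformulas: "finite (subformulas \<phi>)"
  by (induction \<phi>) auto

lemma fragment_subformulas:
  "\<phi> \<in> ctl_fragment V Ut Bl \<Longrightarrow> \<psi> \<in> subformulas \<phi> \<Longrightarrow> \<psi> \<in> ctl_fragment V Ut Bl"
proof (induction rule: ctl_fragment.induct)
  case (Atom p) then show ?case by (auto intro: ctl_fragment.intros)
next
  case (Neg \<phi>) then show ?case by (auto intro: ctl_fragment.intros)
next
  case (Bin b \<phi> \<psi>') then show ?case by (auto intro: ctl_fragment.intros)
next
  case (Exists t \<phi>) then show ?case by (auto intro: ctl_fragment.intros)
next
  case (Forall t \<phi>) then show ?case by (auto intro: ctl_fragment.intros)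
qed

lemma fragment_opr:
  "\<phi> \<in> ctl_fragment V Ut Bl \<Longrightarrow> opr_of \<phi> \<in> oprs Ut Bl"
  by (induction rule: ctl_fragment.induct) (auto simp: oprs_def)

lemma fragment_atom: "Atom p \<in> ctl_fragment V Ut Bl \<Longrightarrow> p \<in> V"
  by (auto elim: ctl_fragment.cases)

lemma base_code_less: "base_code b < 5"
  by (cases b) auto

lemma temp_code_less: "temp_code t < 3"
  by (cases t) auto

lemma opc_less: "opc f < 20"
proof (cases f rule: opc.cases)
  case (3 e t) then show ?thesis using temp_code_less[of t] by simp
next
  case (4 b) then show ?thesis using base_code_less[of b] by simp
next
  case (5 b) then show ?thesis using base_code_less[of b] by simp
qed auto

lemma opc_bin: "8 \<le> opc f \<Longrightarrow> \<exists>b. f = OBin b"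
proof (cases f rule: opc.cases)
  case (3 e t)
  then show "8 \<le> opc f \<Longrightarrow> \<exists>b. f = OBin b" using temp_code_less[of t] by (simp split: if_splits)
qed auto

text \<open>The nodes are the subformulas sorted by size, so operands come first. \<open>N\<close>
  has room for the indices of at most \<open>2 * length x\<close> structures and for the operator
  codes, which are below 20.\<close>

lemma chk_complete:
  assumes "x \<in> CTL_Learn Ut Bl n"
  defines "N \<equiv> 2 * length x + 20"
  shows "\<exists>g. (\<forall>a i j l. g a i j l \<le> N) \<and> (\<forall>a i j l. \<not> (a < 8 \<and> i < N \<and> j < N \<and> l < N) \<longrightarrow> g a i j l = 0) \<and>
     chk Ut Bl n x g"
proof -
  have endN: "endN x = length x" and kr: "\<forall>K\<in>set (structsP x) \<union> set (structsN x). is_kripke K"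
    and cl: "ctl_learn Ut Bl n {..<numP x} (set (structsP x)) (set (structsN x)) (bound x)"
    using assms unfolding CTL_Learn_iff by auto
  obtain \<phi> where \<phi>: "\<phi> \<in> ctl_fragment {..<numP x} Ut Bl" "fsize \<phi> \<le> bound x" "bin_size \<phi> \<le> n"
    "\<forall>K\<in>set (structsP x). models K \<phi>" "\<forall>K\<in>set (structsN x). \<not> models K \<phi>"
    using cl unfolding ctl_learn_def by blast
  have oN: "offN x \<le> length x" using endN pos_mono[of 0 "lenN x" "numP x" x "offN x"] by (simp add: endN_def pos_0)
  have le: "lenP x \<le> length x" "lenN x \<le> length x" "bound x \<le> length x" "numP x \<le> length x" "endP x \<le> length x"
    using ones_le oN by (auto simp: lenP_def lenN_def bound_def numP_def offN_def)
  obtain ys where ys: "set ys = subformulas \<phi>" "distinct ys" using finite_distinct_list[OF finite_subformulas] by blast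
  define L where "L = sort_key size ys"
  have L: "set L = subformulas \<phi>" "distinct L" "sorted (map size L)" using ys by (auto simp: L_def)
  have lenL: "length L = fsize \<phi>" using L distinct_card[of L] by (simp add: fsize_def)
  define idx where "idx \<psi> = (SOME i. i < length L \<and> L ! i = \<psi>)" for \<psi>
  have idx: "idx \<psi> < length L" "L ! idx \<psi> = \<psi>" if "\<psi> \<in> subformulas \<phi>" for \<psi>
    using someI_ex[of "\<lambda>i. i < length L \<and> L ! i = \<psi>"] that L(1) unfolding idx_def by (metis in_set_conv_nth)+
  have idx_less: "idx \<psi> < u" if "\<psi> \<in> subformulas \<phi>" "u < length L" "size \<psi> < size (L ! u)" for \<psi> u
  proof (rule ccontr)
    assume "\<not> idx \<psi> < u"
    then have "map size L ! u \<le> map size L ! idx \<psi>"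
      using idx[OF that(1)] L(3) by (intro sorted_nth_mono) auto
    then show False using idx[OF that(1)] that by simp
  qed
  have sub: "L ! u \<in> subformulas \<phi>" if "u < length L" for u using that L(1) nth_mem by metis
  have frag: "L ! u \<in> ctl_fragment {..<numP x} Ut Bl" if "u < length L" for u
    using fragment_subformulas[OF \<phi>(1) sub[OF that]] .
  have lsub: "left (L ! u) \<in> subformulas \<phi>" and rsub: "right (L ! u) \<in> subformulas \<phi>" if "u < length L" for u
    using subformulas_trans[OF sub[OF that]] left_right_sub by auto
  define lf where "lf u = (case L ! u of Atom p \<Rightarrow> p | _ \<Rightarrow> idx (left (L ! u)))" for u
  define S where "S = lenP x + lenN x"
  define K where "K s = (if s < lenP x then structsP x ! s else structsN x ! (s - lenP x))" for s
  have Kin: "K s \<in> set (structsP x) \<union> set (structsN x)" if "s < S" for s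
    using that by (auto simp: K_def S_def length_structs)
  then have krK: "is_kripke (K s)" if "s < S" for s using kr that by blast
  have cardK: "\<exists>m\<le>length x. states (K s) = {..<m}" if "s < S" for s
    using Kin[OF that] ones_le by (auto simp: structsP_def structsN_def kdecs_def kdec_def Let_def)
  have "\<forall>u s. \<exists>rk. s < S \<longrightarrow> sem_ok (opr_of (L ! u)) (K s) (lf u) (sat (K s) (mkf (opr_of (L ! u)) (lf u) (left (L ! u)) (right (L ! u))))
     (sat (K s) (left (L ! u))) (sat (K s) (right (L ! u))) rk \<and> (\<forall>q. rk q \<le> card (states (K s)))"
    using sem_ok_ex[OF krK] by blast
  then obtain rk where rk: "\<And>u s. s < S \<Longrightarrow> sem_ok (opr_of (L ! u)) (K s) (lf u) (sat (K s) (mkf (opr_of (L ! u)) (lf u) (left (L ! u)) (right (L ! u))))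
     (sat (K s) (left (L ! u))) (sat (K s) (right (L ! u))) (rk u s)" "\<And>u s q. s < S \<Longrightarrow> rk u s q \<le> card (states (K s))"
    by metis
  have mk: "mkf (opr_of (L ! u)) (lf u) (left (L ! u)) (right (L ! u)) = L ! u" for u
    by (rule mkf_opr_of) (simp add: lf_def)
  define raw where "raw a i j l = (if a = 0 then opc (opr_of (L ! i)) else if a = 1 then lf i else if a = 2 then idx (right (L ! i))
     else if a = 3 then of_bool (sat (K j) (L ! i) l) else if a = 4 then rk i j l
     else if a = 5 then pos (numP x) x (offP x) i else if a = 6 then pos (numP x) x (offN x) i else idx \<phi>)"
    for a i j l :: nat
  \<comment> \<open>Truncation at \<open>N\<close> makes the function representable as a
    certificate; the facts below show that no entry on which the check depends is changed.\<close>
  define g where "g a i j l = (if a < 8 \<and> i < N \<and> j < N \<and> l < N then min N (raw a i j l) else 0)" for a i j l :: nat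
  have N0: "0 < N" "length x < N" by (auto simp: N_def)
  have SN: "s < N" if "s \<le> S" for s using that le by (auto simp: S_def N_def)
  have LN: "u < N" "u < length x" if "u < length L" for u using that lenL \<phi>(2) le N0 by auto
  have g0: "g 0 u 0 0 = opc (opr_of (L ! u))" if "u < length L" for u
    using LN(1)[OF that] N0 opc_less[of "opr_of (L ! u)"] by (simp add: g_def raw_def N_def min_def)
  have lfle: "lf u < length x" if "u < length L" for u
  proof (cases "L ! u")
    case (Atom p)
    then have "p < numP x" using fragment_atom[of p] frag[OF that] by auto
    then show ?thesis using Atom le by (simp add: lf_def)
  qed (use idx(1)[OF lsub[OF that]] LN in \<open>auto simp: lf_def\<close>)
  have g1: "g 1 u 0 0 = lf u" if "u < length L" for u
    using LN(1)[OF that] N0 lfle[OF that] by (simp add: g_def raw_def)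
  have g2: "g 2 u 0 0 = idx (right (L ! u))" if "u < length L" for u
    using LN(1)[OF that] N0 LN(2)[OF idx(1)[OF rsub[OF that]]] by (simp add: g_def raw_def)
  have qN: "q < N" if "s < S" "q \<in> states (K s)" for s q
  proof -
    note s = that(1)
    obtain m where "m \<le> length x" "states (K s) = {..<m}" using cardK[OF s] by blast
    then show ?thesis using that(2) N0(2) by simp
  qed
  have rkN: "rk u s q \<le> N" if "s < S" for u s q
  proof -
    note s = that
    obtain m where "m \<le> length x" "states (K s) = {..<m}" using cardK[OF s] by blast
    then show ?thesis using rk(2)[OF that, of u q] N0(2) by simp
  qed
  have g3: "(0 < g 3 u s q) = sat (K s) (L ! u) q" if "u < length L" "s < S" "q \<in> states (K s)" for u s q
  proof -
    have "u < N" "s < N" "q < N" using LN(1) SN[of s] qN that by auto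
    then have "g 3 u s q = min N (of_bool (sat (K s) (L ! u) q))" by (simp add: g_def raw_def)
    then show ?thesis using N0(1) by (cases "sat (K s) (L ! u) q") auto
  qed
  have g4: "g 4 u s q = rk u s q" if "u < length L" "s < S" "q \<in> states (K s)" for u s q
  proof -
    have "u < N" "s < N" "q < N" using LN(1) SN[of s] qN that by auto
    then have "g 4 u s q = min N (rk u s q)" by (simp add: g_def raw_def)
    then show ?thesis using rkN[OF that(2)] by simp
  qed
  have g5: "g 5 s 0 0 = pos (numP x) x (offP x) s" if "s \<le> lenP x" for s
    using SN[of s] N0 that le pos_mono[OF that, of "numP x" x "offP x"] by (auto simp: g_def raw_def S_def endP_def)
  have g6: "g 6 s 0 0 = pos (numP x) x (offN x) s" if "s \<le> lenN x" for s
    using SN[of s] N0 that le pos_mono[OF that, of "numP x" x "offN x"] endN by (auto simp: g_def raw_def S_def endN_def)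
  have root: "idx \<phi> < length L" "L ! idx \<phi> = \<phi>" using idx[OF subformulas_refl] by auto
  have g7: "g 7 0 0 0 = idx \<phi>" using N0 LN[OF root(1)] by (simp add: g_def raw_def)
  have lay: "layout x g"
    unfolding layout_def using g5 g6 endN
    by (auto simp: pos_0 pos_Suc endP_def[symmetric] lenN_def[symmetric] offN_def endN_def)
  note p = layout_pos[OF lay]
  have Kst: "kdec (numP x) x (struct_pos x g s) = K s" if "s < S" for s
  proof (cases "s < lenP x")
    case True
    then show ?thesis using p(4) by (simp add: K_def)
  next
    case False
    then have "s - lenP x < lenN x" using that by (simp add: S_def)
    from p(5)[OF this] show ?thesis using False by (simp add: K_def)
  qed
  have node: "node_ok x g S u (opr_of (L ! u))" if u: "u < length L" for u
    unfolding node_ok_def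
  proof (intro conjI allI impI)
    show "g 0 u 0 0 = opc (opr_of (L ! u))" by (rule g0[OF u])
    show "args_ok (opr_of (L ! u)) (numP x) u (g 1 u 0 0) (g 2 u 0 0)"
      using idx_less[OF lsub[OF u] u left_size] idx_less[OF rsub[OF u] u right_size] frag[OF u] fragment_atom
      unfolding g1[OF u] g2[OF u] by (cases "L ! u") (force simp: args_ok_def lf_def)+
    fix s assume s: "s < S"
    show "sem_ok (opr_of (L ! u)) (kdec (numP x) x (struct_pos x g s)) (g 1 u 0 0) (\<lambda>q. 0 < g 3 u s q)
        (\<lambda>q. 0 < g 3 (g 1 u 0 0) s q) (\<lambda>q. 0 < g 3 (g 2 u 0 0) s q) (\<lambda>q. g 4 u s q)"
      unfolding Kst[OF s] g1[OF u] g2[OF u]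
    proof (rule sem_ok_cong[OF krK[OF s], THEN iffD1, OF _ _ _ _ rk(1)[OF s, of u, unfolded mk]])
      fix q assume q: "q \<in> states (K s)"
      show "sat (K s) (L ! u) q = (0 < g 3 u s q)" using g3[OF u s q] by simp
      show "rk u s q = g 4 u s q" using g4[OF u s q] by simp
      show "sat (K s) (right (L ! u)) q = (0 < g 3 (idx (right (L ! u))) s q)"
        using g3[OF idx(1)[OF rsub[OF u]] s q] idx(2)[OF rsub[OF u]] by simp
      assume "opr_of (L ! u) \<noteq> OAtom"
      then have "lf u = idx (left (L ! u))" by (cases "L ! u") (auto simp: lf_def)
      then show "sat (K s) (left (L ! u)) q = (0 < g 3 (lf u) s q)"
        using g3[OF idx(1)[OF lsub[OF u]] s q] idx(2)[OF lsub[OF u]] by simp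
    qed
  qed
  have "(\<Sum>u<Suc (idx \<phi>). of_bool (8 \<le> g 0 u 0 0)) = card {u. u < Suc (idx \<phi>) \<and> 8 \<le> g 0 u 0 0}"
    by (simp add: of_bool_def sum.If_cases Int_def del: sum.lessThan_Suc)
  also have "\<dots> \<le> card {\<psi> \<in> subformulas \<phi>. \<exists>b \<psi>1 \<psi>2. \<psi> = Bin b \<psi>1 \<psi>2}"
  proof (rule card_inj_on_le[where f = "\<lambda>u. L ! u"])
    \<comment> \<open>As \<open>L\<close> is distinct, each binary node accounts for a binary
      subformula of its own.\<close>
    show "inj_on (\<lambda>u. L ! u) {u. u < Suc (idx \<phi>) \<and> 8 \<le> g 0 u 0 0}"
      using root(1) L(2) by (auto simp: inj_on_def nth_eq_iff_index_eq)
    show "(\<lambda>u. L ! u) ` {u. u < Suc (idx \<phi>) \<and> 8 \<le> g 0 u 0 0} \<subseteq> {\<psi> \<in> subformulas \<phi>. \<exists>b \<psi>1 \<psi>2. \<psi> = Bin b \<psi>1 \<psi>2}"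
    proof (intro subsetI, elim imageE)
      fix \<psi> u assume u: "\<psi> = L ! u" "u \<in> {u. u < Suc (idx \<phi>) \<and> 8 \<le> g 0 u 0 0}"
      then have "u < length L" using root(1) by simp
      then have "\<exists>b. opr_of (L ! u) = OBin b" using opc_bin g0 u by simp
      then show "\<psi> \<in> {\<psi> \<in> subformulas \<phi>. \<exists>b \<psi>1 \<psi>2. \<psi> = Bin b \<psi>1 \<psi>2}"
        using sub[OF \<open>u < length L\<close>] unfolding u(1) by (cases "L ! u") auto
    qed
  qed (simp add: finite_subformulas)
  also have "\<dots> \<le> n" using \<phi>(3) by (simp add: bin_size_def)
  finally have bins: "(\<Sum>u<Suc (idx \<phi>). of_bool (8 \<le> g 0 u 0 0)) \<le> n" .
  have inP: "K s \<in> set (structsP x)" if "s < lenP x" for s using that by (simp add: K_def length_structs)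
  have inN: "K (lenP x + s) \<in> set (structsN x)" if "s < lenN x" for s using that by (simp add: K_def length_structs)
  have initK: "q \<in> states (K s)" if "s < S" "q \<in> init (K s)" for s q
    using krK[OF that(1)] that(2) by (auto simp: is_kripke_def)
  have "chk Ut Bl n x g"
    unfolding chk_def p(1,2) g7 S_def[symmetric]
  proof (intro conjI allI impI ballI)
    show "is_kripke (kdec (numP x) x (struct_pos x g s))" if "s < S" for s using krK Kst that by simp
    show "idx \<phi> < bound x" using root(1) lenL \<phi>(2) by simp
    show "\<exists>f\<in>oprs Ut Bl. node_ok x g S u f" if "u < Suc (idx \<phi>)" for u
    proof -
      have "u < length L" using that root(1) by simp
      then show ?thesis using node fragment_opr[OF frag] by blast
    qed
    show "0 < g 3 (idx \<phi>) s q" if s: "s < lenP x" and q: "q \<in> init (kdec (numP x) x (struct_pos x g s))" for s q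
    proof -
      have S: "s < S" using s by (simp add: S_def)
      have "sat (K s) \<phi> q" using \<phi>(4) inP[OF s] q unfolding Kst[OF S] models_def by blast
      then show ?thesis using g3[OF root(1) S initK[OF S]] q root(2) unfolding Kst[OF S] by simp
    qed
    show "\<exists>q\<in>init (kdec (numP x) x (struct_pos x g (lenP x + s))). \<not> 0 < g 3 (idx \<phi>) (lenP x + s) q" if s: "s < lenN x" for s
    proof -
      have S: "lenP x + s < S" using s by (simp add: S_def)
      obtain q where q: "q \<in> init (K (lenP x + s))" "\<not> sat (K (lenP x + s)) \<phi> q"
        using \<phi>(5) inN[OF s] unfolding models_def by blast
      then show ?thesis using g3[OF root(1) S initK[OF S]] root(2) unfolding Kst[OF S] by auto
    qed
  qed (use lay bins in auto)
  moreover have "g a i j l \<le> N" for a i j l by (simp add: g_def)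
  moreover have "\<not> (a < 8 \<and> i < N \<and> j < N \<and> l < N) \<Longrightarrow> g a i j l = 0" for a i j l by (auto simp: g_def)
  ultimately show ?thesis by blast
qed

section \<open>The check as an arithmetic term\<close>

lemma pn_ones:
  assumes "pn F" shows "pn (\<lambda>ws ns. ones (word ws k) (F ws ns))"
  unfolding ones_def by (intro pn_intros pn_ren[OF assms])

lemma pn_nxt: "pn G \<Longrightarrow> pn F \<Longrightarrow> pn (\<lambda>ws ns. nxt (G ws ns) (word ws k) (F ws ns))"
  unfolding nxt_def ksize_def by (intro pn_intros pn_ones)

lemma pn_numP: "pn (\<lambda>ws ns. numP (word ws k))"
  unfolding numP_def by (intro pn_intros pn_ones)

lemma pn_bound: "pn (\<lambda>ws ns. bound (word ws k))"
  unfolding bound_def by (intro pn_intros pn_ones pn_numP)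

lemma pn_lenP: "pn (\<lambda>ws ns. lenP (word ws k))"
  unfolding lenP_def by (intro pn_intros pn_ones pn_numP pn_bound)

lemma pn_offP: "pn (\<lambda>ws ns. offP (word ws k))"
  unfolding offP_def by (intro pn_intros pn_ones pn_numP pn_bound)

text \<open>The verifier is called with the input and the certificate; after \<open>rotate1\<close>
  the certificate is word 0 and the input is word 1.\<close>

abbreviation crt :: "bool list list \<Rightarrow> nat \<Rightarrow> nat \<Rightarrow> nat \<Rightarrow> nat \<Rightarrow> nat" where
  "crt ws \<equiv> cert (2 * length (word ws 1) + 20) (word ws 0)"

lemma pn_cert:
  assumes "pn F" "pn G" "pn H" shows "pn (\<lambda>ws ns. crt ws a (F ws ns) (G ws ns) (H ws ns))"
  unfolding cert_def by (intro pn_intros assms[THEN pn_ren] assms)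

lemma pn_struct_pos: "pn F \<Longrightarrow> pn (\<lambda>ws ns. struct_pos (word ws 1) (crt ws) (F ws ns))"
  unfolding struct_pos_def by (intro pn_intros pn_cert pn_lenP)

text \<open>Quantifiers over states of a decoded structure become bounded quantifiers over numbers,
  the form for which closure rules exist.\<close>

lemma kdec_ball:
  "(\<forall>q\<in>states (kdec k x a). P q) = (\<forall>q<ones x a. P q)"
  "(\<forall>q\<in>init (kdec k x a). P q) = (\<forall>q<ones x a. bit x (a + Suc (ones x a) + q) \<longrightarrow> P q)"
  "(\<exists>q\<in>init (kdec k x a). P q) = (\<exists>q<ones x a. bit x (a + Suc (ones x a) + q) \<and> P q)"
  by (auto simp: kdec_def Let_def)

lemma kdec_label:
  "(p \<in> label (kdec k x a) q) = (p < k \<and> bit x (a + Suc (ones x a) + ones x a + q * (k + ones x a) + p))"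
  by (simp add: kdec_def Let_def)

lemma kdec_quant:
  "quant True (succ (kdec k x a) q) P =
     (\<exists>r<ones x a. bit x (a + Suc (ones x a) + ones x a + q * (k + ones x a) + k + r) \<and> P r)"
  "quant False (succ (kdec k x a) q) P =
     (\<forall>r<ones x a. bit x (a + Suc (ones x a) + ones x a + q * (k + ones x a) + k + r) \<longrightarrow> P r)"
  by (auto simp: quant_def kdec_def Let_def)

lemma kdec_kripke:
  "is_kripke (kdec k x a) = (\<forall>q<ones x a. \<exists>r<ones x a. bit x (a + Suc (ones x a) + ones x a + q * (k + ones x a) + k + r))"
  by (auto simp: is_kripke_def kdec_def Let_def)

lemma pb_bin_sem: "pb P \<Longrightarrow> pb Q \<Longrightarrow> pb (\<lambda>ws ns. bin_sem b (P ws ns) (Q ws ns))"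
  by (cases b; cases "case b of Plain c \<Rightarrow> c | Negated c \<Rightarrow> c") (simp; intro pn_intros; assumption)+

lemma finite_oprs: "finite (oprs Ut Bl)"
proof -
  have b: "(UNIV :: base_op set) = {OrOp, AndOp, ImpliesOp, ImpliedByOp, IffOp}" by (auto intro: base_op.exhaust)
  have "(UNIV :: bin_op set) = range Plain \<union> range Negated" by (auto intro: bin_op.exhaust)
  then have B: "finite (UNIV :: bin_op set)" using b by (metis finite.emptyI finite_UnI finite_imageI finite_insert)
  have "(UNIV :: temp_op set) = {Next, Finally, Globally}" by (auto intro: temp_op.exhaust)
  then have T: "finite (UNIV :: temp_op set)" by (metis finite.emptyI finite_insert)
  have "oprs Ut Bl \<subseteq> {OAtom, ONeg} \<union> range OBin \<union> (\<lambda>(e, t). OTmp e t) ` (UNIV \<times> UNIV)"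
    by (auto simp: oprs_def)
  then show ?thesis
    by (rule finite_subset) (intro finite_UnI finite_imageI finite_cartesian_product B T; simp)
qed

lemmas chk_intros = pn_intros pn_ones pn_nxt pn_numP pn_bound pn_lenP pn_offP pn_cert pn_struct_pos

lemma pb_args_ok:
  "pn F \<Longrightarrow> pn G \<Longrightarrow> pn H \<Longrightarrow> pn I \<Longrightarrow> pb (\<lambda>ws ns. args_ok f (F ws ns) (G ws ns) (H ws ns) (I ws ns))"
  by (cases f) (simp_all add: args_ok_def, (intro pn_intros; assumption)+)

lemma pb_node_ok:
  assumes "pn F" "pn G"
  shows "pb (\<lambda>ws ns. node_ok (word ws 1) (crt ws) (F ws ns) (G ws ns) f)"
proof -
  have "pb (\<lambda>ws ns. \<forall>s<F ws ns. sem_ok f (kdec (numP (word ws 1)) (word ws 1) (struct_pos (word ws 1) (crt ws) s)) (crt ws 1 (G ws ns) 0 0)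
        (\<lambda>q. 0 < crt ws 3 (G ws ns) s q) (\<lambda>q. 0 < crt ws 3 (crt ws 1 (G ws ns) 0 0) s q)
        (\<lambda>q. 0 < crt ws 3 (crt ws 2 (G ws ns) 0 0) s q) (\<lambda>q. crt ws 4 (G ws ns) s q))"
  proof (cases f)
    case OAtom
    show ?thesis unfolding OAtom sem_ok_def opr.case kdec_ball kdec_label
      by (intro chk_intros pn_ren[OF assms(1)] pn_ren[OF assms(2)])
  next
    case ONeg
    show ?thesis unfolding ONeg sem_ok_def opr.case kdec_ball
      by (intro chk_intros pn_ren[OF assms(1)] pn_ren[OF assms(2)])
  next
    case (OBin b)
    show ?thesis unfolding OBin sem_ok_def opr.case kdec_ball
      by (intro chk_intros pb_bin_sem pn_ren[OF assms(1)] pn_ren[OF assms(2)])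
  next
    case (OTmp e t)
    show ?thesis unfolding OTmp sem_ok_def opr.case temporal_ok_def ranked_def
      by (cases e; cases t; simp only: temp_op.case kdec_ball kdec_quant simp_thms;
          intro chk_intros pn_ren[OF assms(1)] pn_ren[OF assms(2)])
  qed
  then show ?thesis
    unfolding node_ok_def by (intro pb_and; (assumption | intro chk_intros pb_args_ok assms))
qed

lemma pb_chk: "pb (\<lambda>ws ns. chk Ut Bl n (word ws 1) (crt ws))"
  unfolding chk_def layout_def kdec_ball kdec_kripke
  by (intro chk_intros pb_bex finite_oprs pb_node_ok)

lemma pow5: "(N :: nat) ^ 5 = N * N * N * N * N"
  by (simp add: eval_nat_numeral)

text \<open>With \<open>N = 2 * length x + 20\<close> the polynomial is \<open>8 * N ^ 5\<close>,
  the length of the certificates that \<open>cert_surj\<close> provides.\<close>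

lemma CTL_Learn_NP: "CTL_Learn Ut Bl n \<in> NP"
proof -
  define V where "V xs = [chk Ut Bl n (word (rotate1 xs) 1) (crt (rotate1 xs))]" for xs
  have "polytime 2 V" unfolding V_def using polytime_pw[OF pw_single[OF pb_chk], of 2] by simp
  moreover have "x \<in> CTL_Learn Ut Bl n \<longleftrightarrow> (\<exists>c. length c \<le> poly ([:8:] * [:20, 2:] ^ 5) (length x) \<and> V [x, c] = [True])" for x
  proof -
    define N where "N = 2 * length x + 20"
    have V: "V [x, c] = [chk Ut Bl n x (cert N c)]" for c by (simp add: V_def word_def N_def)
    have p: "poly ([:8:] * [:20, 2:] ^ 5) (length x) = 8 * N * N * N * N * N"
    proof -
      have "poly [:20, 2:] (length x) = N" by (simp add: N_def)
      then have "poly ([:8:] * [:20, 2:] ^ 5) (length x) = poly [:8:] (length x) * N ^ 5" by (simp only: poly_mult poly_power)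
      also have "\<dots> = 8 * N ^ 5" by simp
      finally show ?thesis by (simp only: pow5 mult.assoc)
    qed
    show ?thesis
    proof
      assume "x \<in> CTL_Learn Ut Bl n"
      from chk_complete[OF this] obtain g where g: "\<And>a i j l. g a i j l \<le> N"
        "\<And>a i j l. \<not> (a < 8 \<and> i < N \<and> j < N \<and> l < N) \<Longrightarrow> g a i j l = 0" "chk Ut Bl n x g"
        unfolding N_def by blast
      obtain c where "length c = 8 * N * N * N * N * N" "cert N c = g" using cert_surj[of g N] g(1,2) by blast
      then show "\<exists>c. length c \<le> poly ([:8:] * [:20, 2:] ^ 5) (length x) \<and> V [x, c] = [True]"
        unfolding p V using g(3) by (intro exI[of _ c]) simp
    next
      assume "\<exists>c. length c \<le> poly ([:8:] * [:20, 2:] ^ 5) (length x) \<and> V [x, c] = [True]"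
      then show "x \<in> CTL_Learn Ut Bl n" unfolding V using chk_sound by blast
    qed
  qed
  ultimately show ?thesis unfolding NP_def by blast
qed

section \<open>Next-formulas as assignments\<close>

definition mk_kripke :: "nat \<Rightarrow> (nat \<Rightarrow> bool) \<Rightarrow> (nat \<Rightarrow> bool) \<Rightarrow> (nat \<Rightarrow> nat \<Rightarrow> bool) \<Rightarrow> (nat, nat) kripke" where
  "mk_kripke m I L E = \<lparr>states = {..<m}, init = {q. q < m \<and> I q}, props = {..<1},
     label = (\<lambda>q. {p. p < 1 \<and> L q}), succ = (\<lambda>q. {r. r < m \<and> E q r})\<rparr>"

lemma encode_mk_kripke:
  "encode_kripke (mk_kripke m I L E) = unary m @ map I [0..<m] @ concat (map (\<lambda>q. L q # map (E q) [0..<m]) [0..<m])"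
  by (simp add: encode_kripke_def mk_kripke_def map_guard)

lemma valid_mk_kripke: "(\<And>q. q < m \<Longrightarrow> \<exists>r<m. E q r) \<Longrightarrow> valid 1 (mk_kripke m I L E)"
  by (auto simp: valid_def is_kripke_def mk_kripke_def)

text \<open>State \<open>q\<close> has distance \<open>D + 1 - q\<close> to the labelled loop. So
  \<open>chain D 1\<close> starts at distance \<open>D\<close> and will be a positive example, while
  \<open>chain D 0\<close> starts one step further away and will be a negative one.\<close>

definition chain :: "nat \<Rightarrow> nat \<Rightarrow> (nat, nat) kripke" where
  "chain D i = mk_kripke (D + 2) (\<lambda>q. q = i) (\<lambda>q. q = D + 1) (\<lambda>q r. r = min (q + 1) (D + 1))"

text \<open>A path that leaves the chain at a position in \<open>S\<close> stays in the sink \<open>D + 1\<close>, where the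
  proposition has the value \<open>b\<close>; it has the value \<open>\<not> b\<close> at the end of the chain. So a formula
  \<open>Q\<^sub>0 X \<dots> Q\<^bsub>D - 1\<^esub> X p\<close> holds iff some quantifier in \<open>S\<close> is existential (\<open>b\<close>), or fails iff some
  quantifier in \<open>S\<close> is universal (\<open>\<not> b\<close>).\<close>

definition branching :: "nat \<Rightarrow> bool \<Rightarrow> (nat \<Rightarrow> bool) \<Rightarrow> (nat, nat) kripke" where
  "branching D b S = mk_kripke (D + 2) (\<lambda>q. q = 0) (\<lambda>q. if b then q = D + 1 else q = D)
     (\<lambda>q r. if q < D then r = q + 1 \<or> (r = D + 1 \<and> S q) else r = q)"

lemma valid_chain: "valid 1 (chain D i)"
  unfolding chain_def by (rule valid_mk_kripke) auto

lemma valid_branching: "valid 1 (branching D b S)"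
  unfolding branching_def
proof (rule valid_mk_kripke)
  fix q assume "q < D + 2"
  then show "\<exists>r<D + 2. if q < D then r = q + 1 \<or> (r = D + 1 \<and> S q) else r = q"
    by (intro exI[of _ "if q < D then q + 1 else q"]) auto
qed

fun xform :: "bool list \<Rightarrow> nat ctl" where
  "xform [] = Atom 0"
| "xform (e # es) = (if e then Exists Next (xform es) else Forall Next (xform es))"

lemma sat_branching_sink: "sat (branching D b S) (xform es) (D + 1) = b"
proof (induction es)
  case (Cons e es)
  have K: "is_kripke (branching D b S)" using valid_branching by (simp add: valid_def)
  have q: "D + 1 \<in> states (branching D b S)" "succ (branching D b S) (D + 1) = {D + 1}"
    by (auto simp: branching_def mk_kripke_def)
  show ?case using Cons sat_Next[OF K q(1)] q(2) by (cases e) (auto simp: quant_def simp del: sat.simps)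
qed (auto simp: branching_def mk_kripke_def)

text \<open>The sink contributes \<open>b\<close>: if true, it settles an existential quantifier and
  leaves a universal one to the chain; if false, it is the other way round. The opposite value at
  the end of the chain becomes the empty disjunction or conjunction.\<close>

lemma sat_branching:
  assumes "length es = D" "i \<le> D"
  shows "sat (branching D b S) (xform (drop i es)) i =
    (if b then \<exists>j<D. i \<le> j \<and> S j \<and> es ! j else \<forall>j<D. i \<le> j \<longrightarrow> S j \<longrightarrow> es ! j)"
  using assms(2)
proof (induction i rule: inc_induct)
  case base
  then show ?case using assms by (auto simp: branching_def mk_kripke_def)
next
  case (step i)
  have K: "is_kripke (branching D b S)" using valid_branching by (simp add: valid_def)
  have q: "i \<in> states (branching D b S)" "succ (branching D b S) i = {Suc i} \<union> (if S i then {D + 1} else {})"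
    using step.hyps by (auto simp: branching_def mk_kripke_def)
  have d: "drop i es = es ! i # drop (Suc i) es" using step.hyps assms(1) by (simp add: Cons_nth_drop_Suc)
  have "sat (branching D b S) (xform (drop i es)) i =
    quant (es ! i) ({Suc i} \<union> (if S i then {D + 1} else {})) (sat (branching D b S) (xform (drop (Suc i) es)))"
    unfolding d using sat_Next[OF K q(1)] q(2) by (cases "es ! i") (auto simp del: sat.simps)
  also have "\<dots> = (if es ! i then sat (branching D b S) (xform (drop (Suc i) es)) (Suc i) \<or> (S i \<and> b)
     else sat (branching D b S) (xform (drop (Suc i) es)) (Suc i) \<and> (S i \<longrightarrow> b))"
    using sat_branching_sink[of D b S] by (auto simp: quant_def simp del: sat.simps)
  also have "\<dots> = (if b then \<exists>j<D. i \<le> j \<and> S j \<and> es ! j else \<forall>j<D. i \<le> j \<longrightarrow> S j \<longrightarrow> es ! j)"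
    unfolding step.IH using step.hyps by (auto simp: Suc_le_eq) (metis le_neq_implies_less)+
  finally show ?case .
qed

lemma models_branching:
  assumes "length es = D"
  shows "models (branching D b S) (xform es) = (if b then \<exists>j<D. S j \<and> es ! j else \<forall>j<D. S j \<longrightarrow> es ! j)"
  using sat_branching[OF assms, of 0 b S] by (auto simp: models_def) (auto simp: branching_def mk_kripke_def)

section \<open>Nesting depth against size on the chain\<close>

lemma paths_chain:
  assumes "q \<le> D + 1"
  shows "paths (chain D i) q = {\<lambda>j. min (q + j) (D + 1)}"
proof
  show "paths (chain D i) q \<subseteq> {\<lambda>j. min (q + j) (D + 1)}"
  proof
    fix \<rho> assume \<rho>: "\<rho> \<in> paths (chain D i) q"
    have "\<rho> j = min (q + j) (D + 1)" for j
    proof (induction j)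
      case (Suc j)
      have "\<rho> (Suc j) = min (\<rho> j + 1) (D + 1)" using \<rho> by (auto simp: paths_def chain_def mk_kripke_def)
      then show ?case using Suc by simp
    qed (use \<rho> assms in \<open>simp add: paths_def\<close>)
    then show "\<rho> \<in> {\<lambda>j. min (q + j) (D + 1)}" by auto
  qed
  show "{\<lambda>j. min (q + j) (D + 1)} \<subseteq> paths (chain D i) q"
    using assms by (auto simp: paths_def chain_def mk_kripke_def)
qed

text \<open>The chain is deterministic, so the two path quantifiers coincide.\<close>

lemma sat_chain_temporal:
  assumes "q \<le> D + 1"
  shows "sat (chain D i) (Exists t \<phi>) q = temp_sem t (\<lambda>j. sat (chain D i) \<phi> (min (q + j) (D + 1)))"
    and "sat (chain D i) (Forall t \<phi>) q = temp_sem t (\<lambda>j. sat (chain D i) \<phi> (min (q + j) (D + 1)))"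
  by (simp_all add: paths_chain[OF assms])

primrec xdepth :: "'p ctl \<Rightarrow> nat" where
  "xdepth (Atom p) = 0"
| "xdepth (Neg \<phi>) = xdepth \<phi>"
| "xdepth (Bin b \<phi> \<psi>) = max (xdepth \<phi>) (xdepth \<psi>)"
| "xdepth (Exists t \<phi>) = (if t = Next then Suc (xdepth \<phi>) else xdepth \<phi>)"
| "xdepth (Forall t \<phi>) = (if t = Next then Suc (xdepth \<phi>) else xdepth \<phi>)"

text \<open>The path from \<open>q\<close> differs from the one from \<open>q'\<close> only by
  additional states up to \<open>q'\<close>, on which \<open>P\<close> is constant. So Finally and
  Globally see nothing new, and Next shortens the constant region by one.\<close>

lemma temp_sem_chain:
  assumes IH: "\<And>q q'. q \<le> q' \<Longrightarrow> q' + d \<le> D \<Longrightarrow> P q = P q'"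
    and "q \<le> q'" "q' + (if t = Next then Suc d else d) \<le> D"
  shows "temp_sem t (\<lambda>j. P (min (q + j) (D + 1))) = temp_sem t (\<lambda>j. P (min (q' + j) (D + 1)))"
proof -
  have shift: "min (q + (j + (q' - q))) (D + 1) = min (q' + j) (D + 1)" for j using assms(2) by simp
  have down: "\<exists>j'. P (min (q + j) (D + 1)) = P (min (q' + j') (D + 1))" if "q' + d \<le> D" for j
  proof (cases "q + j \<le> q'")
    case True
    then have "P (q + j) = P q'" using IH that by blast
    then show ?thesis using True that by (intro exI[of _ 0]) (simp add: min_def)
  next
    case False
    then have "q + j = q' + (q + j - q')" by simp
    then show ?thesis by metis
  qed
  show ?thesis
  proof (cases t)
    case Next
    then have "P (q + 1) = P (q' + 1)" using assms(2,3) by (intro IH) auto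
    then show ?thesis using Next assms(2,3) by (simp add: min_def)
  next
    case Finally
    then show ?thesis using down shift assms(3) by simp metis
  next
    case Globally
    then show ?thesis using down shift assms(3) by simp metis
  qed
qed

lemma sat_chain_const:
  "q \<le> q' \<Longrightarrow> q' + xdepth \<phi> \<le> D \<Longrightarrow> sat (chain D i) \<phi> q = sat (chain D i) \<phi> q'"
proof (induction \<phi> arbitrary: q q')
  case (Atom p)
  then show ?case by (simp add: chain_def mk_kripke_def)
next
  case (Bin b \<phi> \<psi>)
  then show ?case using Bin.IH(1)[of q q'] Bin.IH(2)[of q q'] by simp
next
  case (Exists t \<phi>)
  have "temp_sem t (\<lambda>j. sat (chain D i) \<phi> (min (q + j) (D + 1))) = temp_sem t (\<lambda>j. sat (chain D i) \<phi> (min (q' + j) (D + 1)))"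
    by (rule temp_sem_chain[OF Exists.IH]) (use Exists.prems in \<open>auto split: if_splits\<close>)
  then show ?case using Exists.prems by (simp only: sat_chain_temporal)
next
  case (Forall t \<phi>)
  have "temp_sem t (\<lambda>j. sat (chain D i) \<phi> (min (q + j) (D + 1))) = temp_sem t (\<lambda>j. sat (chain D i) \<phi> (min (q' + j) (D + 1)))"
    by (rule temp_sem_chain[OF Forall.IH]) (use Forall.prems in \<open>auto split: if_splits\<close>)
  then show ?case using Forall.prems by (simp only: sat_chain_temporal)
qed auto

lemma sat_chain_xform: "q \<le> D + 1 \<Longrightarrow> sat (chain D i) (xform es) q = (D + 1 \<le> q + length es)"
proof (induction es arbitrary: q)
  case Nil
  then show ?case by (auto simp: chain_def mk_kripke_def)
next
  case (Cons e es)
  have "sat (chain D i) (xform (e # es)) q = sat (chain D i) (xform es) (min (q + 1) (D + 1))"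
    using sat_chain_temporal[OF Cons.prems] by (simp del: sat.simps)
  also have "\<dots> = (D + 1 \<le> min (q + 1) (D + 1) + length es)" by (rule Cons.IH) simp
  finally show ?case using Cons.prems by auto
qed

lemma subformulas_size: "\<psi> \<in> subformulas \<phi> \<Longrightarrow> \<psi> = \<phi> \<or> size \<psi> < size \<phi>"
  by (induction \<phi>) (auto simp: less_Suc_eq)

lemma fsize_less:
  assumes "\<psi> \<in> subformulas \<phi>" "\<psi> \<noteq> \<phi>"
  shows "fsize \<psi> < fsize \<phi>"
  unfolding fsize_def
proof (rule psubset_card_mono[OF finite_subformulas])
  have "\<phi> \<notin> subformulas \<psi>" using subformulas_size[OF assms(1)] subformulas_size[of \<phi> \<psi>] assms(2) by auto
  then show "subformulas \<psi> \<subset> subformulas \<phi>" using subformulas_trans[OF assms(1)] subformulas_refl[of \<phi>] by blast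
qed

lemma fsize_sub:
  "fsize \<phi> < fsize (Neg \<phi>)" "fsize \<phi> < fsize (Bin b \<phi> \<psi>)" "fsize \<psi> < fsize (Bin b \<phi> \<psi>)"
  "fsize \<phi> < fsize (Exists t \<phi>)" "fsize \<phi> < fsize (Forall t \<phi>)"
  by (rule fsize_less; simp add: subformulas_refl; metis size_neq_size_imp_neq)+

text \<open>Every Next on a deepest branch is one more subformula, and so is the atom at the
  bottom.\<close>

lemma xdepth_less_fsize: "xdepth \<phi> < fsize \<phi>"
proof (induction \<phi>)
  case (Atom p)
  then show ?case by (simp add: fsize_def)
next
  case (Neg \<phi>)
  then show ?case using fsize_sub(1)[of \<phi>] by simp
next
  case (Bin b \<phi> \<psi>)
  then show ?case using fsize_sub(2,3)[of \<phi> b \<psi>] fsize_sub(3)[of \<psi> b \<phi>] by simp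
next
  case (Exists t \<phi>)
  then show ?case using fsize_sub(4)[of \<phi> t] by (cases "t = Next") auto
next
  case (Forall t \<phi>)
  then show ?case using fsize_sub(5)[of \<phi> t] by (cases "t = Next") auto
qed

text \<open>In the extremal case every operator has to raise the depth. Negations, binary operators,
  Finally and Globally cost a subformula without doing so; only Next remains.\<close>

lemma xform_if_small:
  "\<phi> \<in> ctl_fragment {..<1} Ut Bl \<Longrightarrow> fsize \<phi> \<le> xdepth \<phi> + 1 \<Longrightarrow> \<exists>es. length es = xdepth \<phi> \<and> \<phi> = xform es"
proof (induction rule: ctl_fragment.induct)
  case (Atom p)
  then show ?case by (intro exI[of _ "[]"]) auto
next
  case (Neg \<phi>)
  then show ?case using fsize_sub(1)[of \<phi>] xdepth_less_fsize[of \<phi>] by simp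
next
  case (Bin b \<phi> \<psi>)
  then show ?case using fsize_sub(2)[of \<phi> b \<psi>] fsize_sub(3)[of \<psi> b \<phi>] xdepth_less_fsize[of \<phi>] xdepth_less_fsize[of \<psi>]
    by (auto simp: max_def split: if_splits)
next
  case (Exists t \<phi>)
  have t: "t = Next"
    using Exists.prems fsize_sub(4)[of \<phi> t] xdepth_less_fsize[of \<phi>] by (auto split: if_splits)
  then obtain es where "length es = xdepth \<phi>" "\<phi> = xform es"
    using Exists fsize_sub(4)[of \<phi> t] by auto
  then show ?case using t by (intro exI[of _ "True # es"]) simp
next
  case (Forall t \<phi>)
  have t: "t = Next"
    using Forall.prems fsize_sub(5)[of \<phi> t] xdepth_less_fsize[of \<phi>] by (auto split: if_splits)
  then obtain es where "length es = xdepth \<phi>" "\<phi> = xform es"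
    using Forall fsize_sub(5)[of \<phi> t] by auto
  then show ?case using t by (intro exI[of _ "False # es"]) simp
qed

lemma xform_fragment: "Temporal Next \<in> Ut \<Longrightarrow> xform es \<in> ctl_fragment {..<1} Ut Bl"
  by (induction es) (auto intro: ctl_fragment.intros)

lemma fsize_xform: "fsize (xform es) \<le> length es + 1"
  by (induction es) (auto simp: fsize_def card_insert_if finite_subformulas)

lemma bin_size_xform: "bin_size (xform es) = 0"
proof -
  have "\<psi> \<in> subformulas (xform es) \<Longrightarrow> \<not> (\<exists>b \<psi>1 \<psi>2. \<psi> = Bin b \<psi>1 \<psi>2)" for \<psi>
    by (induction es) (auto split: if_splits)
  then have "{\<psi> \<in> subformulas (xform es). \<exists>b \<psi>1 \<psi>2. \<psi> = Bin b \<psi>1 \<psi>2} = {}" by blast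
  then show ?thesis unfolding bin_size_def by (metis card.empty)
qed

text \<open>The two chains force the depth \<open>D\<close>, the size bound then forces the shape
  \<open>xform\<close>, and the branching structures express the constraints on the quantifiers.
  Conversely \<open>xform es\<close> has no binary subformula and so respects every bound
  \<open>n\<close>.\<close>

lemma ctl_learn_assignment:
  assumes "Temporal Next \<in> Ut"
  shows "ctl_learn Ut Bl n {..<1} (insert (chain D 1) (branching D True ` P)) (insert (chain D 0) (branching D False ` N)) (D + 1)
    \<longleftrightarrow> (\<exists>es. length es = D \<and> (\<forall>S\<in>P. \<exists>j<D. S j \<and> es ! j) \<and> (\<forall>S\<in>N. \<exists>j<D. S j \<and> \<not> es ! j))"
proof
  assume "ctl_learn Ut Bl n {..<1} (insert (chain D 1) (branching D True ` P)) (insert (chain D 0) (branching D False ` N)) (D + 1)"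
  then obtain \<phi> where \<phi>: "\<phi> \<in> ctl_fragment {..<1} Ut Bl" "fsize \<phi> \<le> D + 1"
    "models (chain D 1) \<phi>" "\<forall>S\<in>P. models (branching D True S) \<phi>"
    "\<not> models (chain D 0) \<phi>" "\<forall>S\<in>N. \<not> models (branching D False S) \<phi>"
    by (auto simp: ctl_learn_def)
  have "sat (chain D 1) \<phi> 1" using \<phi>(3) by (auto simp: models_def) (auto simp: chain_def mk_kripke_def)
  moreover have "\<not> sat (chain D 0) \<phi> 0" using \<phi>(5) by (auto simp: models_def) (auto simp: chain_def mk_kripke_def)
  \<comment> \<open>The two chains differ only in the initial state, so both examples speak about
    one structure.\<close>
  moreover have "sat (chain D 0) \<phi> 0 = sat (chain D 1) \<phi> 0"
  proof -
    have "sat (chain D 0) \<phi> q = sat (chain D 1) \<phi> q" for q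
    proof -
      have "paths (chain D 0) = paths (chain D 1)" "label (chain D 0) = label (chain D 1)"
        by (auto simp: paths_def chain_def mk_kripke_def fun_eq_iff)
      then show ?thesis by (induction \<phi> arbitrary: q) auto
    qed
    then show ?thesis .
  qed
  ultimately have "\<not> 1 + xdepth \<phi> \<le> D" using sat_chain_const[of 0 1 \<phi> D 1] by auto
  then have "fsize \<phi> \<le> xdepth \<phi> + 1" "xdepth \<phi> = D" using \<phi>(2) xdepth_less_fsize[of \<phi>] by auto
  then obtain es where es: "length es = D" "\<phi> = xform es" using xform_if_small[OF \<phi>(1)] by auto
  show "\<exists>es. length es = D \<and> (\<forall>S\<in>P. \<exists>j<D. S j \<and> es ! j) \<and> (\<forall>S\<in>N. \<exists>j<D. S j \<and> \<not> es ! j)"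
    using \<phi>(4,6) es models_branching[OF es(1)] by (intro exI[of _ es]) auto
next
  assume "\<exists>es. length es = D \<and> (\<forall>S\<in>P. \<exists>j<D. S j \<and> es ! j) \<and> (\<forall>S\<in>N. \<exists>j<D. S j \<and> \<not> es ! j)"
  then obtain es where es: "length es = D" "\<forall>S\<in>P. \<exists>j<D. S j \<and> es ! j" "\<forall>S\<in>N. \<exists>j<D. S j \<and> \<not> es ! j" by blast
  have "models (chain D 1) (xform es)"
    using sat_chain_xform[of 1 D 1 es] es(1) by (auto simp: models_def) (auto simp: chain_def mk_kripke_def)
  moreover have "\<not> models (chain D 0) (xform es)"
    using sat_chain_xform[of 0 D 0 es] es(1) by (auto simp: models_def intro!: bexI[of _ 0]) (auto simp: chain_def mk_kripke_def)
  ultimately show "ctl_learn Ut Bl n {..<1} (insert (chain D 1) (branching D True ` P)) (insert (chain D 0) (branching D False ` N)) (D + 1)"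
    unfolding ctl_learn_def using es models_branching[OF es(1)] xform_fragment[OF assms] fsize_xform[of es] bin_size_xform[of es]
    by (intro bexI[of _ "xform es"]) auto
qed

section \<open>Uniform families of clauses\<close>

lemma concat_map_concat: "concat (map f (concat (map g xs))) = concat (map (\<lambda>a. concat (map f (g a))) xs)"
  by (induction xs) auto

lemma length_concat_const: "(\<And>a. a \<in> set xs \<Longrightarrow> length (f a) = w) \<Longrightarrow> length (concat (map f xs)) = length xs * w"
  by (induction xs) auto

text \<open>A clause is given by the predicate \<open>C b v\<close> telling whether the variable \<open>v\<close> occurs positively
  (\<open>b\<close>) or negatively. The quantifiers \<open>0, \<dots>, k - 1\<close> of a formula stand for the variables and the
  quantifiers \<open>k, \<dots>, 2 k - 1\<close> for their negations.\<close>

definition clause_set :: "nat \<Rightarrow> (bool \<Rightarrow> nat \<Rightarrow> bool) \<Rightarrow> nat \<Rightarrow> bool" where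
  "clause_set k C q \<longleftrightarrow> (q < k \<and> C True q) \<or> (k \<le> q \<and> C False (q - k))"

text \<open>The sets of \<open>v\<close> and \<open>k + v\<close> forbid that both quantifiers are
  existential. Both may be universal, yet clauses only ask for existential ones, so the first half
  of \<open>es\<close> serves as assignment: if quantifier \<open>k + v\<close> is existential, then
  \<open>v\<close> is false.\<close>

lemma assignment_iff:
  "(\<exists>es. length es = 2 * k \<and> (\<forall>S\<in>clause_set k ` Cs. \<exists>j<2 * k. S j \<and> es ! j) \<and>
      (\<forall>S\<in>(\<lambda>v q. q = v \<or> q = k + v) ` {..<k}. \<exists>j<2 * k. S j \<and> \<not> es ! j))
    \<longleftrightarrow> (\<exists>\<sigma>. \<forall>C\<in>Cs. \<exists>v<k. C (\<sigma> v) v)"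
proof
  assume "\<exists>es. length es = 2 * k \<and> (\<forall>S\<in>clause_set k ` Cs. \<exists>j<2 * k. S j \<and> es ! j) \<and>
      (\<forall>S\<in>(\<lambda>v q. q = v \<or> q = k + v) ` {..<k}. \<exists>j<2 * k. S j \<and> \<not> es ! j)"
  then obtain es where es: "\<And>C. C \<in> Cs \<Longrightarrow> \<exists>j<2 * k. clause_set k C j \<and> es ! j"
    "\<And>v. v < k \<Longrightarrow> \<not> es ! v \<or> \<not> es ! (k + v)" by auto
  have "\<exists>v<k. C (es ! v) v" if C: "C \<in> Cs" for C
  proof -
    obtain j where j: "j < 2 * k" "clause_set k C j" "es ! j" using es(1)[OF C] by blast
    show ?thesis
    proof (cases "j < k")
      case True
      then show ?thesis using j by (intro exI[of _ j]) (auto simp: clause_set_def)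
    next
      case False
      then have "j - k < k" "es ! (k + (j - k))" "C False (j - k)" using j by (auto simp: clause_set_def)
      then show ?thesis using es(2)[of "j - k"] by (intro exI[of _ "j - k"]) auto
    qed
  qed
  then show "\<exists>\<sigma>. \<forall>C\<in>Cs. \<exists>v<k. C (\<sigma> v) v" by blast
next
  assume "\<exists>\<sigma>. \<forall>C\<in>Cs. \<exists>v<k. C (\<sigma> v) v"
  then obtain \<sigma> where \<sigma>: "\<And>C. C \<in> Cs \<Longrightarrow> \<exists>v<k. C (\<sigma> v) v" by blast
  define es where "es = map \<sigma> [0..<k] @ map (\<lambda>v. \<not> \<sigma> v) [0..<k]"
  have nth: "v < k \<Longrightarrow> es ! v = \<sigma> v" "v < k \<Longrightarrow> es ! (k + v) = (\<not> \<sigma> v)" for v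
    by (auto simp: es_def nth_append)
  have "\<exists>j<2 * k. clause_set k C j \<and> es ! j" if C: "C \<in> Cs" for C
  proof -
    obtain v where v: "v < k" "C (\<sigma> v) v" using \<sigma>[OF C] by blast
    show ?thesis
    proof (cases "\<sigma> v")
      case True
      then show ?thesis using v nth by (intro exI[of _ v]) (auto simp: clause_set_def)
    next
      case False
      then show ?thesis using v nth by (intro exI[of _ "k + v"]) (auto simp: clause_set_def)
    qed
  qed
  moreover have "\<exists>j<2 * k. (j = v \<or> j = k + v) \<and> \<not> es ! j" if "v < k" for v
    using nth[OF that] that by (cases "\<sigma> v") (auto intro: exI[of _ v] exI[of _ "k + v"])
  moreover have "length es = 2 * k" by (simp add: es_def)
  ultimately show "\<exists>es. length es = 2 * k \<and> (\<forall>S\<in>clause_set k ` Cs. \<exists>j<2 * k. S j \<and> es ! j) \<and>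
      (\<forall>S\<in>(\<lambda>v q. q = v \<or> q = k + v) ` {..<k}. \<exists>j<2 * k. S j \<and> \<not> es ! j)"
    by (intro exI[of _ es]) auto
qed

text \<open>Finitely many schemes with three parameters each suffice for a tableau. Inside the
  encoding of a structure the column and the row of the transition matrix are entries 0 and 1 of the
  stack, so the parameters appear as entries 4, 3 and 2.\<close>

lemma clauses_reducible:
  fixes T :: "(bool list \<Rightarrow> nat \<Rightarrow> nat \<Rightarrow> nat \<Rightarrow> bool \<Rightarrow> nat \<Rightarrow> bool) list"
  assumes X: "Temporal Next \<in> Ut"
    and k: "pn (\<lambda>ws ns. k (word ws 0))" and m: "pn (\<lambda>ws ns. m (word ws 0))"
    and T: "\<And>C b F. C \<in> set T \<Longrightarrow> pn F \<Longrightarrow> pb (\<lambda>ws ns. C (word ws 0) (ns 4) (ns 3) (ns 2) b (F ws ns))"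
    and L: "\<And>x. x \<in> L \<longleftrightarrow> (\<exists>\<sigma>. \<forall>C\<in>set T. \<forall>h<m x. \<forall>i<m x. \<forall>j<m x. \<exists>v<k x. C x h i j (\<sigma> v) v)"
  shows "poly_reducible L (CTL_Learn Ut Bl n)"
proof -
  define D where "D x = 2 * k x" for x
  define cls where "cls x = concat (map (\<lambda>C. concat (map (\<lambda>h. concat (map (\<lambda>i. map (\<lambda>j. C x h i j) [0..<m x]) [0..<m x])) [0..<m x])) T)" for x
  define Ps where "Ps x = chain (D x) 1 # map (\<lambda>C. branching (D x) True (clause_set (k x) C)) (cls x)" for x
  define Ns where "Ns x = chain (D x) 0 # map (\<lambda>v. branching (D x) False (\<lambda>q. q = v \<or> q = k x + v)) [0..<k x]" for x
  define f where "f x = encode_instance 1 (Ps x) (Ns x) (D x + 1)" for x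
  have ball_cls: "(\<forall>C\<in>set (cls x). P C) \<longleftrightarrow> (\<forall>C\<in>set T. \<forall>h<m x. \<forall>i<m x. \<forall>j<m x. P (C x h i j))" for x P
    by (simp add: cls_def atLeast0LessThan lessThan_def)
  have "x \<in> L \<longleftrightarrow> f x \<in> CTL_Learn Ut Bl n" for x
  proof -
    have "f x \<in> CTL_Learn Ut Bl n \<longleftrightarrow> ctl_learn Ut Bl n {..<1} (set (Ps x)) (set (Ns x)) (D x + 1)"
      unfolding f_def by (rule encode_in_CTL_Learn) (auto simp: Ps_def Ns_def valid_chain valid_branching simp del: One_nat_def)
    also have "\<dots> \<longleftrightarrow> ctl_learn Ut Bl n {..<1} (insert (chain (D x) 1) (branching (D x) True ` (clause_set (k x) ` set (cls x))))
       (insert (chain (D x) 0) (branching (D x) False ` ((\<lambda>v q. q = v \<or> q = k x + v) ` {..<k x}))) (D x + 1)"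
      by (simp add: Ps_def Ns_def image_image lessThan_atLeast0)
    also have "\<dots> \<longleftrightarrow> (\<exists>\<sigma>. \<forall>C\<in>set (cls x). \<exists>v<k x. C (\<sigma> v) v)"
      unfolding ctl_learn_assignment[OF X] unfolding D_def by (rule assignment_iff)
    also have "\<dots> \<longleftrightarrow> x \<in> L" unfolding L ball_cls ..
    finally show ?thesis by simp
  qed
  moreover have "polytime 1 (\<lambda>xs. f (word (rotate1 xs) 0))"
  proof (rule polytime_pw[where F = "\<lambda>ws ns. f (word ws 0)"])
    have lens: "length (Ps x) = Suc (length T * (m x * (m x * m x)))" "length (Ns x) = Suc (k x)" for x
      by (auto simp: Ps_def Ns_def cls_def length_concat_const)
    have pwB: "pw (\<lambda>ws ns. encode_kripke (branching (2 * k (word ws 0)) b (\<lambda>q. S ws ns q)))"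
      if "pb (\<lambda>ws ns. S ws (\<lambda>i. ns (Suc (Suc i))) (ns (Suc 0)))" for S b
    proof -
      have 1: "pb (\<lambda>ws ns. if b then ns 0 = 2 * k (word ws 0) + 1 else ns 0 = 2 * k (word ws 0))"
        by (cases b) (simp_all only: if_True if_False, (intro pn_intros k)+)
      \<comment> \<open>The conditional between truth values is expressed by connectives, for which
        \<open>pb\<close> has closure rules.\<close>
      have e: "(if q < d then r = q + 1 \<or> (r = d + 1 \<and> s) else r = q) = ((q < d \<longrightarrow> r = q + 1 \<or> (r = d + 1 \<and> s)) \<and> (q < d \<or> r = q))"
        for q r d :: nat and s by auto
      show ?thesis
        unfolding branching_def encode_mk_kripke e by (intro pw_intros pn_intros k 1 that)
    qed
    have pwC: "pw (\<lambda>ws ns. encode_kripke (chain (2 * k (word ws 0)) i))" for i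
      unfolding chain_def encode_mk_kripke min_def by (intro pw_intros pn_intros k)
    have P: "concat (map encode_kripke (Ps x)) = encode_kripke (chain (2 * k x) 1) @
      concat (map (\<lambda>C. concat (map (\<lambda>h. concat (map (\<lambda>i. concat (map (\<lambda>j.
        encode_kripke (branching (2 * k x) True (clause_set (k x) (C x h i j)))) [0..<m x])) [0..<m x])) [0..<m x])) T)" for x
      by (simp add: Ps_def cls_def D_def concat_map_concat o_def)
    have N: "concat (map encode_kripke (Ns x)) = encode_kripke (chain (2 * k x) 0) @
      concat (map (\<lambda>v. encode_kripke (branching (2 * k x) False (\<lambda>q. q = v \<or> q = k x + v))) [0..<k x])" for x
      by (simp add: Ns_def D_def o_def)
    have pwS: "pw (\<lambda>ws ns. encode_kripke (branching (2 * k (word ws 0)) True (clause_set (k (word ws 0)) (C (word ws 0) (ns 2) (ns 1) (ns 0)))))"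
      if C: "C \<in> set T" for C
    proof -
      have "pw (\<lambda>ws ns. encode_kripke (branching (2 * k (word ws 0)) True (\<lambda>q. (\<lambda>ws ns q. clause_set (k (word ws 0)) (C (word ws 0) (ns 2) (ns 1) (ns 0)) q) ws ns q)))"
      proof (rule pwB)
        have n: "Suc (Suc 2) = 4" "Suc (Suc 1) = 3" "Suc (Suc 0) = 2" by simp_all
        show "pb (\<lambda>ws ns. clause_set (k (word ws 0)) (C (word ws 0) (ns (Suc (Suc 2))) (ns (Suc (Suc 1))) (ns (Suc (Suc 0)))) (ns (Suc 0)))"
          unfolding clause_set_def n by (intro pn_intros k T[OF C])
      qed
      then show ?thesis by simp
    qed
    show "pw (\<lambda>ws ns. f (word ws 0))"
      unfolding f_def encode_instance_def encode_kripkes_def lens P N D_def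
    proof (intro pw_append pw_unary pn_intros k m pwC pw_concat pw_concat_list)
      fix C assume C: "C \<in> set T"
      show "pw (\<lambda>ws ns. encode_kripke (branching (2 * k (word ws 0)) True (clause_set (k (word ws 0)) (C (word ws 0) (ns (Suc (Suc 0))) (ns (Suc 0)) (ns 0)))))"
        using pwS[OF C] by (simp add: numeral_2_eq_2)
    next
      show "pw (\<lambda>ws ns. encode_kripke (branching (2 * k (word ws 0)) False (\<lambda>q. q = ns 0 \<or> q = k (word ws 0) + ns 0)))"
        using pwB[where b = False and S = "\<lambda>ws ns q. q = ns 0 \<or> q = k (word ws 0) + ns 0"] by (simp add: pn_intros k)
    qed
  qed simp
  ultimately show ?thesis
    unfolding poly_reducible_def by (intro exI[of _ "\<lambda>xs. f (word (rotate1 xs) 0)"]) (simp add: word_def)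
qed

section \<open>The tableau of a Turing machine\<close>

text \<open>Positions in the tableau are offset so that a head that still has to move never stands
  at 0; the truncated subtraction is then exact.\<close>

fun shift :: "nat \<Rightarrow> move \<Rightarrow> nat" where
  "shift p MoveLeft = p - 1"
| "shift p Stay = p"
| "shift p MoveRight = p + 1"

lemma pn_shift: "pn F \<Longrightarrow> pn (\<lambda>ws ns. shift (F ws ns) d)"
  by (cases d) (simp_all only: shift.simps, (intro pn_intros; assumption)+)

text \<open>At the halting state \<open>nst\<close> and \<open>nac\<close> mirror
  \<open>step\<close>, which leaves the configuration unchanged. So every run can be continued up to
  a common time.\<close>

definition nst :: "tm \<Rightarrow> nat \<times> nat list \<Rightarrow> nat" where
  "nst M a = (if fst a < num_states M then fst (delta M (fst a) (snd a)) else fst a)"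

definition nac :: "tm \<Rightarrow> nat \<times> nat list \<Rightarrow> nat \<Rightarrow> nat \<times> move" where
  "nac M a i = (if fst a < num_states M then snd (delta M (fst a) (snd a)) ! i else (snd a ! i, Stay))"

text \<open>Everything the transition function sees. There are finitely many labels, so one variable
  per time and label expresses the whole local situation.\<close>

definition labels :: "tm \<Rightarrow> (nat \<times> nat list) set" where
  "labels M = {..num_states M} \<times> {rs. set rs \<subseteq> {..<num_syms M} \<and> length rs = num_tapes M}"

lemma finite_labels: "finite (labels M)"
  unfolding labels_def by (intro finite_cartesian_product finite_lists_length_eq) auto

definition good :: "tm \<Rightarrow> config \<Rightarrow> bool" where
  "good M cf \<longleftrightarrow> fst cf \<le> num_states M \<and> length (snd cf) = num_tapes M \<and>
     (\<forall>i<num_tapes M. \<forall>z. fst (snd cf ! i) z < num_syms M)"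

lemma good_read:
  assumes "good M cf" "T \<in> set (snd cf)"
  shows "read T < num_syms M"
proof -
  obtain i where i: "i < num_tapes M" "T = snd cf ! i" using assms by (metis good_def in_set_conv_nth)
  then show ?thesis using assms(1) unfolding good_def read_def by blast
qed

lemma good_label: "good M cf \<Longrightarrow> (fst cf, map read (snd cf)) \<in> labels M"
  using good_read[of M cf] by (auto simp: good_def labels_def)

lemma step_good:
  assumes "is_tm M" "good M cf"
  defines "a \<equiv> (fst cf, map read (snd cf))"
  shows "fst (step M cf) = nst M a" "\<And>i. i < num_tapes M \<Longrightarrow> snd (step M cf) ! i = act (nac M a i) (snd cf ! i)"
    "good M (step M cf)"
proof -
  obtain q Ts where cf: "cf = (q, Ts)" by (cases cf)
  have len: "length Ts = num_tapes M" using assms(2) by (simp add: good_def cf)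
  have f: "nst M a \<le> num_states M \<and> (\<forall>i<num_tapes M. fst (nac M a i) < num_syms M) \<and> fst (step M cf) = nst M a \<and>
    (\<forall>i<num_tapes M. snd (step M cf) ! i = act (nac M a i) (snd cf ! i)) \<and> length (snd (step M cf)) = num_tapes M"
  proof (cases "q < num_states M")
    case True
    obtain q' as where d: "delta M q (map read Ts) = (q', as)" by (cases "delta M q (map read Ts)")
    have "\<forall>s\<in>set (map read Ts). s < num_syms M"
      using good_read[OF assms(2)] by (auto simp: cf)
    then have "q' \<le> num_states M" "length as = num_tapes M" "\<forall>(s, d)\<in>set as. s < num_syms M"
      using assms(1) True d len unfolding is_tm_def by (metis length_map)+
    then show ?thesis using True d len by (auto simp: step_def cf a_def nst_def nac_def case_prod_beta)
  next
    case False
    have "fst (Ts ! i) z < num_syms M" if "i < num_tapes M" for i z using assms(2) that by (auto simp: good_def cf)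
    then have "read (Ts ! i) < num_syms M" if "i < num_tapes M" for i using that by (simp add: read_def)
    then show ?thesis using False assms(2) len by (auto simp: step_def cf a_def nst_def nac_def act_stay good_def)
  qed
  then show "fst (step M cf) = nst M a" "\<And>i. i < num_tapes M \<Longrightarrow> snd (step M cf) ! i = act (nac M a i) (snd cf ! i)" by auto
  show "good M (step M cf)"
    using f assms(2) by (auto simp: good_def act_def)
qed

locale tableau =
  fixes M :: tm and TT qb :: "bool list \<Rightarrow> nat" and labs :: "(nat \<times> nat list) list"
  assumes tm: "is_tm M" and two: "2 \<le> num_tapes M" and labs: "set labs = labels M"
    and qb: "\<And>x. qb x \<le> TT x"
begin

abbreviation "kt \<equiv> num_tapes M"
abbreviation "sy \<equiv> num_syms M"
abbreviation "nl \<equiv> length labs"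

text \<open>A mixed radix numbering. Heads stay within distance \<open>TT x\<close> of cell 0, so
  \<open>2 * TT x + 3\<close> positions leave a spare cell on either side. The kind \<open>i\<close>
  has \<open>kt\<close> values for the cells, one for the control and \<open>kt\<close> for the
  heads; the last digit is a label or a symbol.\<close>

definition enc :: "bool list \<Rightarrow> nat \<Rightarrow> nat \<Rightarrow> nat \<Rightarrow> nat \<Rightarrow> nat" where
  "enc x t p i s = ((t * (2 * TT x + 3) + p) * (2 * kt + 1) + i) * (nl + sy) + s"

definition nvars :: "bool list \<Rightarrow> nat" where
  "nvars x = (TT x + 1) * (2 * TT x + 3) * (2 * kt + 1) * (nl + sy)"

text \<open>Variables: the control is in label \<open>a\<close> at time \<open>t\<close>; the head of tape \<open>i\<close> is at position \<open>p\<close>;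
  the cell \<open>p\<close> of tape \<open>i\<close> contains \<open>s\<close>. Cell 0 of a tape has position \<open>TT x + 1\<close>.\<close>

abbreviation "vC x t a \<equiv> enc x t 0 kt a"
abbreviation "vH x t i p \<equiv> enc x t p (kt + 1 + i) 0"
abbreviation "vE x t i p s \<equiv> enc x t p i s"

text \<open>On tape 1 the first \<open>qb x\<close> cells are left open, so that an assignment
  guesses the certificate; all other initial cells are determined.\<close>

definition isym :: "bool list \<Rightarrow> nat \<Rightarrow> nat \<Rightarrow> nat \<Rightarrow> bool" where
  "isym x i p s \<longleftrightarrow>
     i = 0 \<and> (s = 2 \<and> TT x + 1 \<le> p \<and> bit x (p - (TT x + 1)) \<or>
        s = 1 \<and> TT x + 1 \<le> p \<and> p - (TT x + 1) < length x \<and> \<not> bit x (p - (TT x + 1)) \<or>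
        s = 0 \<and> (p < TT x + 1 \<or> length x \<le> p - (TT x + 1))) \<or>
     i = 1 \<and> (s = 0 \<or> TT x + 1 \<le> p \<and> p < TT x + 1 + qb x) \<or> 2 \<le> i \<and> s = 0"

type_synonym clause = "bool list \<Rightarrow> nat \<Rightarrow> nat \<Rightarrow> nat \<Rightarrow> bool \<Rightarrow> nat \<Rightarrow> bool"

text \<open>All schemes share parameter ranges of size \<open>2 * TT x + 3\<close>. Disjuncts such
  as \<open>TT x < t\<close> hold for every variable and make the surplus instances trivially
  true.\<close>

definition cLabel :: clause where
  "cLabel x t p p' b v \<longleftrightarrow> TT x < t \<or> b \<and> (\<exists>a\<in>{..<nl}. v = vC x t a)"
definition cStart :: "nat \<Rightarrow> clause" where
  "cStart a x t p p' b v \<longleftrightarrow> \<not> b \<and> v = vC x 0 a"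
definition cHead :: "nat \<Rightarrow> clause" where
  "cHead i x t p p' b v \<longleftrightarrow> b \<and> v = vH x 0 i (TT x + 1)"
definition cCell :: "nat \<Rightarrow> clause" where
  "cCell i x t p p' b v \<longleftrightarrow> b \<and> (\<exists>s\<in>{..<3}. v = vE x 0 i p s \<and> isym x i p s)"
text \<open>A blank in the guessed zone forces a blank to its right, so the guess is a word followed
  by blanks only.\<close>

definition cBlank :: clause where
  "cBlank x t p p' b v \<longleftrightarrow> p < TT x + 1 \<or> TT x + 1 + qb x \<le> p \<or> \<not> b \<and> v = vE x 0 1 p 0 \<or> b \<and> v = vE x 0 1 (p + 1) 0"
definition cRead :: "nat \<Rightarrow> nat \<Rightarrow> nat \<Rightarrow> clause" where
  "cRead a i s x t p p' b v \<longleftrightarrow> TT x < t \<or> \<not> b \<and> (v = vC x t a \<or> v = vH x t i p \<or> v = vE x t i p s)"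
definition cNext :: "nat \<Rightarrow> nat \<Rightarrow> clause" where
  "cNext a a' x t p p' b v \<longleftrightarrow> TT x \<le> t \<or> \<not> b \<and> (v = vC x t a \<or> v = vC x (t + 1) a')"
definition cMove :: "nat \<Rightarrow> nat \<Rightarrow> clause" where
  "cMove a i x t p p' b v \<longleftrightarrow> TT x \<le> t \<or> \<not> b \<and> (v = vC x t a \<or> v = vH x t i p) \<or>
     b \<and> v = vH x (t + 1) i (shift p (snd (nac M (labs ! a) i)))"
definition cWrite :: "nat \<Rightarrow> nat \<Rightarrow> clause" where
  "cWrite a i x t p p' b v \<longleftrightarrow> TT x \<le> t \<or> \<not> b \<and> (v = vC x t a \<or> v = vH x t i p) \<or>
     b \<and> v = vE x (t + 1) i p (fst (nac M (labs ! a) i))"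
definition cKeep :: "nat \<Rightarrow> nat \<Rightarrow> clause" where
  "cKeep i s x t p p' b v \<longleftrightarrow> TT x \<le> t \<or> p = p' \<or> \<not> b \<and> (v = vH x t i p' \<or> v = vE x t i p s) \<or> b \<and> v = vE x (t + 1) i p s"
text \<open>Together with \<open>cEnd\<close> this expresses the result \<open>[True]\<close>:
  symbol 2 under the head of tape 0 and a blank next to it.\<close>

definition cAccept :: "nat \<Rightarrow> clause" where
  "cAccept a x t p p' b v \<longleftrightarrow> \<not> b \<and> v = vC x (TT x) a"
definition cEnd :: "nat \<Rightarrow> clause" where
  "cEnd s x t p p' b v \<longleftrightarrow> \<not> b \<and> (v = vH x (TT x) 0 p \<or> v = vE x (TT x) 0 (p + 1) s)"

text \<open>Given the certificate the run is deterministic, so the clauses only have to make the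
  variables of the run true; nothing excludes further true head or cell variables. For labels it is
  different: one has to be true at each time, and \<open>cStart\<close>, \<open>cNext\<close> and
  \<open>cRead\<close> exclude the wrong ones.\<close>

definition clauses :: "clause set" where
  "clauses = {cLabel, cBlank} \<union> cStart ` {a. a < nl \<and> fst (labs ! a) \<noteq> 0} \<union> cHead ` {..<kt} \<union> cCell ` {..<kt} \<union>
     (\<Union>a\<in>{..<nl}. \<Union>i\<in>{..<kt}. cRead a i ` {s. s < sy \<and> s \<noteq> snd (labs ! a) ! i}) \<union>
     (\<Union>a\<in>{..<nl}. cNext a ` {a'. a' < nl \<and> fst (labs ! a') \<noteq> nst M (labs ! a)}) \<union>
     (\<Union>a\<in>{..<nl}. cMove a ` {..<kt}) \<union> (\<Union>a\<in>{..<nl}. cWrite a ` {..<kt}) \<union>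
     (\<Union>i\<in>{..<kt}. cKeep i ` {..<sy}) \<union>
     cAccept ` {a. a < nl \<and> (fst (labs ! a) \<noteq> num_states M \<or> snd (labs ! a) ! 0 \<noteq> 2)} \<union> cEnd ` {s. 0 < s \<and> s < sy}"

lemma finite_clauses: "finite clauses"
  unfolding clauses_def by simp

lemma pb_clauses:
  assumes T: "pn (\<lambda>ws ns. TT (word ws 0))" and q: "pn (\<lambda>ws ns. qb (word ws 0))" and F: "pn F" and C: "C \<in> clauses"
  shows "pb (\<lambda>ws ns. C (word ws 0) (ns 4) (ns 3) (ns 2) b (F ws ns))"
proof -
  note i = pn_intros T q F pn_shift pb_bex finite_lessThan
  from C consider "C = cLabel" | "C = cBlank" | a where "C = cStart a" | i where "C = cHead i" | i where "C = cCell i"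
    | a i s where "C = cRead a i s" | a a' where "C = cNext a a'" | a i where "C = cMove a i" | a i where "C = cWrite a i"
    | i s where "C = cKeep i s" | a where "C = cAccept a" | s where "C = cEnd s"
    unfolding clauses_def by blast
  then show ?thesis
  proof cases
    case 1 show ?thesis unfolding 1 cLabel_def enc_def by (intro i)
  next
    case 2 show ?thesis unfolding 2 cBlank_def enc_def by (intro i)
  next
    case 3 show ?thesis unfolding 3 cStart_def enc_def by (intro i)
  next
    case 4 show ?thesis unfolding 4 cHead_def enc_def by (intro i)
  next
    case 5 show ?thesis unfolding 5 cCell_def enc_def isym_def by (intro i)
  next
    case 6 show ?thesis unfolding 6 cRead_def enc_def by (intro i)
  next
    case 7 show ?thesis unfolding 7 cNext_def enc_def by (intro i)
  next
    case 8 show ?thesis unfolding 8 cMove_def enc_def by (intro i)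
  next
    case 9 show ?thesis unfolding 9 cWrite_def enc_def by (intro i)
  next
    case 10 show ?thesis unfolding 10 cKeep_def enc_def by (intro i)
  next
    case 11 show ?thesis unfolding 11 cAccept_def enc_def by (intro i)
  next
    case 12 show ?thesis unfolding 12 cEnd_def enc_def by (intro i)
  qed
qed

lemma pn_nvars: "pn (\<lambda>ws ns. TT (word ws 0)) \<Longrightarrow> pn (\<lambda>ws ns. nvars (word ws 0))"
  unfolding nvars_def by (intro pn_intros; assumption?)

lemma enc_less:
  "t \<le> TT x \<Longrightarrow> p < 2 * TT x + 3 \<Longrightarrow> i < 2 * kt + 1 \<Longrightarrow> s < nl + sy \<Longrightarrow> enc x t p i s < nvars x"
  unfolding enc_def nvars_def by (intro radix_less) auto

lemma enc_eq:
  assumes "enc x t p i s = enc x t' p' i' s'" "p < 2 * TT x + 3" "i < 2 * kt + 1" "s < nl + sy"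
    "p' < 2 * TT x + 3" "i' < 2 * kt + 1" "s' < nl + sy"
  shows "t = t' \<and> p = p' \<and> i = i' \<and> s = s'"
  using assms radix_div radix_mod unfolding enc_def by metis

section \<open>The actual run of the machine\<close>

definition conf :: "bool list \<Rightarrow> bool list \<Rightarrow> nat \<Rightarrow> config" where
  "conf x c t = (step M ^^ t) (start_config M [x, c])"

definition lab :: "bool list \<Rightarrow> bool list \<Rightarrow> nat \<Rightarrow> nat \<times> nat list" where
  "lab x c t = (fst (conf x c t), map read (snd (conf x c t)))"

definition head :: "bool list \<Rightarrow> bool list \<Rightarrow> nat \<Rightarrow> nat \<Rightarrow> int" where
  "head x c t i = snd (snd (conf x c t) ! i)"

definition cell :: "bool list \<Rightarrow> bool list \<Rightarrow> nat \<Rightarrow> nat \<Rightarrow> int \<Rightarrow> nat" where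
  "cell x c t i = fst (snd (conf x c t) ! i)"

definition accepts :: "bool list \<Rightarrow> bool list \<Rightarrow> bool" where
  "accepts x c \<longleftrightarrow> fst (conf x c (TT x)) = num_states M \<and> cell x c (TT x) 0 (head x c (TT x) 0) = 2 \<and>
     cell x c (TT x) 0 (head x c (TT x) 0 + 1) = 0"

lemma syms: "3 \<le> sy"
  using tm by (simp add: is_tm_def)

lemma conf_Suc: "conf x c (Suc t) = step M (conf x c t)"
  by (simp add: conf_def)

lemma start_tape:
  assumes "i < kt"
  shows "snd (start_config M [x, c]) ! i = word_tape (if i = 0 then x else if i = 1 then c else [])"
  using assms two by (auto simp: start_config_def nth_Cons split: nat.split)

lemma conf_good: "good M (conf x c t)"
proof (induction t)
  case 0
  have "length (snd (start_config M [x, c])) = kt" using two by (simp add: start_config_def)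
  moreover have "fst (word_tape w) z < sy" for w z using syms by (simp add: word_tape_def sym_def)
  ultimately show ?case unfolding good_def conf_def using start_tape[of _ x c]
    by (simp add: start_config_def)
next
  case (Suc t)
  then show ?case using step_good(3)[OF tm] by (simp add: conf_Suc)
qed

lemma start_cell:
  assumes "i < kt"
  shows "head x c 0 i = 0" "cell x c 0 i z = (let w = if i = 0 then x else if i = 1 then c else [] in
     if 0 \<le> z \<and> z < int (length w) then sym (w ! nat z) else 0)"
  using start_tape[OF assms, of x c] by (auto simp: head_def cell_def conf_def word_tape_def Let_def)

lemma conf_step:
  assumes "i < kt"
  shows "fst (conf x c (Suc t)) = nst M (lab x c t)"
    "head x c (Suc t) i = head x c t i + offset (snd (nac M (lab x c t) i))"
    "cell x c (Suc t) i = (cell x c t i)(head x c t i := fst (nac M (lab x c t) i))"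
  using step_good(1,2)[OF tm conf_good[of x c t]] assms
  by (auto simp: lab_def head_def cell_def conf_Suc act_def)

lemma head_bound: "i < kt \<Longrightarrow> \<bar>head x c t i\<bar> \<le> int t"
proof (induction t)
  case (Suc t)
  have "\<bar>offset d\<bar> \<le> 1" for d by (cases d) auto
  from this[of "snd (nac M (lab x c t) i)"]
  have "\<bar>head x c t i + offset (snd (nac M (lab x c t) i))\<bar> \<le> int t + 1"
    using Suc.IH[OF Suc.prems] by linarith
  then show ?case using conf_step(2)[OF Suc.prems, of x c t] by simp
qed (simp add: start_cell)

lemma lab_in: "\<exists>a<nl. labs ! a = lab x c t"
  using good_label[OF conf_good[of x c t]] labs unfolding lab_def by (metis in_set_conv_nth)

lemma lab_read: "i < kt \<Longrightarrow> snd (lab x c t) ! i = cell x c t i (head x c t i)"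
  using conf_good[of x c t] by (simp add: lab_def good_def cell_def head_def read_def)

lemma cell_less: "i < kt \<Longrightarrow> cell x c t i z < sy"
  using conf_good[of x c t] by (simp add: cell_def good_def)

lemma labs_label: "a < nl \<Longrightarrow> length (snd (labs ! a)) = kt"
  using labs nth_mem[of a labs] by (auto simp: labels_def)

definition satisfies :: "bool list \<Rightarrow> (nat \<Rightarrow> bool) \<Rightarrow> bool" where
  "satisfies x \<sigma> \<longleftrightarrow> (\<forall>C\<in>clauses. \<forall>t<2 * TT x + 3. \<forall>p<2 * TT x + 3. \<forall>p'<2 * TT x + 3. \<exists>v<nvars x. C x t p p' (\<sigma> v) v)"

text \<open>The certificate is read off the initial cells of tape 1, and induction on the time shows
  that the variables describing the run on it are true.\<close>

lemma satisfies_accepts: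
  assumes "satisfies x \<sigma>"
  shows "\<exists>c. length c \<le> qb x \<and> accepts x c"
proof -
  define T where "T = TT x"
  define W where "W = 2 * T + 3"
  have S: "\<exists>v<nvars x. C x t p p' (\<sigma> v) v" if "C \<in> clauses" "t < W" "p < W" "p' < W" for C t p p'
    using assms that unfolding satisfies_def W_def T_def by blast
  have W0: "0 < W" by (simp add: W_def)
  have Label: "\<exists>a<nl. \<sigma> (vC x t a)" if "t \<le> T" for t
    using S[of cLabel t 0 0] that by (auto simp: clauses_def cLabel_def T_def W_def)
  have Start: "fst (labs ! a) = 0" if "a < nl" "\<sigma> (vC x 0 a)" for a
  proof (rule ccontr)
    assume "fst (labs ! a) \<noteq> 0"
    then have "cStart a \<in> cStart ` {a. a < nl \<and> fst (labs ! a) \<noteq> 0}" using that by blast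
    then have cl: "cStart a \<in> clauses" by (simp only: clauses_def Un_iff simp_thms)
    have w: "0 < W" by (auto simp: W_def)
    from S[OF cl W0 W0 W0] obtain v where "cStart a x 0 0 0 (\<sigma> v) v" by blast
    then show False using that by (auto simp: cStart_def)
  qed
  have Head: "\<sigma> (vH x 0 i (T + 1))" if "i < kt" for i
    using S[of "cHead i" 0 0 0] that by (auto simp: clauses_def cHead_def W_def T_def)
  have Cell: "\<exists>s<3. \<sigma> (vE x 0 i p s) \<and> isym x i p s" if "i < kt" "p < W" for i p
  proof -
    have "cCell i \<in> clauses" using that by (auto simp: clauses_def)
    from S[OF this _ that(2), of 0 0] show ?thesis by (auto simp: cCell_def W_def)
  qed
  have Blank: "\<sigma> (vE x 0 1 (p + 1) 0)" if "T + 1 \<le> p" "p < T + 1 + qb x" "p < W" "\<sigma> (vE x 0 1 p 0)" for p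
  proof -
    have "cBlank \<in> clauses" by (simp add: clauses_def)
    from S[OF this _ that(3), of 0 0] show ?thesis using that by (auto simp: cBlank_def W_def T_def)
  qed
  have Read: "s = snd (labs ! a) ! i" if "t \<le> T" "a < nl" "i < kt" "p < W" "s < sy" "\<sigma> (vC x t a)" "\<sigma> (vH x t i p)" "\<sigma> (vE x t i p s)"
    for a i s t p
  proof (rule ccontr)
    assume "s \<noteq> snd (labs ! a) ! i"
    then have "cRead a i s \<in> (\<Union>a\<in>{..<nl}. \<Union>i\<in>{..<kt}. cRead a i ` {s. s < sy \<and> s \<noteq> snd (labs ! a) ! i})" using that by blast
    then have cl: "cRead a i s \<in> clauses" by (simp only: clauses_def Un_iff simp_thms)
    have w: "t < W" "0 < W" using that by (auto simp: W_def)
    note p = that(4)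
    from S[OF cl w(1) p(1) W0] obtain v where "cRead a i s x t p 0 (\<sigma> v) v" by blast
    then show False using that by (auto simp: cRead_def T_def)
  qed
  have Next: "fst (labs ! a') = nst M (labs ! a)" if "t < T" "a < nl" "a' < nl" "\<sigma> (vC x t a)" "\<sigma> (vC x (Suc t) a')" for t a a'
  proof (rule ccontr)
    assume "fst (labs ! a') \<noteq> nst M (labs ! a)"
    then have "cNext a a' \<in> (\<Union>a\<in>{..<nl}. cNext a ` {a'. a' < nl \<and> fst (labs ! a') \<noteq> nst M (labs ! a)})" using that by blast
    then have cl: "cNext a a' \<in> clauses" by (simp only: clauses_def Un_iff simp_thms)
    have w: "t < W" "0 < W" using that by (auto simp: W_def)
    from S[OF cl w(1) W0 W0] obtain v where "cNext a a' x t 0 0 (\<sigma> v) v" by blast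
    then show False using that by (auto simp: cNext_def T_def)
  qed
  have Move: "\<sigma> (vH x (Suc t) i (shift p (snd (nac M (labs ! a) i))))" if "t < T" "a < nl" "i < kt" "p < W" "\<sigma> (vC x t a)" "\<sigma> (vH x t i p)"
    for t a i p
  proof -
    have "cMove a i \<in> (\<Union>a\<in>{..<nl}. cMove a ` {..<kt})" using that by blast
    then have cl: "cMove a i \<in> clauses" by (simp only: clauses_def Un_iff simp_thms)
    have w: "t < W" "0 < W" using that by (auto simp: W_def)
    note p = that(4)
    from S[OF cl w(1) p(1) W0] obtain v where "cMove a i x t p 0 (\<sigma> v) v" by blast
    then show ?thesis using that by (auto simp: cMove_def T_def)
  qed
  have Write: "\<sigma> (vE x (Suc t) i p (fst (nac M (labs ! a) i)))" if "t < T" "a < nl" "i < kt" "p < W" "\<sigma> (vC x t a)" "\<sigma> (vH x t i p)"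
    for t a i p
  proof -
    have "cWrite a i \<in> (\<Union>a\<in>{..<nl}. cWrite a ` {..<kt})" using that by blast
    then have cl: "cWrite a i \<in> clauses" by (simp only: clauses_def Un_iff simp_thms)
    have w: "t < W" "0 < W" using that by (auto simp: W_def)
    note p = that(4)
    from S[OF cl w(1) p(1) W0] obtain v where "cWrite a i x t p 0 (\<sigma> v) v" by blast
    then show ?thesis using that by (auto simp: cWrite_def T_def)
  qed
  have Keep: "\<sigma> (vE x (Suc t) i p s)" if "t < T" "i < kt" "s < sy" "p < W" "p' < W" "p \<noteq> p'" "\<sigma> (vH x t i p')" "\<sigma> (vE x t i p s)"
    for t i s p p'
  proof -
    have "cKeep i s \<in> (\<Union>i\<in>{..<kt}. cKeep i ` {..<sy})" using that by blast
    then have cl: "cKeep i s \<in> clauses" by (simp only: clauses_def Un_iff simp_thms)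
    have w: "t < W" using that by (auto simp: W_def)
    note p = that(4,5)
    from S[OF cl w(1) p(1) p(2)] obtain v where "cKeep i s x t p p' (\<sigma> v) v" by blast
    then show ?thesis using that by (auto simp: cKeep_def T_def)
  qed
  have Accept: "fst (labs ! a) = num_states M \<and> snd (labs ! a) ! 0 = 2" if "a < nl" "\<sigma> (vC x T a)" for a
  proof (rule ccontr)
    assume "\<not> ?thesis"
    then have "cAccept a \<in> cAccept ` {a. a < nl \<and> (fst (labs ! a) \<noteq> num_states M \<or> snd (labs ! a) ! 0 \<noteq> 2)}" using that by blast
    then have cl: "cAccept a \<in> clauses" by (simp only: clauses_def Un_iff simp_thms)
    have w: "0 < W" by (auto simp: W_def)
    from S[OF cl W0 W0 W0] obtain v where "cAccept a x 0 0 0 (\<sigma> v) v" by blast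
    then show False using that by (auto simp: cAccept_def T_def)
  qed
  have End: "s = 0" if "s < sy" "p < W" "\<sigma> (vH x T 0 p)" "\<sigma> (vE x T 0 (p + 1) s)" for s p
  proof (rule ccontr)
    assume "s \<noteq> 0"
    then have "cEnd s \<in> cEnd ` {s. 0 < s \<and> s < sy}" using that by blast
    then have cl: "cEnd s \<in> clauses" by (simp only: clauses_def Un_iff simp_thms)
    have w: "0 < W" by (auto simp: W_def)
    note p = that(2)
    from S[OF cl W0 p(1) W0] obtain v where "cEnd s x 0 p 0 (\<sigma> v) v" by blast
    then show False using that by (auto simp: cEnd_def T_def)
  qed
  have qbT: "qb x \<le> T" using qb by (simp add: T_def)
  \<comment> \<open>The end of the guessed word: its first blank, or \<open>qb x\<close> if the word
    fills the zone.\<close>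
  define len where "len = (LEAST j. j = qb x \<or> \<sigma> (vE x 0 1 (T + 1 + j) 0))"
  have len: "len = qb x \<or> \<sigma> (vE x 0 1 (T + 1 + len) 0)" unfolding len_def by (rule LeastI_ex) blast
  have len_le: "len \<le> qb x" unfolding len_def by (rule Least_le) simp
  have before: "\<not> \<sigma> (vE x 0 1 (T + 1 + j) 0)" if "j < len" for j using not_less_Least that unfolding len_def by blast
  \<comment> \<open>Both bit symbols of a cell may be true. Reading True whenever symbol 2 is true
    selects a symbol that is true in either case.\<close>
  define c where "c = map (\<lambda>j. \<sigma> (vE x 0 1 (T + 1 + j) 2)) [0..<len]"
  have c: "length c = len" by (simp add: c_def)
  have one: "1 < kt" using two by simp
  \<comment> \<open>Inside the zone blanks propagate by \<open>cBlank\<close>; behind it blank is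
    the only admissible initial symbol.\<close>
  have beyond: "\<sigma> (vE x 0 1 (T + 1 + j) 0)" if "len \<le> j" "T + 1 + j < W" for j
  proof (cases "j < qb x")
    case True
    then have l: "\<sigma> (vE x 0 1 (T + 1 + len) 0)" using len that(1) by auto
    show ?thesis using that(1) True
    proof (induction j rule: dec_induct)
      case base
      then show ?case using l by simp
    next
      case (step j)
      then show ?case using Blank[of "T + 1 + j"] qbT by (simp add: W_def)
    qed
  next
    case False
    then show ?thesis using Cell[OF one that(2)] by (auto simp: isym_def T_def)
  qed
  define pos where "pos t i = nat (head x c t i + int T + 1)" for t i
  have pos: "int (pos t i) = head x c t i + int T + 1" "1 \<le> pos t i" "pos t i + 1 < W" if "t \<le> T" "i < kt" for t i
    using head_bound[OF that(2), of x c t] that(1) by (auto simp: pos_def W_def)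
  \<comment> \<open>Heads and cells of the run are claimed to be true, labels off the run to be
    false; that some label is true at all comes from \<open>cLabel\<close>.\<close>
  have inv: "(\<forall>i<kt. \<sigma> (vH x t i (pos t i))) \<and> (\<forall>i<kt. \<forall>p<W. \<sigma> (vE x t i p (cell x c t i (int p - int T - 1)))) \<and>
     (\<forall>a<nl. \<sigma> (vC x t a) \<longrightarrow> labs ! a = lab x c t)" if "t \<le> T" for t
    using that
  proof (induction t)
    case 0
    have 1: "\<sigma> (vH x 0 i (pos 0 i))" if "i < kt" for i using Head[OF that] start_cell(1)[OF that] by (simp add: pos_def nat_add_distrib)
    have 2: "\<sigma> (vE x 0 i p (cell x c 0 i (int p - int T - 1)))" if i: "i < kt" and p: "p < W" for i p
    proof -
      obtain s where s: "s < 3" "\<sigma> (vE x 0 i p s)" "isym x i p s" using Cell[OF i p] by blast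
      show ?thesis
      proof (cases "p < T + 1")
        case True
        then have "s = 0" using s(3) by (auto simp: isym_def T_def)
        then show ?thesis using s True i by (simp add: start_cell Let_def)
      next
        case False
        then obtain j where j: "p = T + 1 + j" by (metis le_Suc_ex not_less)
        have z: "int p - int T - 1 = int j" by (simp add: j)
        consider "i = 0" | "i = 1" | "2 \<le> i" by linarith
        then show ?thesis
        proof cases
          case 1
          then have "cell x c 0 i (int j) = s" using s(3) i by (auto simp: start_cell isym_def bit_def sym_def j T_def)
          then show ?thesis using s(2) unfolding z by simp
        next
          case 2
          show ?thesis
          proof (cases "j < len")
            case True
            then have "s = 1 \<or> s = 2" using s before[OF True] 2 j by (auto simp: less_Suc_eq numeral_3_eq_3)
            moreover have "cell x c 0 i (int j) = sym (\<sigma> (vE x 0 1 (T + 1 + j) 2))" using True 2 i c by (simp add: start_cell c_def)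
            ultimately show ?thesis using s(2) 2 j unfolding z by (auto simp: sym_def)
          next
            case False
            then have "cell x c 0 i (int j) = 0" using 2 i c by (simp add: start_cell)
            then show ?thesis using beyond[of j] False p 2 unfolding z by (simp add: j)
          qed
        next
          case 3
          then have "s = 0" "cell x c 0 i (int j) = 0" using s(3) i by (auto simp: isym_def start_cell)
          then show ?thesis using s(2) unfolding z by simp
        qed
      qed
    qed
    have 3: "labs ! a = lab x c 0" if a: "a < nl" "\<sigma> (vC x 0 a)" for a
    proof (rule prod_eqI)
      show "fst (labs ! a) = fst (lab x c 0)" using Start[OF a] by (simp add: lab_def conf_def start_config_def)
      show "snd (labs ! a) = snd (lab x c 0)"
      proof (rule nth_equalityI)
        show "length (snd (labs ! a)) = length (snd (lab x c 0))"
          using labs_label[OF a(1)] conf_good[of x c 0] by (simp add: lab_def good_def)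
        fix i assume "i < length (snd (labs ! a))"
        then have i: "i < kt" using labs_label[OF a(1)] by simp
        have "head x c 0 i = int (pos 0 i) - int T - 1" using pos(1)[OF _ i, of 0] by simp
        then show "snd (labs ! a) ! i = snd (lab x c 0) ! i"
          using Read[OF _ a(1) i _ cell_less[OF i] a(2) 1[OF i] 2[OF i]] pos(3)[OF _ i, of 0] lab_read[OF i, of x c 0] by simp
      qed
    qed
    show ?case using 1 2 3 by blast
  next
    case (Suc t)
    then have t: "t < T" "t \<le> T" by auto
    obtain a where a: "a < nl" "\<sigma> (vC x t a)" using Label[OF t(2)] by blast
    have IH: "\<And>i. i < kt \<Longrightarrow> \<sigma> (vH x t i (pos t i))"
      "\<And>i p. i < kt \<Longrightarrow> p < W \<Longrightarrow> \<sigma> (vE x t i p (cell x c t i (int p - int T - 1)))"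
      "labs ! a = lab x c t" using Suc.IH[OF t(2)] a by auto
    have 1: "\<sigma> (vH x (Suc t) i (pos (Suc t) i))" if i: "i < kt" for i
    proof -
      have "shift (pos t i) d = nat (head x c t i + offset d + int T + 1)" for d
        using pos[OF t(2) i] by (cases d) auto
      then have "shift (pos t i) (snd (nac M (lab x c t) i)) = pos (Suc t) i"
        by (simp add: pos_def conf_step(2)[OF i])
      then show ?thesis using Move[OF t(1) a(1) i _ a(2) IH(1)[OF i]] pos(3)[OF t(2) i] IH(3) by simp
    qed
    have 2: "\<sigma> (vE x (Suc t) i p (cell x c (Suc t) i (int p - int T - 1)))" if i: "i < kt" and p: "p < W" for i p
    proof (cases "p = pos t i")
      case True
      then have "int p - int T - 1 = head x c t i" using pos(1)[OF t(2) i] by simp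
      then show ?thesis using Write[OF t(1) a(1) i p a(2)] IH(1)[OF i] IH(3) True by (simp add: conf_step(3)[OF i])
    next
      case False
      then have "int p - int T - 1 \<noteq> head x c t i" using pos(1)[OF t(2) i] by linarith
      then show ?thesis using Keep[OF t(1) i cell_less[OF i] p _ False IH(1)[OF i] IH(2)[OF i p]] pos(3)[OF t(2) i]
        by (simp add: conf_step(3)[OF i])
    qed
    \<comment> \<open>The state is fixed by the previous label, the scanned symbols by the cells at
      the new head positions.\<close>
    have 3: "labs ! a' = lab x c (Suc t)" if a': "a' < nl" "\<sigma> (vC x (Suc t) a')" for a'
    proof (rule prod_eqI)
      show "fst (labs ! a') = fst (lab x c (Suc t))"
        using Next[OF t(1) a(1) a'(1) a(2) a'(2)] conf_step(1)[OF one, of x c t] IH(3) by (simp add: lab_def)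
      show "snd (labs ! a') = snd (lab x c (Suc t))"
      proof (rule nth_equalityI)
        show "length (snd (labs ! a')) = length (snd (lab x c (Suc t)))"
          using labs_label[OF a'(1)] conf_good[of x c "Suc t"] by (simp add: lab_def good_def)
        fix i assume "i < length (snd (labs ! a'))"
        then have i: "i < kt" using labs_label[OF a'(1)] by simp
        have h: "head x c (Suc t) i = int (pos (Suc t) i) - int T - 1" using pos(1)[OF Suc.prems i] by simp
        have "cell x c (Suc t) i (int (pos (Suc t) i) - int T - 1) = snd (labs ! a') ! i"
          using Read[OF Suc.prems a'(1) i _ cell_less[OF i] a'(2) 1[OF i] 2[OF i]] pos(3)[OF Suc.prems i] by simp
        then show "snd (labs ! a') ! i = snd (lab x c (Suc t)) ! i" using lab_read[OF i, of x c "Suc t"] h by simp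
      qed
    qed
    show ?case using 1 2 3 by blast
  qed
  have k0: "0 < kt" using two by simp
  obtain a where a: "a < nl" "\<sigma> (vC x T a)" using Label by blast
  then have l: "labs ! a = lab x c T" using inv by blast
  have h: "int (pos T 0 + 1) - int T - 1 = head x c T 0 + 1" using pos(1)[OF _ k0, of T] by simp
  have "\<sigma> (vE x T 0 (pos T 0 + 1) (cell x c T 0 (int (pos T 0 + 1) - int T - 1)))"
    using inv[of T] k0 pos(3)[OF _ k0, of T] by blast
  then have "\<sigma> (vE x T 0 (pos T 0 + 1) (cell x c T 0 (head x c T 0 + 1)))" unfolding h .
  moreover have "\<sigma> (vH x T 0 (pos T 0))" using inv[of T] k0 by blast
  moreover have "pos T 0 < W" using pos(3)[OF _ k0, of T] by simp
  ultimately have "cell x c T 0 (head x c T 0 + 1) = 0" by (intro End[OF cell_less[OF k0]])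
  moreover have "fst (conf x c T) = num_states M" "cell x c T 0 (head x c T 0) = 2"
    using Accept[OF a] l lab_read[OF k0, of x c T] by (auto simp: lab_def)
  ultimately show ?thesis using len_le c by (intro exI[of _ c]) (simp add: accepts_def T_def)
qed

lemma clauses_cases:
  assumes "C \<in> clauses"
  obtains "C = cLabel" | "C = cBlank" | a where "a < nl" "fst (labs ! a) \<noteq> 0" "C = cStart a"
      | i where "i < kt" "C = cHead i" | i where "i < kt" "C = cCell i"
      | a i s where "a < nl" "i < kt" "s < sy" "s \<noteq> snd (labs ! a) ! i" "C = cRead a i s"
      | a a' where "a < nl" "a' < nl" "fst (labs ! a') \<noteq> nst M (labs ! a)" "C = cNext a a'"
      | a i where "a < nl" "i < kt" "C = cMove a i" | a i where "a < nl" "i < kt" "C = cWrite a i"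
      | i s where "i < kt" "s < sy" "C = cKeep i s"
      | a where "a < nl" "fst (labs ! a) \<noteq> num_states M \<or> snd (labs ! a) ! 0 \<noteq> 2" "C = cAccept a"
      | s where "0 < s" "s < sy" "C = cEnd s"
proof -
  note i = lessThan_iff[THEN iffD1]
  show thesis
    by (insert assms[unfolded clauses_def], elim UnE UN_E imageE insertE emptyE CollectE conjE,
        (rule that(1); (assumption | erule i)),
        (rule that(2); (assumption | erule i)),
        (rule that(3); (assumption | erule i)),
        (rule that(4); (assumption | erule i)),
        (rule that(5); (assumption | erule i)),
        (rule that(6); (assumption | erule i)),
        (rule that(7); (assumption | erule i)),
        (rule that(8); (assumption | erule i)),
        (rule that(9); (assumption | erule i)),
        (rule that(10); (assumption | erule i)),
        (rule that(11); (assumption | erule i)),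
        (rule that(12); (assumption | erule i)))
qed

text \<open>A variable is made true iff what it stands for holds in the run; \<open>enc\<close> is
  injective on the relevant range, so this is well defined.\<close>

lemma accepts_satisfies:
  assumes c: "length c \<le> qb x" and acc: "accepts x c"
  shows "\<exists>\<sigma>. satisfies x \<sigma>"
proof -
  define T where "T = TT x"
  define W where "W = 2 * T + 3"
  \<comment> \<open>The kind \<open>i\<close> is decoded: below \<open>kt\<close> a cell, at
    \<open>kt\<close> the control, above it a head.\<close>
  define truth where "truth t p i s \<longleftrightarrow> (if i < kt then cell x c t i (int p - int T - 1) = s
     else if i = kt then p = 0 \<and> s < nl \<and> labs ! s = lab x c t
     else s = 0 \<and> head x c t (i - kt - 1) = int p - int T - 1)" for t p i s
  define \<sigma> where "\<sigma> v \<longleftrightarrow> (\<exists>t p i s. t \<le> T \<and> p < W \<and> i < 2 * kt + 1 \<and> s < nl + sy \<and> v = enc x t p i s \<and> truth t p i s)" for v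
  have enc: "\<sigma> (enc x t p i s) = truth t p i s" if "t \<le> T" "p < W" "i < 2 * kt + 1" "s < nl + sy" for t p i s
    unfolding \<sigma>_def using that enc_eq[of x t p i s] unfolding W_def T_def by blast
  have rng: "enc x t p i s < nvars x" if "t \<le> T" "p < W" "i < 2 * kt + 1" "s < nl + sy" for t p i s
    using enc_less that unfolding W_def T_def by blast
  have k0: "0 < kt" "1 < kt" using two by auto
  have W0: "0 < W" by (simp add: W_def)
  have sC: "\<sigma> (vC x t a) = (labs ! a = lab x c t)" "vC x t a < nvars x" if "t \<le> T" "a < nl" for t a
    using enc[of t 0 kt a] rng[of t 0 kt a] that W0 k0 by (auto simp: truth_def)
  have sH: "\<sigma> (vH x t i p) = (head x c t i = int p - int T - 1)" "vH x t i p < nvars x" if "t \<le> T" "i < kt" "p < W" for t i p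
    using enc[of t p "kt + 1 + i" 0] rng[of t p "kt + 1 + i" 0] that syms by (auto simp: truth_def)
  have sE: "\<sigma> (vE x t i p s) = (cell x c t i (int p - int T - 1) = s)" "vE x t i p s < nvars x"
    if "t \<le> T" "i < kt" "p < W" "s < sy" for t i p s
    using enc[of t p i s] rng[of t p i s] that by (auto simp: truth_def)
  have n0: "0 < nvars x" using rng[of 0 0 0 0] W0 k0 syms by simp
  \<comment> \<open>Up to time \<open>T\<close> a head keeps one cell of distance to both ends of
    the window, so its neighbours still have positions.\<close>
  have bound: "1 \<le> p" "p + 1 < W" if "head x c t i = int p - int T - 1" "t \<le> T" "i < kt" for t i p
    using head_bound[OF that(3), of x c t] that by (auto simp: W_def)
  have qbT: "qb x \<le> T" using qb by (simp add: T_def)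
  have "\<exists>v<nvars x. C x t p p' (\<sigma> v) v" if C: "C \<in> clauses" and t: "t < W" and p: "p < W" and p': "p' < W" for C t p p'
  proof (rule ccontr)
    assume "\<not> ?thesis"
    \<comment> \<open>In a violated instance the negative literals give facts about the run, which
      contradict the failure of the positive literal or the side condition of the scheme.\<close>
    then have N: "\<And>v. v < nvars x \<Longrightarrow> \<not> C x t p p' (\<sigma> v) v" by blast
    from C show False
    proof (cases rule: clauses_cases)
      case 1
      have "t \<le> T" using N[OF n0] by (auto simp: 1 cLabel_def T_def)
      moreover obtain a where "a < nl" "labs ! a = lab x c t" using lab_in by blast
      ultimately show False using N[of "vC x t a"] sC[of t a] by (auto simp: 1 cLabel_def)
    next
      case 2
      have g: "T + 1 \<le> p" "p < T + 1 + qb x" using N[OF n0] by (auto simp: 2 cBlank_def T_def)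
      have p1: "p + 1 < W" using g qbT by (simp add: W_def)
      have s0: "0 < sy" using syms by simp
      have "\<sigma> (vE x 0 1 p 0)" using N[OF sE(2)[OF _ k0(2) p s0]] by (auto simp: 2 cBlank_def)
      then have "cell x c 0 1 (int p - int T - 1) = 0" using sE(1)[OF _ k0(2) p s0] by simp
      then have "cell x c 0 1 (int (p + 1) - int T - 1) = 0"
        using g k0 by (auto simp: start_cell Let_def sym_def split: if_splits)
      then have "\<sigma> (vE x 0 1 (p + 1) 0)" using sE(1)[OF _ k0(2) p1 s0] by simp
      then show False using N[OF sE(2)[OF _ k0(2) p1 s0]] by (auto simp: 2 cBlank_def)
    next
      case (3 a)
      have "\<sigma> (vC x 0 a)" using N[OF sC(2)[OF _ 3(1)]] by (auto simp: 3 cStart_def)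
      then show False using sC(1)[OF _ 3(1)] 3(2) by (simp add: lab_def conf_def start_config_def)
    next
      case (4 i)
      have w: "T + 1 < W" by (simp add: W_def)
      have "\<sigma> (vH x 0 i (T + 1))" using sH(1)[OF _ 4(1) w, of 0] start_cell(1)[OF 4(1)] by simp
      then show False using N[OF sH(2)[OF _ 4(1) w]] by (auto simp: 4 cHead_def T_def)
    next
      case (5 i)
      define s where "s = cell x c 0 i (int p - int T - 1)"
      have s: "s < 3" "isym x i p s"
        using start_cell(2)[OF 5(1), of x c "int p - int T - 1"] c
        by (auto simp: s_def isym_def Let_def sym_def T_def[symmetric] bit_def nat_diff_distrib le_diff_conv2 split: if_splits)
      then have "s < sy" using syms by simp
      then have "\<sigma> (vE x 0 i p s)" "vE x 0 i p s < nvars x" using sE[OF _ 5(1) p, of 0 s] by (auto simp: s_def)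
      then show False using N[of "vE x 0 i p s"] s by (auto simp: 5 cCell_def)
    next
      case (6 a i s)
      have t: "t \<le> T" using N[OF n0] by (auto simp: 6 cRead_def T_def)
      have "\<sigma> (vC x t a)" using N[OF sC(2)[OF t 6(1)]] by (auto simp: 6 cRead_def)
      moreover have "\<sigma> (vH x t i p)" using N[OF sH(2)[OF t 6(2) p]] by (auto simp: 6 cRead_def)
      moreover have "\<sigma> (vE x t i p s)" using N[OF sE(2)[OF t 6(2) p 6(3)]] by (auto simp: 6 cRead_def)
      ultimately show False
        using sC(1)[OF t 6(1)] sH(1)[OF t 6(2) p] sE(1)[OF t 6(2) p 6(3)] lab_read[OF 6(2), of x c t] 6(4) by simp
    next
      case (7 a a')
      have t: "t < T" using N[OF n0] by (auto simp: 7 cNext_def T_def)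
      then have t': "t \<le> T" "t + 1 \<le> T" by auto
      have "\<sigma> (vC x t a)" using N[OF sC(2)[OF t'(1) 7(1)]] by (auto simp: 7 cNext_def)
      moreover have "\<sigma> (vC x (t + 1) a')" using N[OF sC(2)[OF t'(2) 7(2)]] by (auto simp: 7 cNext_def)
      ultimately show False
        using sC(1)[OF t'(1) 7(1)] sC(1)[OF t'(2) 7(2)] conf_step(1)[OF k0(1), of x c t] 7(3) by (simp add: lab_def)
    next
      case (8 a i)
      have t: "t < T" using N[OF n0] by (auto simp: 8 cMove_def T_def)
      then have t': "t \<le> T" "t + 1 \<le> T" by auto
      have a: "labs ! a = lab x c t" using N[OF sC(2)[OF t'(1) 8(1)]] sC(1)[OF t'(1) 8(1)] by (auto simp: 8 cMove_def)
      have h: "head x c t i = int p - int T - 1" using N[OF sH(2)[OF t'(1) 8(2) p]] sH(1)[OF t'(1) 8(2) p] by (auto simp: 8 cMove_def)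
      note b = bound[OF h t'(1) 8(2)]
      define d where "d = snd (nac M (labs ! a) i)"
      have "int (shift p d) = int p + offset d" "shift p d < W" using b by (cases d; simp)+
      then have "head x c (t + 1) i = int (shift p d) - int T - 1" using conf_step(2)[OF 8(2), of x c t] h a by (simp add: d_def)
      then have "\<sigma> (vH x (t + 1) i (shift p d))" using sH(1)[OF t'(2) 8(2) \<open>shift p d < W\<close>] by blast
      then show False using N[OF sH(2)[OF t'(2) 8(2) \<open>shift p d < W\<close>]] by (auto simp: 8 cMove_def d_def)
    next
      case (9 a i)
      have t: "t < T" using N[OF n0] by (auto simp: 9 cWrite_def T_def)
      then have t': "t \<le> T" "t + 1 \<le> T" by auto
      have a: "labs ! a = lab x c t" using N[OF sC(2)[OF t'(1) 9(1)]] sC(1)[OF t'(1) 9(1)] by (auto simp: 9 cWrite_def)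
      have h: "head x c t i = int p - int T - 1" using N[OF sH(2)[OF t'(1) 9(2) p]] sH(1)[OF t'(1) 9(2) p] by (auto simp: 9 cWrite_def)
      define s where "s = fst (nac M (labs ! a) i)"
      have e: "cell x c (t + 1) i (int p - int T - 1) = s" using conf_step(3)[OF 9(2), of x c t] h a by (simp add: s_def)
      then have s: "s < sy" using cell_less[OF 9(2)] by blast
      have "\<sigma> (vE x (t + 1) i p s)" using sE(1)[OF t'(2) 9(2) p s] e by blast
      then show False using N[OF sE(2)[OF t'(2) 9(2) p s]] by (auto simp: 9 cWrite_def s_def)
    next
      case (10 i s)
      have t: "t < T" "p \<noteq> p'" using N[OF n0] by (auto simp: 10 cKeep_def T_def)
      then have t': "t \<le> T" "t + 1 \<le> T" by auto
      have h: "head x c t i = int p' - int T - 1" using N[OF sH(2)[OF t'(1) 10(1) p']] sH(1)[OF t'(1) 10(1) p'] by (auto simp: 10 cKeep_def)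
      have "cell x c t i (int p - int T - 1) = s"
        using N[OF sE(2)[OF t'(1) 10(1) p 10(2)]] sE(1)[OF t'(1) 10(1) p 10(2)] by (auto simp: 10 cKeep_def)
      then have "cell x c (t + 1) i (int p - int T - 1) = s" using conf_step(3)[OF 10(1), of x c t] h t(2) by simp
      then have "\<sigma> (vE x (t + 1) i p s)" using sE(1)[OF t'(2) 10(1) p 10(2)] by blast
      then show False using N[OF sE(2)[OF t'(2) 10(1) p 10(2)]] by (auto simp: 10 cKeep_def)
    next
      case (11 a)
      have "\<sigma> (vC x T a)" using N[OF sC(2)[OF order.refl 11(1)]] by (auto simp: 11 cAccept_def T_def)
      then have "labs ! a = lab x c T" using sC(1)[OF order.refl 11(1)] by simp
      then show False using 11(2) acc lab_read[OF k0(1), of x c T] by (auto simp: accepts_def T_def[symmetric] lab_def)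
    next
      case (12 s)
      have h: "head x c T 0 = int p - int T - 1"
        using N[OF sH(2)[OF order.refl k0(1) p]] sH(1)[OF order.refl k0(1) p] by (auto simp: 12 cEnd_def T_def)
      have p1: "p + 1 < W" using bound(2)[OF h order.refl k0(1)] .
      have "cell x c T 0 (int (p + 1) - int T - 1) = s"
        using N[OF sE(2)[OF order.refl k0(1) p1 12(2)]] sE(1)[OF order.refl k0(1) p1 12(2)] by (auto simp: 12 cEnd_def T_def)
      moreover have "int (p + 1) - int T - 1 = head x c T 0 + 1" using h by simp
      ultimately show False using acc 12(1) by (simp add: accepts_def T_def[symmetric])
    qed
  qed
  then show ?thesis unfolding satisfies_def W_def T_def by blast
qed

end

text \<open>Bits are never encoded by the blank, so two cells decide whether the result is
  \<open>[True]\<close>.\<close>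

lemma tape_word_True: "tape_word T y \<Longrightarrow> fst T (snd T) = 2 \<Longrightarrow> fst T (snd T + 1) = 0 \<Longrightarrow> y = [True]"
proof -
  assume y: "tape_word T y" "fst T (snd T) = 2" "fst T (snd T + 1) = 0"
  show "y = [True]"
  proof (cases y)
    case Nil
    then show ?thesis using y by (simp add: tape_word_def)
  next
    case (Cons b z)
    have "sym b = 2" using y(1,2) Cons by (auto simp: tape_word_def)
    moreover have "z = []"
    proof (rule ccontr)
      assume "z \<noteq> []"
      then have "fst T (snd T + int 1) = sym (y ! 1)"
        using y(1)[unfolded tape_word_def, THEN conjunct1, rule_format, of 1] Cons by simp
      then show False using y(3) by (simp add: sym_def split: if_splits)
    qed
    ultimately show ?thesis using Cons by (simp add: sym_def split: if_splits)
  qed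
qed

lemma NP_reducible:
  assumes X: "Temporal Next \<in> Ut" and L: "L \<in> NP"
  shows "poly_reducible L (CTL_Learn Ut Bl n)"
proof -
  obtain V q where V: "polytime 2 V" and Lq: "\<And>x. x \<in> L \<longleftrightarrow> (\<exists>c. length c \<le> poly q (length x) \<and> V [x, c] = [True])"
    using L by (auto simp: NP_def)
  obtain M p where M: "is_tm M" "2 \<le> num_tapes M"
    and comp: "\<And>xs. length xs = 2 \<Longrightarrow> computes_within M xs (V xs) (poly p (sum_list (map length xs)))"
    using V by (auto simp: polytime_def)
  obtain labs where labs: "set labs = labels M" using finite_list[OF finite_labels] by blast
  define qb where "qb x = poly q (length x)" for x :: "bool list"
  \<comment> \<open>The first summand bounds the running time for all admissible certificates; the
    second keeps the guessed zone inside the window of positions.\<close>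
  define TT where "TT x = poly p (length x + qb x) + qb x" for x
  interpret tableau M TT qb labs
    by unfold_locales (use M labs in \<open>auto simp: TT_def\<close>)
  have acc: "V [x, c] = [True] \<longleftrightarrow> accepts x c" if "length c \<le> qb x" for x c
  proof -
    have t: "poly p (length x + length c) \<le> TT x"
      unfolding TT_def using poly_nat_mono[of "length x + length c" "length x + qb x" p] that by simp
    obtain Ts where Ts: "(step M ^^ poly p (length x + length c)) (start_config M [x, c]) = (num_states M, Ts)"
      "tape_word (hd Ts) (V [x, c])"
      using comp[of "[x, c]"] by (auto simp: computes_within_def Let_def split: prod.splits)
    \<comment> \<open>Steps after halting change nothing, so acceptance may be tested at the common
      time \<open>TT x\<close>.\<close>
    obtain u where u: "TT x = poly p (length x + length c) + u" using t le_Suc_ex by blast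
    have cf: "conf x c (TT x) = (num_states M, Ts)"
      unfolding conf_def u by (rule funpow_compose[OF Ts(1) steps_halted])
    have "length Ts = num_tapes M" using conf_good[of x c "TT x"] by (simp add: good_def cf)
    then have "hd Ts = Ts ! 0" using M(2) by (intro hd_conv_nth) auto
    then have w: "tape_word (Ts ! 0) (V [x, c])" using Ts(2) by simp
    have a: "accepts x c \<longleftrightarrow> fst (Ts ! 0) (snd (Ts ! 0)) = 2 \<and> fst (Ts ! 0) (snd (Ts ! 0) + 1) = 0"
      by (simp add: accepts_def cell_def head_def cf)
    show ?thesis
    proof
      assume "V [x, c] = [True]"
      then show "accepts x c" using w unfolding a by (auto simp: tape_word_def sym_def)
    qed (use a tape_word_True[OF w] in blast)
  qed
  obtain Cs where Cs: "set Cs = clauses" using finite_list[OF finite_clauses] by blast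
  have pnq: "pn (\<lambda>ws ns. qb (word ws 0))" unfolding qb_def by (intro pn_intros)
  have pnT: "pn (\<lambda>ws ns. TT (word ws 0))" unfolding TT_def by (intro pn_intros pnq)
  show ?thesis
  proof (rule clauses_reducible[OF X, where k = nvars and m = "\<lambda>x. 2 * TT x + 3" and T = Cs])
    show "pn (\<lambda>ws ns. nvars (word ws 0))" by (rule pn_nvars[OF pnT])
    show "pn (\<lambda>ws ns. 2 * TT (word ws 0) + 3)" by (intro pn_intros pnT)
    show "pb (\<lambda>ws ns. C (word ws 0) (ns 4) (ns 3) (ns 2) b (F ws ns))" if "C \<in> set Cs" "pn F" for C b F
      using pb_clauses[OF pnT pnq that(2)] that(1) Cs by blast
    have "x \<in> L \<longleftrightarrow> (\<exists>\<sigma>. satisfies x \<sigma>)" for x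
      unfolding Lq qb_def[symmetric] using acc[of _ x] satisfies_accepts[of x] accepts_satisfies[of _ x] by blast
    then show "x \<in> L \<longleftrightarrow> (\<exists>\<sigma>. \<forall>C\<in>set Cs. \<forall>h<2 * TT x + 3. \<forall>i<2 * TT x + 3. \<forall>j<2 * TT x + 3. \<exists>v<nvars x. C x h i j (\<sigma> v) v)" for x
      unfolding satisfies_def Cs .
  qed
qed

theorem theorem5:
  fixes Ut :: "unary_op set" and Bl :: "bin_op set" and n :: nat
  assumes "Temporal Next \<in> Ut"
  shows "NP_complete (CTL_Learn Ut Bl n)"
  unfolding NP_complete_def NP_hard_def using CTL_Learn_NP NP_reducible[OF assms] by blast

end
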